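(* Let $G=(V,E,w)$ be a $k$-connected vertex-weighted graph with $w:V\to\mathbb{N}$, and let $w_1,\dots,w_k\in\mathbb{N}$ with $\sum_{i=1}^k w_i=w(G)$ and $\min_{i\in[k]}w_i\ge\max_{v\in V}w(v)$. Then a connected $k$-partition $T_1,\dots,T_k$ of $V$ such that $w(T_i)\ge\frac13 w_i$ for every $i\in[k]$ (lower-bound version) can be computed in time $\mathcal{O}(k|V|^2|E|)$, and likewise a connected $k$-partition $T_1,\dots,T_k$ of $V$ such that $w(T_i)\le 3w_i$ for every $i\in[k]$ (upper-bound version) can be computed in time $\mathcal{O}(k|V|^2|E|)$.
   Context: $\mathbb{N}$ denotes the positive integers. For $U\subseteq V$, $w(U)=\sum_{u\in U}w(u)$ and $w(G)=w(V)$. A connected $k$-partition of $V$ is a partition $T_1,\dots,T_k$ of $V$ such that each induced subgraph $G[T_i]$ is connected. *)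

theory Defs
  imports Complex_Main "HOL-Library.Disjoint_Sets"
begin

section \<open>Graphs\<close>

text \<open>A finite simple undirected graph: edges are two-element sets of vertices.\<close>

definition simple_graph :: "'a set \<Rightarrow> 'a set set \<Rightarrow> bool" where
  "simple_graph V E \<longleftrightarrow> finite V \<and> (\<forall>e\<in>E. e \<subseteq> V \<and> card e = 2)"

definition induced_edges :: "'a set set \<Rightarrow> 'a set \<Rightarrow> 'a set set" where
  "induced_edges E U = {e \<in> E. e \<subseteq> U}"

text \<open>The graph without vertices does not count as connected.\<close>

definition connected_graph :: "'a set \<Rightarrow> 'a set set \<Rightarrow> bool" where
  "connected_graph V E \<longleftrightarrow>
     V \<noteq> {} \<and> (\<forall>u\<in>V. \<forall>v\<in>V. (u, v) \<in> {(x, y). {x, y} \<in> E}\<^sup>*)"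

definition k_connected :: "nat \<Rightarrow> 'a set \<Rightarrow> 'a set set \<Rightarrow> bool" where
  "k_connected k V E \<longleftrightarrow> k < card V \<and>
     (\<forall>X\<subseteq>V. card X < k \<longrightarrow> connected_graph (V - X) (induced_edges E (V - X)))"

text \<open>The parts are indexed by \<open>{1..k}\<close>; \<^const>\<open>partition_on\<close> makes all of them nonempty.\<close>

definition connected_partition :: "'a set \<Rightarrow> 'a set set \<Rightarrow> nat \<Rightarrow> (nat \<Rightarrow> 'a set) \<Rightarrow> bool" where
  "connected_partition V E k T \<longleftrightarrow>
     inj_on T {1..k} \<and> partition_on V (T ` {1..k}) \<and>
     (\<forall>i\<in>{1..k}. connected_graph (T i) (induced_edges E (T i)))"

definition gl_instance ::
    "'a set \<Rightarrow> 'a set set \<Rightarrow> ('a \<Rightarrow> nat) \<Rightarrow> nat \<Rightarrow> (nat \<Rightarrow> nat) \<Rightarrow> bool" where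
  "gl_instance V E w k ws \<longleftrightarrow>
     simple_graph V E \<and> 1 \<le> k \<and> k_connected k V E \<and>
     (\<forall>v\<in>V. 1 \<le> w v) \<and> (\<forall>i\<in>{1..k}. 1 \<le> ws i) \<and>
     (\<Sum>i=1..k. ws i) = (\<Sum>v\<in>V. w v) \<and>
     Min (ws ` {1..k}) \<ge> Max (w ` V)"


section \<open>The machine model\<close>

text \<open>
  A uniform-cost random access machine whose only arithmetic is addition and truncated
  subtraction of natural numbers (multiplication at unit cost would be unreasonably powerful).
  It is presented as a while language with named registers and named arrays.  A program mentions
  only finitely many arrays, so they can be interleaved in a single memory with constant
  overhead.
\<close>

type_synonym vname = string

record state =
  reg :: "vname \<Rightarrow> nat"
  arr :: "vname \<Rightarrow> nat \<Rightarrow> nat"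

datatype aexp =
    Const nat
  | Reg vname
  | Arr vname aexp
  | Add aexp aexp
  | Sub aexp aexp

datatype bexp =
    Less aexp aexp
  | Equal aexp aexp
  | Neg bexp
  | Conj bexp bexp

datatype com =
    Skip
  | Assign vname aexp
  | Store vname aexp aexp
  | Seq com com
  | Cond bexp com com
  | While bexp com

primrec aval :: "aexp \<Rightarrow> state \<Rightarrow> nat" where
  "aval (Const c) s = c"
| "aval (Reg x) s = reg s x"
| "aval (Arr a e) s = arr s a (aval e s)"
| "aval (Add e f) s = aval e s + aval f s"
| "aval (Sub e f) s = aval e s - aval f s"

primrec bval :: "bexp \<Rightarrow> state \<Rightarrow> bool" where
  "bval (Less e f) s \<longleftrightarrow> aval e s < aval f s"
| "bval (Equal e f) s \<longleftrightarrow> aval e s = aval f s"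
| "bval (Neg b) s \<longleftrightarrow> \<not> bval b s"
| "bval (Conj b c) s \<longleftrightarrow> bval b s \<and> bval c s"

primrec acost :: "aexp \<Rightarrow> nat" where
  "acost (Const c) = 1"
| "acost (Reg x) = 1"
| "acost (Arr a e) = acost e + 1"
| "acost (Add e f) = acost e + acost f + 1"
| "acost (Sub e f) = acost e + acost f + 1"

primrec bcost :: "bexp \<Rightarrow> nat" where
  "bcost (Less e f) = acost e + acost f + 1"
| "bcost (Equal e f) = acost e + acost f + 1"
| "bcost (Neg b) = bcost b + 1"
| "bcost (Conj b c) = bcost b + bcost c + 1"

text \<open>\<open>exec c s t s'\<close>: started in \<open>s\<close>, the program \<open>c\<close> halts in \<open>s'\<close> after exactly \<open>t\<close> steps.\<close>

inductive exec :: "com \<Rightarrow> state \<Rightarrow> nat \<Rightarrow> state \<Rightarrow> bool" where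
  Skip: "exec Skip s 1 s"
| Assign: "exec (Assign x e) s (acost e + 1) (s\<lparr>reg := (reg s)(x := aval e s)\<rparr>)"
| Store: "exec (Store a e f) s (acost e + acost f + 1)
    (s\<lparr>arr := (arr s)(a := (arr s a)(aval e s := aval f s))\<rparr>)"
| Seq: "exec c s t s' \<Longrightarrow> exec d s' t' s'' \<Longrightarrow> exec (Seq c d) s (t + t') s''"
| CondTrue: "bval b s \<Longrightarrow> exec c s t s' \<Longrightarrow> exec (Cond b c d) s (bcost b + 1 + t) s'"
| CondFalse: "\<not> bval b s \<Longrightarrow> exec d s t s' \<Longrightarrow> exec (Cond b c d) s (bcost b + 1 + t) s'"
| WhileFalse: "\<not> bval b s \<Longrightarrow> exec (While b c) s (bcost b + 1) s"
| WhileTrue: "bval b s \<Longrightarrow> exec c s t s' \<Longrightarrow> exec (While b c) s' t' s'' \<Longrightarrow>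
    exec (While b c) s (bcost b + 1 + t + t') s''"

lemma exec_deterministic:
  "exec c s t s' \<Longrightarrow> exec c s u r \<Longrightarrow> u = t \<and> r = s'"
proof (induction arbitrary: u r rule: exec.induct)
  case (Seq c s t s' d t' s'')
  from Seq.prems obtain u1 q u2 where "exec c s u1 q" "exec d q u2 r" "u = u1 + u2"
    by (cases rule: exec.cases) simp_all
  with Seq.IH show ?case by metis
next
  case (CondTrue b s c t s' d)
  from CondTrue.prems CondTrue.hyps(1) obtain u1 where "exec c s u1 r" "u = bcost b + 1 + u1"
    by (cases rule: exec.cases) simp_all
  with CondTrue.IH show ?case by metis
next
  case (CondFalse b s d t s' c)
  from CondFalse.prems CondFalse.hyps(1) obtain u1 where "exec d s u1 r" "u = bcost b + 1 + u1"
    by (cases rule: exec.cases) simp_all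
  with CondFalse.IH show ?case by metis
next
  case (WhileTrue b s c t s' t' s'')
  from WhileTrue.prems WhileTrue.hyps(1) obtain u1 q u2
    where "exec c s u1 q" "exec (While b c) q u2 r" "u = bcost b + 1 + u1 + u2"
    by (cases rule: exec.cases) simp_all
  with WhileTrue.IH show ?case by metis
next
  case (WhileFalse b s c)
  from WhileFalse.prems WhileFalse.hyps show ?case
    by (cases rule: exec.cases) simp_all
next
  case (Skip s)
  then show ?case by (cases rule: exec.cases) simp_all
next
  case (Assign x e s)
  then show ?case by (cases rule: exec.cases) simp_all
next
  case (Store a e f s)
  then show ?case by (cases rule: exec.cases) simp_all
qed


section \<open>Input and output\<close>

text \<open>
  The vertices are \<open>0, \<dots>, n - 1\<close>.  The edges are given as a list in which every edge occurs
  once, in an arbitrary order and with arbitrarily ordered endpoints.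
\<close>

definition edge_list :: "(nat \<times> nat) list \<Rightarrow> nat set set \<Rightarrow> bool" where
  "edge_list es E \<longleftrightarrow>
     distinct (map (\<lambda>(u, v). {u, v}) es) \<and> set (map (\<lambda>(u, v). {u, v}) es) = E"

text \<open>All registers and memory cells that do not hold the input are initially zero.\<close>

definition input_state ::
    "nat \<Rightarrow> (nat \<times> nat) list \<Rightarrow> (nat \<Rightarrow> nat) \<Rightarrow> nat \<Rightarrow> (nat \<Rightarrow> nat) \<Rightarrow> state" where
  "input_state n es w k ws = \<lparr>
     reg = (\<lambda>_. 0)(''n'' := n, ''m'' := length es, ''k'' := k),
     arr = (\<lambda>_ _. 0)(
       ''weight'' := (\<lambda>v. if v < n then w v else 0),
       ''target'' := (\<lambda>i. if i \<in> {1..k} then ws i else 0),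
       ''source'' := (\<lambda>j. if j < length es then fst (es ! j) else 0),
       ''sink'' := (\<lambda>j. if j < length es then snd (es ! j) else 0))\<rparr>"

definition output_part :: "nat \<Rightarrow> state \<Rightarrow> nat \<Rightarrow> nat set" where
  "output_part n s i = {v \<in> {..<n}. arr s ''part'' v = i}"

end

(* Give every vertex the weight c * w (c = 3 for the lower bound, c = 1 for the upper bound), so
   that in both cases w(T_i) >= w_i is the goal while weight above 3 w_i makes a part heavy.
   Parts are split off one at a time, always for the largest target w_j not yet served.  A heavy
   part T_b that cannot be split into connected sets of weight >= w_b and >= w_j is a star: it has a
   centre whose removal leaves only pieces of weight < w_j.  Such a centre is found by repeatedly
   moving it into the unique large piece.  Fewer than k centres do not disconnect the graph, so some
   piece of a heavy star is adjacent to another piece or to a light part, which absorbs it.  If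
   this makes a large piece in a star, then that star can be split.  A potential that counts the
   parts that are not yet stars and the pieces of the stars shows that a phase has O(k n) rounds
   of O(n^2) steps each; as 2 |E| >= k n, all phases together take O(k |V|^2 |E|) steps.
   For c = 3 some part is heavy until all targets are served.  For c = 1, once no part is heavy,
   non-cut vertices are split off as the remaining parts. *)
theory Submission
  imports Defs
begin

section \<open>For-programs and their running time\<close>

text \<open>The constant 3 is tied to serving the targets in decreasing order, which gives
  \<open>L j \<le> L b\<close> for every part \<open>b\<close> in use. A star gives away a piece
  lighter than \<open>L j\<close> only while it is heavy, so it always weighs more than
  \<open>3 * L b - L j\<close>. If a merger creates a piece of weight at least \<open>L j\<close> in
  it, the rest of the star still weighs more than \<open>3 * L b - 2 * L j \<ge> L b\<close>, and
  the piece can be split off. The obstacle is that a star may stop being heavy without being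
  settled, and that it may then absorb pieces of other stars. The clauses of \<open>invar\<close> on
  light stars keep just the information that makes the absorbed weight usable. The two kinds of
  steps pull in opposite directions: a merger reduces the number of pieces, whereas moving a centre
  may shatter a big piece into single vertices. The potential reconciles them by charging a big
  piece in advance for all its vertices.\<close>

datatype fcom =
    FSkip
  | FAssign vname aexp
  | FStore vname aexp aexp
  | FSeq fcom fcom
  | FIf bexp fcom fcom
  | FFor vname vname fcom

definition set_reg :: "vname \<Rightarrow> nat \<Rightarrow> state \<Rightarrow> state" where
  "set_reg x v s = s\<lparr>reg := (reg s)(x := v)\<rparr>"

definition set_arr :: "vname \<Rightarrow> nat \<Rightarrow> nat \<Rightarrow> state \<Rightarrow> state" where
  "set_arr a i v s = s\<lparr>arr := (arr s)(a := (arr s a)(i := v))\<rparr>"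

lemma set_reg_simps [simp]:
  "reg (set_reg x v s) y = (if y = x then v else reg s y)" "arr (set_reg x v s) = arr s"
  by (simp_all add: set_reg_def)

lemma set_arr_simps [simp]:
  "reg (set_arr a i v s) = reg s"
  "arr (set_arr a i v s) b = (if b = a then (arr s a)(i := v) else arr s b)"
  by (simp_all add: set_arr_def)

primrec iterate :: "(state \<Rightarrow> state) \<Rightarrow> vname \<Rightarrow> state \<Rightarrow> nat \<Rightarrow> state" where
  "iterate f x s 0 = set_reg x 0 s"
| "iterate f x s (Suc i) = set_reg x (Suc i) (f (iterate f x s i))"

primrec sem :: "fcom \<Rightarrow> state \<Rightarrow> state" where
  "sem FSkip s = s"
| "sem (FAssign x e) s = set_reg x (aval e s) s"
| "sem (FStore a e f) s = set_arr a (aval e s) (aval f s) s"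
| "sem (FSeq c d) s = sem d (sem c s)"
| "sem (FIf b c d) s = (if bval b s then sem c s else sem d s)"
| "sem (FFor x y c) s = iterate (sem c) x s (reg s y)"

text \<open>The compiled loop compares with its bound in every round while \<open>sem\<close> fixes
  the number of rounds on entry; \<open>well_formed\<close> forbids the body to write the bound or
  the counter, which makes the two agree.\<close>

primrec compile :: "fcom \<Rightarrow> com" where
  "compile FSkip = Skip"
| "compile (FAssign x e) = Assign x e"
| "compile (FStore a e f) = Store a e f"
| "compile (FSeq c d) = Seq (compile c) (compile d)"
| "compile (FIf b c d) = Cond b (compile c) (compile d)"
| "compile (FFor x y c) = Seq (Assign x (Const 0)) (While (Less (Reg x) (Reg y))
     (Seq (compile c) (Assign x (Add (Reg x) (Const 1)))))"

primrec wregs :: "fcom \<Rightarrow> vname set" where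
  "wregs FSkip = {}"
| "wregs (FAssign x e) = {x}"
| "wregs (FStore a e f) = {}"
| "wregs (FSeq c d) = wregs c \<union> wregs d"
| "wregs (FIf b c d) = wregs c \<union> wregs d"
| "wregs (FFor x y c) = insert x (wregs c)"

primrec warrs :: "fcom \<Rightarrow> vname set" where
  "warrs FSkip = {}"
| "warrs (FAssign x e) = {}"
| "warrs (FStore a e f) = {a}"
| "warrs (FSeq c d) = warrs c \<union> warrs d"
| "warrs (FIf b c d) = warrs c \<union> warrs d"
| "warrs (FFor x y c) = warrs c"

text \<open>\<open>Y\<close> is the set of registers that may serve as loop bounds; they are read-only.\<close>

primrec well_formed :: "vname set \<Rightarrow> fcom \<Rightarrow> bool" where
  "well_formed Y FSkip \<longleftrightarrow> True"
| "well_formed Y (FAssign x e) \<longleftrightarrow> x \<notin> Y"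
| "well_formed Y (FStore a e f) \<longleftrightarrow> True"
| "well_formed Y (FSeq c d) \<longleftrightarrow> well_formed Y c \<and> well_formed Y d"
| "well_formed Y (FIf b c d) \<longleftrightarrow> well_formed Y c \<and> well_formed Y d"
| "well_formed Y (FFor x y c) \<longleftrightarrow> x \<notin> Y \<and> y \<in> Y \<and> x \<notin> wregs c \<and> well_formed Y c"

primrec depth :: "fcom \<Rightarrow> nat" where
  "depth FSkip = 0"
| "depth (FAssign x e) = 0"
| "depth (FStore a e f) = 0"
| "depth (FSeq c d) = max (depth c) (depth d)"
| "depth (FIf b c d) = max (depth c) (depth d)"
| "depth (FFor x y c) = Suc (depth c)"

text \<open>In the loop case, 8 units pay for the test and the increment of a round, and 6 for the
  initialisation and the last test.\<close>

primrec factor :: "fcom \<Rightarrow> nat" where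
  "factor FSkip = 1"
| "factor (FAssign x e) = acost e + 1"
| "factor (FStore a e f) = acost e + acost f + 1"
| "factor (FSeq c d) = factor c + factor d"
| "factor (FIf b c d) = bcost b + 1 + factor c + factor d"
| "factor (FFor x y c) = factor c + 14"

lemma sem_reg [simp]: "x \<notin> wregs c \<Longrightarrow> reg (sem c s) x = reg s x"
proof (induction c arbitrary: s)
  case (FFor y z c)
  have "reg (iterate (sem c) y s i) x = reg s x" for i
    using FFor by (induction i) auto
  then show ?case by simp
qed auto

lemma sem_arr [simp]: "a \<notin> warrs c \<Longrightarrow> arr (sem c s) a = arr s a"
proof (induction c arbitrary: s)
  case (FFor y z c)
  have "arr (iterate (sem c) y s i) a = arr s a" for i
    using FFor by (induction i) auto
  then show ?case by simp
qed auto

lemma well_formed_wregs: "well_formed Y c \<Longrightarrow> wregs c \<inter> Y = {}"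
  by (induction c) auto

definition frame :: "fcom \<Rightarrow> state \<Rightarrow> state \<Rightarrow> bool" where
  "frame c s s' \<longleftrightarrow> (\<forall>x. x \<notin> wregs c \<longrightarrow> reg s' x = reg s x) \<and> (\<forall>a. a \<notin> warrs c \<longrightarrow> arr s' a = arr s a)"

text \<open>The frame condition is carried along, so \<open>P\<close> only has to describe what the
  loop changes.\<close>

lemma for_invariant:
  assumes "P 0 (set_reg x 0 s)"
    and "x \<notin> wregs c" "x \<noteq> y"
    and step: "\<And>i s'. i < reg s y \<Longrightarrow> frame (FFor x y c) s s' \<Longrightarrow> reg s' x = i \<Longrightarrow> P i s' \<Longrightarrow>
      P (Suc i) (set_reg x (Suc i) (sem c s'))"
  shows "P (reg s y) (sem (FFor x y c) s)"
proof -
  have "i \<le> reg s y \<Longrightarrow> P i (iterate (sem c) x s i) \<and> reg (iterate (sem c) x s i) x = i \<and>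
      frame (FFor x y c) s (iterate (sem c) x s i)" for i
  proof (induction i)
    case 0
    then show ?case using assms(1) by (simp add: frame_def)
  next
    case (Suc i)
    then have "P (Suc i) (set_reg x (Suc i) (sem c (iterate (sem c) x s i)))"
      by (intro step) auto
    then show ?case using Suc assms(2) by (simp add: frame_def)
  qed
  then show ?thesis by simp
qed

text \<open>A program with nesting depth \<open>d\<close> of for-loops bounded by \<open>N\<close> runs in time
  \<open>O((N + 1)\<^sup>d)\<close>, so only the while loops of the algorithm need a running time analysis.\<close>

lemma power_mult_mono:
  fixes N :: nat
  shows "d \<le> e \<Longrightarrow> a * (N + 1) ^ d \<le> a * (N + 1) ^ e"
  by (intro mult_le_mono2 power_increasing) auto

lemma le_mult_power:
  fixes N :: nat
  shows "a \<le> a * (N + 1) ^ e"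
  using power_mult_mono[of 0 e a N] by simp

lemma exec_compile:
  assumes "well_formed Y c" "\<And>y. y \<in> Y \<Longrightarrow> reg s y \<le> N"
  shows "\<exists>t. exec (compile c) s t (sem c s) \<and> t \<le> factor c * (N + 1) ^ depth c"
  using assms
proof (induction c arbitrary: s)
  case FSkip
  then show ?case by (auto intro!: exI exec.intros)
next
  case (FAssign x e)
  then show ?case using exec.Assign[of x e s] by (auto simp: set_reg_def)
next
  case (FStore a e f)
  then show ?case using exec.Store[of a e f s] by (auto simp: set_arr_def)
next
  case (FSeq c d)
  have d: "reg (sem c s) y \<le> N" if "y \<in> Y" for y
    using FSeq.prems that well_formed_wregs[of Y c] by (subst sem_reg) auto
  from FSeq.IH(1)[of s] FSeq.prems obtain t where
    t: "exec (compile c) s t (sem c s)" "t \<le> factor c * (N + 1) ^ depth c" by auto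
  from FSeq.IH(2)[of "sem c s"] FSeq.prems d obtain u where
    u: "exec (compile d) (sem c s) u (sem d (sem c s))" "u \<le> factor d * (N + 1) ^ depth d" by auto
  have "t \<le> factor c * (N + 1) ^ max (depth c) (depth d)"
    using t(2) power_mult_mono[of "depth c" "max (depth c) (depth d)" "factor c" N] by linarith
  moreover have "u \<le> factor d * (N + 1) ^ max (depth c) (depth d)"
    using u(2) power_mult_mono[of "depth d" "max (depth c) (depth d)" "factor d" N] by linarith
  ultimately show ?case using exec.Seq[OF t(1) u(1)] by (auto simp: add_mult_distrib)
next
  case (FIf b c d)
  let ?e = "max (depth c) (depth d)"
  have pos: "bcost b + 1 \<le> (bcost b + 1) * (N + 1) ^ ?e"
    by (rule le_mult_power)
  show ?case
  proof (cases "bval b s")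
    case True
    from FIf.IH(1)[of s] FIf.prems obtain t where
      t: "exec (compile c) s t (sem c s)" "t \<le> factor c * (N + 1) ^ depth c" by auto
    have "t \<le> factor c * (N + 1) ^ ?e"
      using t(2) power_mult_mono[of "depth c" ?e "factor c" N] by linarith
    then have "bcost b + 1 + t \<le> (bcost b + 1 + factor c) * (N + 1) ^ ?e"
      using pos by (simp add: add_mult_distrib)
    also have "\<dots> \<le> factor (FIf b c d) * (N + 1) ^ ?e" by (intro mult_le_mono1) simp
    finally show ?thesis using exec.CondTrue[OF True t(1)] True by auto
  next
    case False
    from FIf.IH(2)[of s] FIf.prems obtain t where
      t: "exec (compile d) s t (sem d s)" "t \<le> factor d * (N + 1) ^ depth d" by auto
    have "t \<le> factor d * (N + 1) ^ ?e"
      using t(2) power_mult_mono[of "depth d" ?e "factor d" N] by linarith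
    then have "bcost b + 1 + t \<le> (bcost b + 1 + factor d) * (N + 1) ^ ?e"
      using pos by (simp add: add_mult_distrib)
    also have "\<dots> \<le> factor (FIf b c d) * (N + 1) ^ ?e" by (intro mult_le_mono1) simp
    finally show ?thesis using exec.CondFalse[OF False t(1)] False by auto
  qed
next
  case (FFor x y c)
  let ?it = "iterate (sem c) x s" and ?M = "reg s y" and ?K = "factor c * (N + 1) ^ depth c"
  let ?W = "While (Less (Reg x) (Reg y)) (Seq (compile c) (Assign x (Add (Reg x) (Const 1))))"
  have xy: "x \<notin> Y" "y \<in> Y" "x \<notin> wregs c" "well_formed Y c" using FFor.prems by auto
  have out: "z \<notin> wregs c" if "z \<in> Y" for z using well_formed_wregs[OF xy(4)] that by auto
  have it: "reg (?it i) x = i \<and> (\<forall>z\<in>Y. reg (?it i) z = reg s z)" for i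
    using xy out by (induction i) auto
  \<comment> \<open>Each remaining round costs the body plus 8; the final 4 is the failing
    test.\<close>
  have loop: "i \<le> ?M \<Longrightarrow> \<exists>t. exec ?W (?it i) t (?it ?M) \<and> t \<le> (?M - i) * (?K + 8) + 4" for i
  proof (induction "?M - i" arbitrary: i)
    case 0
    then have i: "i = ?M" by simp
    then have "\<not> bval (Less (Reg x) (Reg y)) (?it i)" using it[of i] xy by simp
    then have "exec ?W (?it i) (bcost (Less (Reg x) (Reg y)) + 1) (?it i)" by (rule exec.WhileFalse)
    then show ?case using i by auto
  next
    case (Suc r)
    then have i: "i < ?M" by linarith
    have ih: "\<exists>t. exec ?W (?it (Suc i)) t (?it ?M) \<and> t \<le> (?M - Suc i) * (?K + 8) + 4"
      using Suc.hyps(2) i by (intro Suc.hyps(1)) linarith+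
    obtain t where t: "exec ?W (?it (Suc i)) t (?it ?M)" "t \<le> (?M - Suc i) * (?K + 8) + 4"
      using ih by blast
    have "\<exists>u. exec (compile c) (?it i) u (sem c (?it i)) \<and> u \<le> ?K"
      using FFor.prems it by (intro FFor.IH) auto
    then obtain u where u: "exec (compile c) (?it i) u (sem c (?it i))" "u \<le> ?K" by blast
    have "reg (sem c (?it i)) x = i" using xy it by simp
    then have "exec (Assign x (Add (Reg x) (Const 1))) (sem c (?it i)) 4 (?it (Suc i))"
      using exec.Assign[of x "Add (Reg x) (Const 1)" "sem c (?it i)"] by (simp add: set_reg_def eval_nat_numeral)
    from exec.WhileTrue[OF _ exec.Seq[OF u(1) this] t(1)]
    have "exec ?W (?it i) (bcost (Less (Reg x) (Reg y)) + 1 + (u + 4) + t) (?it ?M)"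
      using i it[of i] xy by simp
    moreover have "bcost (Less (Reg x) (Reg y)) + 1 + (u + 4) + t \<le> (?M - i) * (?K + 8) + 4"
    proof -
      have "?M - i = Suc (?M - Suc i)" using i by simp
      then show ?thesis using u(2) t(2) by simp
    qed
    ultimately show ?case by blast
  qed
  from loop[of 0] obtain t where t: "exec ?W (?it 0) t (?it ?M)" "t \<le> ?M * (?K + 8) + 4" by auto
  have "exec (Assign x (Const 0)) s 2 (?it 0)"
    using exec.Assign[of x "Const 0" s] by (simp add: set_reg_def numeral_2_eq_2)
  from exec.Seq[OF this t(1)] have e: "exec (compile (FFor x y c)) s (2 + t) (sem (FFor x y c) s)" by simp
  have "2 + t \<le> N * (?K + 8) + 6"
    using t(2) FFor.prems(2)[OF xy(2)] mult_le_mono1[of ?M N "?K + 8"] by linarith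
  also have "\<dots> \<le> (N + 1) * (?K + 14 * (N + 1) ^ depth c)"
  proof -
    have "N * (a + 8) + 6 \<le> (N + 1) * (a + 14 * Suc q)" for a q by (simp add: algebra_simps)
    moreover obtain q where "(N + 1) ^ depth c = Suc q"
      by (metis not0_implies_Suc power_not_zero Suc_eq_plus1 nat.distinct(2))
    ultimately show ?thesis by metis
  qed
  also have "\<dots> = factor (FFor x y c) * (N + 1) ^ depth (FFor x y c)"
    by (simp add: algebra_simps)
  finally show ?case using e by blast
qed

text \<open>All rounds obey the same time bound because the body never writes the registers in
  \<open>Y\<close>. The measure bounds the number of rounds, and the additional 1 pays for the last
  test.\<close>

lemma exec_while:
  fixes \<mu> :: "state \<Rightarrow> nat"
  assumes "well_formed Y c" "\<And>y. y \<in> Y \<Longrightarrow> reg s y \<le> N" "Q s"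
    and step: "\<And>s'. Q s' \<Longrightarrow> bval b s' \<Longrightarrow> Q (sem c s') \<and> \<mu> (sem c s') < \<mu> s'"
  shows "\<exists>t s'. exec (While b (compile c)) s t s' \<and> Q s' \<and> \<not> bval b s' \<and>
    t \<le> (\<mu> s + 1) * ((factor c + bcost b + 1) * (N + 1) ^ depth c)"
  using assms(2,3)
proof (induction "\<mu> s" arbitrary: s rule: less_induct)
  case less
  let ?F = "(factor c + bcost b + 1) * (N + 1) ^ depth c"
  have pos: "bcost b + 1 \<le> (bcost b + 1) * (N + 1) ^ depth c"
    by (rule le_mult_power)
  show ?case
  proof (cases "bval b s")
    case False
    have "bcost b + 1 \<le> ?F" using pos by (simp add: add_mult_distrib)
    then show ?thesis using exec.WhileFalse[OF False, of "compile c"] less.prems False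
      by (intro exI[of _ "bcost b + 1"] exI[of _ s]) (simp add: trans_le_add1)
  next
    case True
    obtain u where u: "exec (compile c) s u (sem c s)" "u \<le> factor c * (N + 1) ^ depth c"
      using exec_compile[OF assms(1) less.prems(1)] by blast
    have *: "Q (sem c s)" "\<mu> (sem c s) < \<mu> s" using step[OF less.prems(2) True] by auto
    have "reg (sem c s) y \<le> N" if "y \<in> Y" for y
      using less.prems(1)[OF that] well_formed_wregs[OF assms(1)] that by (subst sem_reg) auto
    from less.hyps[OF *(2) this *(1)] obtain t s' where t: "exec (While b (compile c)) (sem c s) t s'"
      "Q s'" "\<not> bval b s'" "t \<le> (\<mu> (sem c s) + 1) * ?F" by auto
    have "t \<le> \<mu> s * ?F" using t(4) *(2) mult_le_mono1[of "\<mu> (sem c s) + 1" "\<mu> s" ?F] by linarith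
    moreover have "bcost b + 1 + u \<le> ?F" using u(2) pos by (simp add: add_mult_distrib)
    ultimately have "bcost b + 1 + u + t \<le> (\<mu> s + 1) * ?F" by simp
    then show ?thesis using exec.WhileTrue[OF True u(1) t(1)] t by blast
  qed
qed

section \<open>Connected vertex sets\<close>

locale graph =
  fixes n :: nat and E :: "nat set set"
  assumes simple: "simple_graph {..<n} E"
begin

definition adj :: "nat \<Rightarrow> nat \<Rightarrow> bool" where
  "adj u v \<longleftrightarrow> {u, v} \<in> E"

lemma adj_sym: "adj u v \<Longrightarrow> adj v u"
  by (simp add: adj_def insert_commute)

text \<open>Closed subsets take the place of paths: unions and stars are then handled without
  concatenating walks.\<close>

definition conn :: "nat set \<Rightarrow> bool" where
  "conn S \<longleftrightarrow> S \<noteq> {} \<and>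
    (\<forall>X\<subseteq>S. X \<noteq> {} \<longrightarrow> (\<forall>x\<in>X. \<forall>y\<in>S. adj x y \<longrightarrow> y \<in> X) \<longrightarrow> X = S)"

lemma connD: "conn S \<Longrightarrow> X \<subseteq> S \<Longrightarrow> X \<noteq> {} \<Longrightarrow> (\<And>x y. x \<in> X \<Longrightarrow> y \<in> S \<Longrightarrow> adj x y \<Longrightarrow> y \<in> X) \<Longrightarrow> X = S"
  unfolding conn_def by blast

lemma conn_nonempty: "conn S \<Longrightarrow> S \<noteq> {}"
  by (simp add: conn_def)

text \<open>A closed set absorbs every walk that starts in it; conversely the set reachable from
  \<open>u\<close> is closed.\<close>

lemma connected_graph_iff_conn: "connected_graph S (induced_edges E S) \<longleftrightarrow> conn S"
proof
  let ?R = "{(x, y). {x, y} \<in> induced_edges E S}"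
  have R: "(x, y) \<in> ?R \<longleftrightarrow> adj x y \<and> x \<in> S \<and> y \<in> S" for x y
    by (auto simp: adj_def induced_edges_def)
  {
    assume c: "connected_graph S (induced_edges E S)"
    show "conn S" unfolding conn_def
    proof (intro conjI allI impI)
      show "S \<noteq> {}" using c by (simp add: connected_graph_def)
      fix X assume X: "X \<subseteq> S" "X \<noteq> {}" "\<forall>x\<in>X. \<forall>y\<in>S. adj x y \<longrightarrow> y \<in> X"
      then obtain x where x: "x \<in> X" by blast
      have "y \<in> X" if "y \<in> S" for y
      proof -
        have "(x, y) \<in> ?R\<^sup>*" using c x X that unfolding connected_graph_def by blast
        then show ?thesis
        proof (induction rule: rtrancl_induct)
          case (step y z)
          then show ?case using X R by blast
        qed (use x in simp)
      qed
      then show "X = S" using X by blast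
    qed
  next
    assume c: "conn S"
    show "connected_graph S (induced_edges E S)" unfolding connected_graph_def
    proof (intro conjI ballI)
      show "S \<noteq> {}" using c by (rule conn_nonempty)
      fix u v assume u: "u \<in> S" and v: "v \<in> S"
      have "{y\<in>S. (u, y) \<in> ?R\<^sup>*} = S"
      proof (rule connD[OF c])
        show "{y\<in>S. (u, y) \<in> ?R\<^sup>*} \<noteq> {}" using u by auto
        fix x y assume "x \<in> {y\<in>S. (u, y) \<in> ?R\<^sup>*}" "y \<in> S" "adj x y"
        then show "y \<in> {y\<in>S. (u, y) \<in> ?R\<^sup>*}"
          using R[of x y] by (auto intro: rtrancl_into_rtrancl)
      qed auto
      then show "(u, v) \<in> ?R\<^sup>*" using v by blast
    qed
  }
qed

lemma conn_singleton [simp]: "conn {x}"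
  unfolding conn_def by blast

lemma conn_piece:
  assumes "conn K" "K \<subseteq> S" "X \<inter> K \<noteq> {}" "\<forall>x\<in>X. \<forall>y\<in>S. adj x y \<longrightarrow> y \<in> X"
  shows "K \<subseteq> X"
proof -
  have "X \<inter> K = K"
  proof (rule connD[OF assms(1)])
    fix x y assume "x \<in> X \<inter> K" "y \<in> K" "adj x y"
    then show "y \<in> X \<inter> K" using assms(2,4) by blast
  qed (use assms(3) in auto)
  then show ?thesis by blast
qed

lemma conn_Un:
  assumes A: "conn A" and B: "conn B" and link: "a \<in> A" "b \<in> B" "a = b \<or> adj a b"
  shows "conn (A \<union> B)"
  unfolding conn_def
proof (intro conjI allI impI)
  show "A \<union> B \<noteq> {}" using conn_nonempty[OF A] by blast
  fix X assume X: "X \<subseteq> A \<union> B" "X \<noteq> {}" and cl: "\<forall>x\<in>X. \<forall>y\<in>A \<union> B. adj x y \<longrightarrow> y \<in> X"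
  have 1: "A \<subseteq> X" if "X \<inter> A \<noteq> {}"
    by (rule conn_piece[OF A _ that cl]) simp
  have 2: "B \<subseteq> X" if "X \<inter> B \<noteq> {}"
    by (rule conn_piece[OF B _ that cl]) simp
  have "X \<inter> A \<noteq> {} \<or> X \<inter> B \<noteq> {}" using X by blast
  then have "a \<in> X \<or> b \<in> X" using 1 2 link(1,2) by blast
  then have "a \<in> X \<and> b \<in> X" using link cl adj_sym[of a b] by auto
  then have "A \<subseteq> X" "B \<subseteq> X" using 1 2 link(1,2) by auto
  then show "X = A \<union> B" using X(1) by auto
qed

text \<open>A closed set contains \<open>s\<close> iff it contains \<open>u\<close>, because the
  connected set \<open>K\<close> through \<open>u\<close> has a neighbour of \<open>s\<close>. This
  serves the stars of the algorithm as well as the component of a newly inserted vertex.\<close>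

lemma conn_star:
  assumes s: "s \<in> S"
    and pieces: "\<And>u. u \<in> S \<Longrightarrow> u \<noteq> s \<Longrightarrow> \<exists>K\<subseteq>S. u \<in> K \<and> conn K \<and> (\<exists>x\<in>K. adj s x)"
  shows "conn S"
  unfolding conn_def
proof (intro conjI allI impI)
  show "S \<noteq> {}" using s by blast
  fix X assume X: "X \<subseteq> S" "X \<noteq> {}" and cl: "\<forall>x\<in>X. \<forall>y\<in>S. adj x y \<longrightarrow> y \<in> X"
  have link: "s \<in> X \<longleftrightarrow> u \<in> X" if u: "u \<in> S" "u \<noteq> s" for u
  proof -
    obtain K x where K: "K \<subseteq> S" "u \<in> K" "conn K" "x \<in> K" "adj s x"
      using pieces[OF u] by auto
    note piece = conn_piece[OF K(3,1) _ cl]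
    have "s \<in> X \<longleftrightarrow> x \<in> X" using cl K s adj_sym[OF K(5)] by auto
    also have "\<dots> \<longleftrightarrow> u \<in> X" using piece K(2,4) by auto
    finally show ?thesis .
  qed
  then have "s \<in> X" using X by (metis equals0I subsetD)
  then have "u \<in> X" if "u \<in> S" for u using link[OF that] by (cases "u = s") auto
  then show "X = S" using X(1) by auto
qed

text \<open>A maximal connected proper subset of \<open>S\<close> misses exactly one vertex.\<close>

lemma ex_noncut_vertex:
  assumes S: "conn S" "finite S" "card S \<ge> 2"
  shows "\<exists>v\<in>S. conn (S - {v})"
proof -
  let ?P = "\<lambda>R. R \<subset> S \<and> conn R"
  obtain x where "x \<in> S" using conn_nonempty[OF S(1)] by blast
  then have "?P {x}" using S(3) by (cases "S = {x}") auto
  moreover have "\<forall>R. ?P R \<longrightarrow> card R < Suc (card S)"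
    using S(2) by (auto intro!: card_mono simp: less_Suc_eq_le)
  ultimately have "\<exists>R. ?P R \<and> (\<forall>R'. ?P R' \<longrightarrow> card R' \<le> card R)" by (rule ex_has_greatest_nat)
  then obtain R where R: "?P R" and max: "\<And>R'. ?P R' \<Longrightarrow> card R' \<le> card R" by blast
  \<comment> \<open>Being a proper subset, \<open>R\<close> is not closed in \<open>S\<close>; the
    end \<open>v\<close> of a leaving edge can be added, and by maximality this already fills
    \<open>S\<close>.\<close>
  have "\<not> (\<forall>x\<in>R. \<forall>y\<in>S. adj x y \<longrightarrow> y \<in> R)"
    using S(1) R conn_nonempty[of R] unfolding conn_def by (metis psubset_eq)
  then obtain a v where a: "a \<in> R" "v \<in> S" "adj a v" "v \<notin> R" by blast
  have "conn (R \<union> {v})" using conn_Un[of R "{v}" a v] R a by simp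
  moreover have "card (R \<union> {v}) = Suc (card R)" using R S(2) a finite_subset[of R S] by auto
  ultimately have "\<not> R \<union> {v} \<subset> S" using max[of "R \<union> {v}"] by auto
  then have "S - {v} = R" using R a by blast
  then show ?thesis using R a by blast
qed

end

section \<open>Stars of pieces\<close>

definition fiber :: "nat \<Rightarrow> (nat \<Rightarrow> nat) \<Rightarrow> nat \<Rightarrow> nat set" where
  "fiber n f b = {v. v < n \<and> f v = b}"

lemma mem_fiber [simp]: "v \<in> fiber n f b \<longleftrightarrow> v < n \<and> f v = b"
  by (simp add: fiber_def)

lemma finite_fiber [simp]: "finite (fiber n f b)"
  by (simp add: fiber_def)

text \<open>The bound \<open>c \<le> 3\<close> ensures that a single vertex is never heavy, and
  \<open>1 \<le> c\<close> that the whole graph weighs at least the sum of the targets.\<close>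

locale partition_instance =
  fixes n :: nat and E :: "nat set set" and w :: "nat \<Rightarrow> nat" and k :: nat and L :: "nat \<Rightarrow> nat"
    and c :: nat
  assumes inst: "gl_instance {..<n} E w k L" and c: "1 \<le> c" "c \<le> 3"

sublocale partition_instance \<subseteq> graph n E
  using inst by unfold_locales (simp add: gl_instance_def)

context partition_instance
begin

abbreviation fib :: "(nat \<Rightarrow> nat) \<Rightarrow> nat \<Rightarrow> nat set" where
  "fib \<equiv> fiber n"

definition wt :: "nat set \<Rightarrow> nat" where
  "wt S = (\<Sum>v\<in>S. c * w v)"

definition heavy :: "(nat \<Rightarrow> nat) \<Rightarrow> nat \<Rightarrow> bool" where
  "heavy p b \<longleftrightarrow> 3 * L b < wt (fib p b)"

lemma k: "1 \<le> k" "k < n"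
  using inst by (simp_all add: gl_instance_def k_connected_def)

lemma L_pos: "i \<in> {1..k} \<Longrightarrow> 1 \<le> L i"
  using inst by (simp add: gl_instance_def)

lemma sum_L: "(\<Sum>i=1..k. L i) = (\<Sum>v<n. w v)"
  using inst by (simp add: gl_instance_def)

lemma wt_all: "wt {..<n} = c * (\<Sum>i=1..k. L i)"
  unfolding wt_def sum_L by (rule sum_distrib_left[symmetric])

lemma w_le_L:
  assumes "v < n" "i \<in> {1..k}"
  shows "w v \<le> L i"
proof -
  have "w v \<le> Max (w ` {..<n})" using assms by simp
  also have "\<dots> \<le> Min (L ` {1..k})" using inst by (simp add: gl_instance_def)
  also have "\<dots> \<le> L i" using assms by simp
  finally show ?thesis .
qed

lemma wt_Un: "finite A \<Longrightarrow> finite B \<Longrightarrow> A \<inter> B = {} \<Longrightarrow> wt (A \<union> B) = wt A + wt B"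
  unfolding wt_def by (rule sum.union_disjoint)

lemma wt_Diff: "finite B \<Longrightarrow> A \<subseteq> B \<Longrightarrow> wt (B - A) + wt A = wt B"
  unfolding wt_def by (rule sum.subset_diff[symmetric])

lemma wt_mono: "finite B \<Longrightarrow> A \<subseteq> B \<Longrightarrow> wt A \<le> wt B"
  unfolding wt_def by (rule sum_mono2) auto

lemma wt_empty [simp]: "wt {} = 0"
  by (simp add: wt_def)

text \<open>Every vertex carries the label of its piece, which is one of the vertices of the piece.
  A part \<open>b\<close> with \<open>z b = 0\<close> is a single piece; \<open>z b = Suc s\<close> makes it a star: its centre \<open>s\<close> is a
  piece of its own, and every other piece of the part is adjacent to \<open>s\<close>.\<close>

definition star :: "(nat \<Rightarrow> nat) \<Rightarrow> (nat \<Rightarrow> nat) \<Rightarrow> nat \<Rightarrow> nat \<Rightarrow> bool" where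
  "star p l b s \<longleftrightarrow> s < n \<and> p s = b \<and> fib l s = {s} \<and>
     (\<forall>u\<in>fib p b - {s}. \<exists>x\<in>fib l (l u). adj s x)"

text \<open>Only the remainder is tested here; whether the piece itself reaches \<open>L j\<close>
  is asked separately.\<close>

definition splits :: "(nat \<Rightarrow> nat) \<Rightarrow> (nat \<Rightarrow> nat) \<Rightarrow> nat \<Rightarrow> nat \<Rightarrow> bool" where
  "splits p l b x \<longleftrightarrow> L b \<le> wt (fib p b - fib l x)"

text \<open>In a heavy star the weights of the pieces are unrestricted: a big piece is split off or
  receives the centre. A star turns light only by giving away a piece lighter than
  \<open>L j\<close> while it is heavy, which explains the deficit of one \<open>L j\<close>. The
  centre of a light star is never moved, so each of its big pieces has to split.\<close>

definition invar :: "(nat \<Rightarrow> nat) \<Rightarrow> (nat \<Rightarrow> nat) \<Rightarrow> (nat \<Rightarrow> nat) \<Rightarrow> nat set \<Rightarrow> nat \<Rightarrow> bool" where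
  "invar p l z B j \<longleftrightarrow>
     B \<subseteq> {1..k} \<and> j \<in> {1..k} - B \<and> (\<forall>i\<in>{1..k} - B. L i \<le> L j) \<and> (\<forall>b\<in>B. L j \<le> L b) \<and>
     (\<forall>v<n. p v \<in> B \<and> l v < n \<and> l (l v) = l v \<and> p (l v) = p v \<and> conn (fib l (l v))) \<and>
     (\<forall>b\<in>B. L b \<le> wt (fib p b)) \<and>
     (\<forall>b\<in>B. z b = 0 \<longrightarrow> (\<forall>u\<in>fib p b. \<forall>v\<in>fib p b. l u = l v)) \<and>
     (\<forall>b\<in>B. \<forall>s. z b = Suc s \<longrightarrow> star p l b s \<and>
        (\<not> heavy p b \<longrightarrow> 3 * L b < wt (fib p b) + L j \<and>
           (\<forall>u\<in>fib p b - {s}. wt (fib l (l u)) < L j \<or> splits p l b (l u))))"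

text \<open>The state between two phases.\<close>

definition parts_invar :: "(nat \<Rightarrow> nat) \<Rightarrow> nat set \<Rightarrow> bool" where
  "parts_invar p B \<longleftrightarrow> B \<subseteq> {1..k} \<and> (\<forall>v<n. p v \<in> B) \<and>
     (\<forall>b\<in>B. conn (fib p b) \<and> L b \<le> wt (fib p b) \<and> (\<forall>i\<in>{1..k} - B. L i \<le> L b))"

definition pieces :: "(nat \<Rightarrow> nat) \<Rightarrow> (nat \<Rightarrow> nat) \<Rightarrow> (nat \<Rightarrow> nat) \<Rightarrow> nat \<Rightarrow> nat set" where
  "pieces p l z b = {x \<in> fib p b. l x = x \<and> z b \<noteq> Suc x}"

text \<open>A big piece that does not split may be broken up into pieces that are big again, so it
  is charged by its number of vertices. Any other piece only waits to be merged or split off. The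
  factor 2 leaves room for the extra piece that the old rest of the star becomes.\<close>

definition piece_potential :: "(nat \<Rightarrow> nat) \<Rightarrow> (nat \<Rightarrow> nat) \<Rightarrow> nat \<Rightarrow> nat \<Rightarrow> nat \<Rightarrow> nat" where
  "piece_potential p l j b x =
     (if L j \<le> wt (fib l x) \<and> \<not> splits p l b x then 2 * card (fib l x) else 1)"

text \<open>The value \<open>2 * n + 1\<close> exceeds the potential of any star that a first centre
  can create, which is at most 2 for each vertex other than the centre.\<close>

definition part_potential ::
    "(nat \<Rightarrow> nat) \<Rightarrow> (nat \<Rightarrow> nat) \<Rightarrow> (nat \<Rightarrow> nat) \<Rightarrow> nat \<Rightarrow> nat \<Rightarrow> nat" where
  "part_potential p l z j b =
     (if z b = 0 then 2 * n + 1 else \<Sum>x\<in>pieces p l z b. piece_potential p l j b x)"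

definition potential ::
    "(nat \<Rightarrow> nat) \<Rightarrow> (nat \<Rightarrow> nat) \<Rightarrow> (nat \<Rightarrow> nat) \<Rightarrow> nat set \<Rightarrow> nat \<Rightarrow> nat" where
  "potential p l z B j = (\<Sum>b\<in>B. part_potential p l z j b)"

lemma finite_pieces [simp]: "finite (pieces p l z b)"
  by (rule finite_subset[of _ "fib p b"]) (auto simp: pieces_def)

end

section \<open>Consequences of the invariant\<close>

locale phase = partition_instance +
  fixes p l z :: "nat \<Rightarrow> nat" and B :: "nat set" and j :: nat
  assumes inv: "invar p l z B j"
begin

lemma invB: "B \<subseteq> {1..k}" "j \<in> {1..k}" "j \<notin> B" "b \<in> B \<Longrightarrow> L j \<le> L b"
    "i \<in> {1..k} - B \<Longrightarrow> L i \<le> L j"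
  using inv unfolding invar_def by (elim conjE, blast)+

lemma finite_B: "finite B"
  using invB(1) by (rule finite_subset) simp

lemma L_j_pos: "1 \<le> L j"
  using invB(2) by (rule L_pos)

lemma L_B_pos: "b \<in> B \<Longrightarrow> 1 \<le> L b"
  using invB(1) by (intro L_pos) auto

lemma invV: "v < n \<Longrightarrow> p v \<in> B" "v < n \<Longrightarrow> l v < n" "v < n \<Longrightarrow> l (l v) = l v"
    "v < n \<Longrightarrow> p (l v) = p v" "v < n \<Longrightarrow> conn (fib l (l v))"
  using inv unfolding invar_def by (elim conjE, blast)+

lemma invW: "b \<in> B \<Longrightarrow> L b \<le> wt (fib p b)"
  using inv unfolding invar_def by (elim conjE, blast)

lemma invZ: "b \<in> B \<Longrightarrow> z b = 0 \<Longrightarrow> u \<in> fib p b \<Longrightarrow> v \<in> fib p b \<Longrightarrow> l u = l v"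
  using inv unfolding invar_def by (elim conjE, blast)

lemma invS: "b \<in> B \<Longrightarrow> z b = Suc s \<Longrightarrow> star p l b s"
    "b \<in> B \<Longrightarrow> z b = Suc s \<Longrightarrow> \<not> heavy p b \<Longrightarrow> 3 * L b < wt (fib p b) + L j"
    "b \<in> B \<Longrightarrow> z b = Suc s \<Longrightarrow> \<not> heavy p b \<Longrightarrow> u \<in> fib p b - {s} \<Longrightarrow>
      wt (fib l (l u)) < L j \<or> splits p l b (l u)"
  using inv unfolding invar_def by (elim conjE, blast)+

lemma star_weight: "b \<in> B \<Longrightarrow> z b \<noteq> 0 \<Longrightarrow> 3 * L b < wt (fib p b) + L j"
  using invS(2)[of b] by (cases "z b"; cases "heavy p b") (auto simp: heavy_def)

lemma same_label: "u < n \<Longrightarrow> v < n \<Longrightarrow> l u = l v \<Longrightarrow> p u = p v"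
  using invV(4) by metis

lemma piece_subset: "u < n \<Longrightarrow> fib l (l u) \<subseteq> fib p (p u)"
  by (auto intro: same_label)

lemma label_centre: "u < n \<Longrightarrow> z (p u) = Suc s \<Longrightarrow> l u = s \<longleftrightarrow> u = s"
  using invS(1)[OF invV(1), of u s] by (auto simp: star_def set_eq_iff)

lemma piece_label: "u < n \<Longrightarrow> z (p u) \<noteq> Suc u \<Longrightarrow> l u \<in> pieces p l z (p u)"
  using label_centre[of u "l u"] invV[of u] by (auto simp: pieces_def)

text \<open>The remaining pieces are still attached to the centre. This is the benefit of a star:
  any piece can be taken out without disconnecting the others.\<close>

lemma conn_rest:
  assumes b: "b \<in> B" "z b = Suc s" and x: "x \<noteq> s"
  shows "conn (fib p b - fib l x)"
proof (rule conn_star[of s])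
  have star: "star p l b s" using invS(1) b by blast
  show "s \<in> fib p b - fib l x" using star x by (auto simp: star_def set_eq_iff)
  fix u assume u: "u \<in> fib p b - fib l x" "u \<noteq> s"
  show "\<exists>K\<subseteq>fib p b - fib l x. u \<in> K \<and> conn K \<and> (\<exists>x\<in>K. adj s x)"
  proof (intro exI[of _ "fib l (l u)"] conjI)
    show "fib l (l u) \<subseteq> fib p b - fib l x" using u piece_subset[of u] by auto
    show "\<exists>x\<in>fib l (l u). adj s x" using star u by (auto simp: star_def)
  qed (use u invV in auto)
qed

lemma conn_part:
  assumes b: "b \<in> B"
  shows "conn (fib p b)"
proof (cases "z b")
  case 0
  have "fib p b \<noteq> {}" using invW[OF b] L_B_pos[OF b] by auto
  then obtain u where u: "u \<in> fib p b" by blast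
  have "fib p b \<subseteq> fib l (l u)" using invZ[OF b 0 _ u] by (intro subsetI) simp
  moreover have "fib l (l u) \<subseteq> fib p b" using piece_subset[of u] u by simp
  ultimately have "fib p b = fib l (l u)" by (rule antisym)
  then show ?thesis using invV(5) u by simp
next
  case (Suc s)
  \<comment> \<open>No vertex has label \<open>n\<close>, so taking out its fibre removes nothing
    and \<open>conn_rest\<close> covers the whole part.\<close>
  have "fib l n = {}" using invV(2) by fastforce
  moreover have "n \<noteq> s" using invS(1)[OF b Suc] by (simp add: star_def)
  ultimately show ?thesis using conn_rest[OF b Suc, of n] by simp
qed

lemma parts_invar: "parts_invar p B"
  using invB(1) invV(1) invW conn_part order_trans[OF invB(5) invB(4)] unfolding parts_invar_def by auto

text \<open>Since \<open>j\<close> has the largest free target, the targets left over are at most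
  \<open>L j\<close>; so the order clause of \<open>parts_invar\<close> holds for the new part,
  too.\<close>

lemma split_part:
  assumes b: "b \<in> B" and S: "S \<subseteq> fib p b" "conn S" "conn (fib p b - S)"
    and W: "L j \<le> wt S" "L b \<le> wt (fib p b - S)"
    and p': "\<And>v. v < n \<Longrightarrow> p' v = (if v \<in> S then j else p v)"
  shows "parts_invar p' (insert j B)"
proof -
  have "v \<in> fib p' j \<longleftrightarrow> v \<in> S" for v
    using p'[of v] S(1) invV(1)[of v] invB(3) by (cases "v < n") auto
  then have "fib p' j = S" by blast
  moreover have "v \<in> fib p' b \<longleftrightarrow> v \<in> fib p b - S" for v
    using p'[of v] b invB(3) by (cases "v < n") auto
  then have "fib p' b = fib p b - S" by blast
  moreover have "fib p' a = fib p a" if a: "a \<in> B" "a \<noteq> b" for a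
  proof -
    have "v \<in> fib p' a \<longleftrightarrow> v \<in> fib p a" for v
      using a p'[of v] S(1) invB(3) by (cases "v < n") auto
    then show ?thesis by blast
  qed
  ultimately have "conn (fib p' a) \<and> L a \<le> wt (fib p' a)" if "a \<in> insert j B" for a
    using that assms invW conn_part by (cases "a = j"; cases "a = b") auto
  moreover have "L i \<le> L a" if "i \<in> {1..k} - insert j B" "a \<in> insert j B" for i a
    using that invB(5)[of i] order_trans[OF invB(5) invB(4), of i a] by auto
  moreover have "p' v \<in> insert j B" if "v < n" for v using p' that invV(1) by auto
  ultimately show ?thesis using invB(1,2) unfolding parts_invar_def by blast
qed

end

section \<open>Splitting a part and moving the centre of a star\<close>

context partition_instance
begin

text \<open>A phase starts without any star, so nothing about stars has to survive a split or the
  change of \<open>L j\<close>. The price is the full potential of every part.\<close>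

lemma new_phase:
  assumes parts: "parts_invar p B" and j: "j \<in> {1..k} - B" "\<And>i. i \<in> {1..k} - B \<Longrightarrow> L i \<le> L j"
    and l: "\<And>v. v < n \<Longrightarrow> l v < n \<and> p (l v) = p v"
      "\<And>u v. u < n \<Longrightarrow> v < n \<Longrightarrow> p u = p v \<Longrightarrow> l u = l v"
    and z: "\<And>b. b \<in> B \<Longrightarrow> z b = 0"
  shows "invar p l z B j"
proof -
  have P: "B \<subseteq> {1..k}" "v < n \<Longrightarrow> p v \<in> B" "b \<in> B \<Longrightarrow> conn (fib p b)"
    "b \<in> B \<Longrightarrow> L b \<le> wt (fib p b)" "b \<in> B \<Longrightarrow> L j \<le> L b" for v b
    using parts j(1) unfolding parts_invar_def by (elim conjE, blast)+
  have fib: "fib l (l v) = fib p (p v)" if "v < n" for v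
  proof -
    have "u \<in> fib l (l v) \<longleftrightarrow> u \<in> fib p (p v)" for u
      using l(1)[OF that] l(1)[of u] l(2)[of u v] that by (cases "u < n") auto
    then show ?thesis by blast
  qed
  show ?thesis unfolding invar_def
  proof (intro conjI allI ballI impI)
    fix v assume v: "v < n"
    show "p v \<in> B" "l v < n" "p (l v) = p v" using P(2) l(1) v by auto
    show "l (l v) = l v" using l(1)[OF v] l(2)[of "l v" v] v by simp
    show "conn (fib l (l v))" unfolding fib[OF v] using P(2,3) v by blast
  next
    fix b u v assume "u \<in> fib p b" "v \<in> fib p b"
    then show "l u = l v" using l(2)[of u v] by simp
  qed (use P j z in auto)
qed

lemma potential_new_phase: "(\<And>b. b \<in> B \<Longrightarrow> z b = 0) \<Longrightarrow> potential p l z B j = card B * (2 * n + 1)"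
  by (simp add: potential_def part_potential_def)

end

context phase
begin

lemma split_piece:
  assumes x: "x \<in> pieces p l z (p x)" "L j \<le> wt (fib l x)" "L (p x) \<le> wt (fib p (p x) - fib l x)"
    and p': "\<And>v. v < n \<Longrightarrow> p' v = (if l v = x then j else p v)"
  shows "parts_invar p' (insert j B)"
proof -
  have x': "x < n" "l x = x" "p x \<in> B" "z (p x) \<noteq> Suc x" using x(1) invV(1) by (auto simp: pieces_def)
  show ?thesis
  proof (rule split_part[OF \<open>p x \<in> B\<close>, of "fib l x"])
    show "fib l x \<subseteq> fib p (p x)" using piece_subset[of x] x' by simp
    show "conn (fib l x)" using invV(5)[of x] x' by simp
    show "conn (fib p (p x) - fib l x)"
    proof (cases "z (p x)")
      \<comment> \<open>A part consisting of one piece leaves nothing over, which cannot reach a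
        positive target.\<close>
      case 0
      have "fib p (p x) \<subseteq> fib l x"
        using invZ[OF \<open>p x \<in> B\<close> 0, of _ x] x' by (intro subsetI) simp
      then have "wt (fib p (p x) - fib l x) = 0" by (simp add: Diff_eq_empty_iff[THEN iffD2])
      then show ?thesis using x(3) L_B_pos[OF x'(3)] by simp
    next
      case (Suc s)
      then show ?thesis using conn_rest[OF x'(3) Suc, of x] x' by simp
    qed
    show "p' v = (if v \<in> fib l x then j else p v)" if "v < n" for v
      using p'[OF that] that by simp
  qed (use x in auto)
qed

text \<open>The roles are exchanged: the rest serves \<open>j\<close> and the piece keeps the label
  \<open>b\<close>. The part must be heavy because in a light star a big piece splits; hence the
  piece alone weighs more than \<open>2 * L b\<close>.\<close>

lemma split_rest:
  assumes x: "x \<in> pieces p l z b" "L j \<le> wt (fib l x)" "wt (fib p b - fib l x) < L b"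
      "L j \<le> wt (fib p b - fib l x)" "z b \<noteq> 0 \<or> heavy p b"
    and p': "\<And>v. v < n \<Longrightarrow> p' v = (if p v = b \<and> l v \<noteq> x then j else p v)"
  shows "parts_invar p' (insert j B)"
proof -
  have x': "x < n" "l x = x" "p x = b" "b \<in> B" "z b \<noteq> Suc x"
    using x(1) invV(1) by (auto simp: pieces_def)
  have sub: "fib l x \<subseteq> fib p b" using piece_subset[of x] x' by simp
  obtain s where s: "z b = Suc s"
  proof (cases "z b")
    case 0
    have "fib p b \<subseteq> fib l x"
      using invZ[OF \<open>b \<in> B\<close> 0, of _ x] x' by (intro subsetI) simp
    then have "wt (fib p b - fib l x) = 0" by (simp add: Diff_eq_empty_iff[THEN iffD2])
    then show ?thesis using x(4) L_j_pos by simp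
  qed
  have "heavy p b"
  proof (rule ccontr)
    assume "\<not> heavy p b"
    then have "splits p l b x" using invS(3)[OF x'(4) s, of x] x x' s by auto
    then show False using x(3) by (simp add: splits_def)
  qed
  then have W: "3 * L b < wt (fib p b - fib l x) + wt (fib l x)"
    using wt_Diff[of "fib p b" "fib l x"] sub by (simp add: heavy_def)
  have Diff: "fib p b - (fib p b - fib l x) = fib l x" using sub by blast
  show ?thesis
  proof (rule split_part[OF \<open>b \<in> B\<close>, of "fib p b - fib l x"])
    show "conn (fib p b - fib l x)" using conn_rest[OF \<open>b \<in> B\<close> s, of x] x' s by auto
    show "conn (fib p b - (fib p b - fib l x))" unfolding Diff using invV(5)[of x] x' by simp
    show "L b \<le> wt (fib p b - (fib p b - fib l x))" unfolding Diff using W x(3) by simp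
    show "p' v = (if v \<in> fib p b - fib l x then j else p v)" if "v < n" for v
      using p'[OF that] that by simp
  qed (use x in auto)
qed

end

definition (in graph) components :: "nat set \<Rightarrow> (nat \<Rightarrow> nat) \<Rightarrow> bool" where
  "components D f \<longleftrightarrow> (\<forall>u\<in>D. f u \<in> D \<and> f (f u) = f u \<and> conn {y \<in> D. f y = f u} \<and>
     (\<forall>y\<in>D. adj u y \<longrightarrow> f y = f u))"

text \<open>The remaining case for a big piece: the rest of the part is too light for either target.
  The new centre \<open>v\<close> is chosen next to the old centre, so that the entire rest becomes
  a single piece, labelled by the old centre and attached to \<open>v\<close>. Without an old centre
  there is no rest, and \<open>v\<close> is not constrained further.\<close>

locale recentring = phase +
  fixes x v :: nat and l' :: "nat \<Rightarrow> nat"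
  assumes x: "x < n" "l x = x" "z (p x) \<noteq> Suc x" and heavy: "heavy p (p x)"
    and big: "L j \<le> wt (fib l x)"
    and rest: "wt (fib p (p x) - fib l x) < L (p x)" "wt (fib p (p x) - fib l x) < L j"
    and v: "v \<in> fib l x" "\<And>s. z (p x) = Suc s \<Longrightarrow> adj s v"
    and l'_out: "\<And>u. u < n \<Longrightarrow> p u \<noteq> p x \<Longrightarrow> l' u = l u"
    and l'_rest: "\<And>u s. z (p x) = Suc s \<Longrightarrow> u < n \<Longrightarrow> p u = p x \<Longrightarrow> l u \<noteq> x \<Longrightarrow> l' u = s"
    and l'_v: "l' v = v"
    and comps: "components (fib l x - {v}) l'"
begin

abbreviation "b \<equiv> p x"
abbreviation "C \<equiv> fib l x"
abbreviation "D \<equiv> C - {v}"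
abbreviation "A \<equiv> fib p b - C"

lemma part_b: "b \<in> B"
  using invV(1) x by simp

lemma piece_C: "C \<subseteq> fib p b" "conn C" "x \<in> C"
  using piece_subset[of x] invV(5)[of x] x by auto

lemma A_empty: "z b = 0 \<Longrightarrow> A = {}"
  using invZ[OF part_b _, of _ x] x by auto

lemma centre:
  assumes "z b = Suc s"
  shows "s \<in> A" "star p l b s" "conn A"
proof -
  show "star p l b s" using invS(1)[OF part_b assms] .
  then have "s < n" "p s = b" "l s = s" by (auto simp: star_def set_eq_iff)
  moreover have "x \<noteq> s" using x assms by auto
  ultimately show "s \<in> A" by simp
  show "conn A" using conn_rest[OF part_b assms, of x] \<open>x \<noteq> s\<close> .
qed

lemma labels_D: "u \<in> D \<Longrightarrow> l' u \<in> D" "u \<in> D \<Longrightarrow> l' (l' u) = l' u" "u \<in> D \<Longrightarrow> conn {y \<in> D. l' y = l' u}"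
  "u \<in> D \<Longrightarrow> y \<in> D \<Longrightarrow> adj u y \<Longrightarrow> l' y = l' u"
  using comps unfolding components_def by blast+

lemma labels_A: "u \<in> A \<Longrightarrow> l' u \<in> A" "u \<in> A \<Longrightarrow> l' (l' u) = l' u" "u \<in> A \<Longrightarrow> u' \<in> A \<Longrightarrow> l' u' = l' u"
    "u \<in> A \<Longrightarrow> z b = Suc (l' u)"
proof -
  have *: "l' u = s" if "z b = Suc s" "u \<in> A" for u s using l'_rest[OF that(1)] that(2) by auto
  show "l' u \<in> A" "l' (l' u) = l' u" "u' \<in> A \<Longrightarrow> l' u' = l' u" "z b = Suc (l' u)" if "u \<in> A"
    using that *[of _ u] *[of _ "l' u"] *[of _ u'] A_empty centre(1) by (cases "z b"; auto)+
qed

lemma part_cases: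
  assumes "u < n"
  obtains "p u \<noteq> b" "l' u = l u" | "u = v" "l' u = v" | "u \<in> D" "l' u \<in> D" | "u \<in> A" "l' u \<in> A"
  using assms l'_out[OF assms] l'_v labels_D(1)[of u] labels_A(1)[of u] by (cases "u = v"; cases "u \<in> C"; cases "p u = b") auto

lemma vC: "v < n" "p v = b" "l v = x"
  using v piece_C by auto

lemma p_l':
  assumes u: "u < n"
  shows "l' u < n \<and> p (l' u) = p u"
  using u
proof (cases rule: part_cases)
  case 1
  then show ?thesis using invV(2,4)[OF u] by simp
next
  case 2
  then show ?thesis using vC by simp
next
  case 3
  then have "u \<in> fib p b" "l' u \<in> fib p b" using piece_C(1) by auto
  then show ?thesis by simp
next
  case 4
  then show ?thesis by simp
qed

lemma fib_out:
  assumes "u < n" "p u \<noteq> b"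
  shows "fib l' (l' u) = fib l (l u)"
proof -
  have "y \<in> fib l' (l' u) \<longleftrightarrow> y \<in> fib l (l u)" for y
    using assms l'_out[of u] l'_out[of y] p_l'[of y] p_l'[of u] invV(4)[of y] invV(4)[of u]
    by (cases "y < n"; cases "p y = b") auto
  then show ?thesis by blast
qed

lemma fib_v: "fib l' v = {v}"
proof -
  have "y \<in> fib l' v \<longleftrightarrow> y = v" for y
  proof (cases "y < n")
    case True
    then show ?thesis using p_l'[OF True] vC v l'_v by (cases rule: part_cases[OF True]) auto
  qed (use vC(1) in auto)
  then show ?thesis by blast
qed

lemma fib_D:
  assumes "u \<in> D"
  shows "fib l' (l' u) = {y \<in> D. l' y = l' u}"
proof -
  have u: "l' u \<in> D" "l' u \<in> fib p b" using labels_D(1)[OF assms] piece_C(1) by auto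
  have *: "y \<in> D" if y: "y < n" "l' y = l' u" for y
    using y(1)
  proof (cases rule: part_cases)
    case 1
    have "p (l' y) = p y" using p_l'[OF y(1)] ..
    then show ?thesis using 1 u(2) y(2) by simp
  next
    case 2
    then show ?thesis using u(1) y(2) by simp
  next
    case 4
    then show ?thesis using u(1) y(2) by simp
  qed
  show ?thesis
  proof (intro equalityI subsetI)
    fix y assume "y \<in> fib l' (l' u)"
    then show "y \<in> {y \<in> D. l' y = l' u}" using *[of y] by simp
  qed simp
qed

lemma fib_A:
  assumes "u \<in> A"
  shows "fib l' (l' u) = A"
proof -
  have u: "l' u \<in> A" using labels_A(1)[OF assms] .
  have *: "y \<in> A" if y: "y < n" "l' y = l' u" for y
    using y(1)
  proof (cases rule: part_cases)
    case 1
    have "p (l' y) = p y" using p_l'[OF y(1)] ..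
    then show ?thesis using 1 u y(2) by simp
  next
    case 2
    then show ?thesis using u v y(2) by simp
  next
    case 3
    then show ?thesis using u y(2) by simp
  qed
  show ?thesis
  proof (intro equalityI subsetI)
    fix y assume "y \<in> fib l' (l' u)"
    then show "y \<in> A" using *[of y] by simp
  next
    fix y assume "y \<in> A"
    then show "y \<in> fib l' (l' u)" using labels_A(3)[OF assms, of y] by simp
  qed
qed

text \<open>The piece \<open>C\<close> is connected, so some edge within \<open>C\<close> leaves
  each component of \<open>D\<close>, and it can only end in \<open>v\<close>. The rest
  \<open>A\<close> touches \<open>v\<close> through the old centre.\<close>

lemma star': "star p l' b v"
  unfolding star_def
proof (intro conjI ballI)
  fix u assume u: "u \<in> fib p b - {v}"
  then consider "u \<in> D" | "u \<in> A" by auto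
  then show "\<exists>y\<in>fib l' (l' u). adj v y"
  proof cases
    case 1
    let ?X = "{y \<in> D. l' y = l' u}"
    have "\<not> (\<forall>a\<in>?X. \<forall>y\<in>C. adj a y \<longrightarrow> y \<in> ?X)"
    proof
      assume "\<forall>a\<in>?X. \<forall>y\<in>C. adj a y \<longrightarrow> y \<in> ?X"
      then have "?X = C" using connD[OF piece_C(2), of ?X] 1 by blast
      then show False using v by blast
    qed
    then obtain a y where a: "a \<in> ?X" "y \<in> C" "adj a y" "y \<notin> ?X" by blast
    then have "y = v" using labels_D(4)[of a y] by auto
    then have "adj v a" using a adj_sym by blast
    then show ?thesis using a(1) fib_D[OF 1] by blast
  next
    case 2
    then obtain s where s: "z b = Suc s" using A_empty by (cases "z b") auto
    then have "adj v s" using v(2) adj_sym by blast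
    then show ?thesis using fib_A[OF 2] centre(1)[OF s] by blast
  qed
qed (use vC fib_v in auto)

abbreviation "z' \<equiv> z(b := Suc v)"

text \<open>Part \<open>b\<close> keeps its vertices and stays heavy, so the clauses on light stars
  concern only the other parts, whose labels are unchanged.\<close>

lemma invar': "invar p l' z' B j"
  unfolding invar_def
proof (intro conjI allI ballI impI)
  show "B \<subseteq> {1..k}" "j \<in> {1..k} - B" using invB by auto
  show "L i \<le> L j" if "i \<in> {1..k} - B" for i using invB that by blast
  show "L j \<le> L a" if "a \<in> B" for a using invB that by blast
  show "L a \<le> wt (fib p a)" if "a \<in> B" for a using invW that by blast
  fix u assume u: "u < n"
  show "p u \<in> B" using invV u by blast
  show "l' u < n" "p (l' u) = p u" using p_l'[OF u] by auto
  show "l' (l' u) = l' u"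
    using u
  proof (cases rule: part_cases)
    case 1
    then show ?thesis using l'_out[of "l u"] invV(2-4)[OF u] by simp
  next
    case 2
    then show ?thesis using l'_v by simp
  next
    case 3
    then show ?thesis using labels_D(2) by simp
  next
    case 4
    then show ?thesis using labels_A(2) by simp
  qed
  show "conn (fib l' (l' u))"
    using u
  proof (cases rule: part_cases)
    case 1
    then show ?thesis using fib_out[OF u] invV(5)[OF u] by simp
  next
    case 2
    then show ?thesis using fib_v by simp
  next
    case 3
    then show ?thesis using fib_D labels_D(3) by simp
  next
    case 4
    then show ?thesis using fib_A centre(3) labels_A(4) by simp
  qed
next
  fix a u v' assume "a \<in> B" "z' a = 0" "u \<in> fib p a" "v' \<in> fib p a"
  then show "l' u = l' v'" using invZ[of a u v'] l'_out[of u] l'_out[of v'] by (auto split: if_splits)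
next
  fix a s assume a: "a \<in> B" and s: "z' a = Suc s"
  have fib: "fib l' (l' u) = fib l (l u)" if "u \<in> fib p a" "a \<noteq> b" for u
    using fib_out[of u] that by auto
  show "star p l' a s"
  proof (cases "a = b")
    case True
    then show ?thesis using star' s by simp
  next
    case False
    then have st: "star p l a s" using invS(1)[OF a] s by simp
    then have "l' s = s" "fib l s = {s}" using l'_out[of s] False by (auto simp: star_def set_eq_iff)
    then have "fib l' s = {s}" using fib[of s] st False by (metis mem_fiber insertI1 star_def)
    then show ?thesis using st fib False by (auto simp: star_def)
  qed
  assume nh: "\<not> heavy p a"
  then have "a \<noteq> b" using heavy by blast
  then have z: "z a = Suc s" using s by simp
  show "3 * L a < wt (fib p a) + L j" using invS(2)[OF a z nh] .
  fix u assume u: "u \<in> fib p a - {s}"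
  show "wt (fib l' (l' u)) < L j \<or> splits p l' a (l' u)"
    using invS(3)[OF a z nh u] fib[of u] u \<open>a \<noteq> b\<close> by (simp add: splits_def)
qed

end

context phase
begin

lemma centre_label:
  assumes "star p l b s"
  shows "s < n" "p s = b" "l s = s" "fib l s = {s}" "y < n \<Longrightarrow> l y = s \<Longrightarrow> y = s"
proof -
  show "s < n" "p s = b" and *: "fib l s = {s}" using assms unfolding star_def by blast+
  have "s \<in> fib l s" using * by blast
  then show "l s = s" by simp
  assume "y < n" "l y = s"
  then have "y \<in> fib l s" by simp
  then show "y = s" using * by blast
qed

lemma potential_less_at:
  assumes "b \<in> B" "\<And>a. a \<in> B \<Longrightarrow> a \<noteq> b \<Longrightarrow> part_potential p' l' z' j a \<le> part_potential p l z j a"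
    "part_potential p' l' z' j b < part_potential p l z j b"
  shows "potential p' l' z' B j < potential p l z B j"
  unfolding potential_def using assms finite_B by (intro sum_strict_mono_ex1) (auto, metis le_less)

end

context recentring
begin

lemma part_potential_out:
  assumes a: "a \<in> B" "a \<noteq> b"
  shows "part_potential p l' z' j a = part_potential p l z j a"
proof -
  have "pieces p l' z' a = pieces p l z a"
    using a l'_out by (auto simp: pieces_def)
  moreover have "piece_potential p l' j a y = piece_potential p l j a y" if "y \<in> pieces p l z a" for y
  proof -
    have y: "y < n" "p y \<noteq> b" "l y = y" using that a by (auto simp: pieces_def)
    then have "fib l' y = fib l y" using fib_out[of y] l'_out[of y] by simp
    then show ?thesis by (simp add: piece_potential_def splits_def)
  qed
  ultimately show ?thesis using a by (simp add: part_potential_def)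
qed

text \<open>Centres are stored shifted by one: \<open>z b - 1\<close> is the old centre, now the
  label of the piece \<open>A\<close>.\<close>

lemma new_pieces: "pieces p l' z' b \<subseteq> (if z b = 0 then {} else {z b - 1}) \<union> l' ` D"
proof
  fix y assume "y \<in> pieces p l' z' b"
  then have y: "y < n" "p y = b" "l' y = y" "y \<noteq> v" by (auto simp: pieces_def)
  from y(1) show "y \<in> (if z b = 0 then {} else {z b - 1}) \<union> l' ` D"
  proof (cases rule: part_cases)
    case 3
    then show ?thesis using y by (metis UnI2 imageI)
  next
    case 4
    then show ?thesis using labels_A(4)[of y] y by auto
  qed (use y in auto)
qed

lemma sum_D: "(\<Sum>y\<in>l' ` D. card (fib l' y)) = card D"
proof -
  have "(\<Sum>y\<in>l' ` D. card (fib l' y)) = (\<Sum>y\<in>l' ` D. \<Sum>u\<in>{u \<in> D. l' u = y}. 1)"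
  proof (rule sum.cong)
    fix y assume "y \<in> l' ` D"
    then obtain u where "u \<in> D" "y = l' u" by blast
    then show "card (fib l' y) = (\<Sum>u\<in>{u \<in> D. l' u = y}. 1)" using fib_D by simp
  qed simp
  also have "\<dots> = (\<Sum>u\<in>D. 1)" by (rule sum.image_gen[symmetric]) simp
  finally show ?thesis by simp
qed

text \<open>The piece \<open>A\<close> weighs less than \<open>L j\<close> and counts 1. The other
  pieces are disjoint subsets of \<open>D\<close>, each counting at most twice its size, whether big
  or not.\<close>

lemma new_part_potential: "part_potential p l' z' j b \<le> (if z b = 0 then 0 else 1) + 2 * card D"
proof -
  let ?f = "piece_potential p l' j b" and ?S = "if z b = 0 then {} else {z b - 1}"
  have pos: "1 \<le> card (fib l' y)" if "y \<in> pieces p l' z' b" for y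
  proof -
    have "y \<in> fib l' y" using that by (auto simp: pieces_def)
    then have "fib l' y \<noteq> {}" by blast
    then show ?thesis by (simp add: card_gt_0_iff Suc_leI)
  qed
  have "part_potential p l' z' j b = (\<Sum>y\<in>pieces p l' z' b. ?f y)"
    by (simp add: part_potential_def)
  also have "\<dots> \<le> (\<Sum>y\<in>pieces p l' z' b. if y \<in> ?S then 1 else 2 * card (fib l' y))"
  proof (rule sum_mono)
    fix y assume y: "y \<in> pieces p l' z' b"
    show "?f y \<le> (if y \<in> ?S then 1 else 2 * card (fib l' y))"
    proof (cases "y \<in> ?S")
      case True
      then have s: "z b = Suc y" by (auto split: if_splits)
      then have "fib l' (l' y) = A" using fib_A[OF centre(1)[OF s]] by simp
      then have "fib l' y = A" using y by (simp add: pieces_def)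
      then show ?thesis using True rest by (simp add: piece_potential_def)
    next
      case False
      then show ?thesis using pos[OF y] by (simp add: piece_potential_def)
    qed
  qed
  also have "\<dots> \<le> (\<Sum>y\<in>?S \<union> l' ` D. if y \<in> ?S then 1 else 2 * card (fib l' y))"
    by (rule sum_mono2[OF _ new_pieces]) auto
  also have "\<dots> \<le> (\<Sum>y\<in>?S. if y \<in> ?S then 1 else 2 * card (fib l' y)) +
      (\<Sum>y\<in>l' ` D. if y \<in> ?S then 1 else 2 * card (fib l' y))"
    by (subst sum.union_inter[symmetric]) auto
  also have "(\<Sum>y\<in>?S. if y \<in> ?S then 1 else 2 * card (fib l' y)) = (if z b = 0 then 0 else 1)" by simp
  also have "(if z b = 0 then 0 else 1) + (\<Sum>y\<in>l' ` D. if y \<in> ?S then 1 else 2 * card (fib l' y))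
      \<le> (if z b = 0 then 0 else 1) + (\<Sum>y\<in>l' ` D. 2 * card (fib l' y))"
  proof (rule add_left_mono, rule sum_mono)
    fix y assume "y \<in> l' ` D"
    then have "y \<in> fib l' y" using labels_D(1,2) piece_C(1) by auto
    then have "fib l' y \<noteq> {}" by blast
    then have "1 \<le> card (fib l' y)" by (simp add: card_gt_0_iff Suc_leI)
    then show "(if y \<in> ?S then 1 else 2 * card (fib l' y)) \<le> 2 * card (fib l' y)" by simp
  qed
  also have "(\<Sum>y\<in>l' ` D. 2 * card (fib l' y)) = 2 * card D" using sum_D by (simp add: sum_distrib_left[symmetric])
  finally show ?thesis .
qed

text \<open>With an old centre, the piece \<open>C\<close> alone counted
  \<open>2 * card C = 2 * card D + 2\<close>, against at most \<open>2 * card D + 1\<close> now.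
  Without one, the part counted \<open>2 * n + 1\<close>.\<close>

lemma potential_decreases: "potential p l' z' B j < potential p l z B j"
proof (rule potential_less_at[OF part_b])
  show "part_potential p l' z' j a \<le> part_potential p l z j a" if "a \<in> B" "a \<noteq> b" for a
    using part_potential_out[OF that] by simp
  have card_C: "card C = Suc (card D)" using v by (intro card.remove) auto
  show "part_potential p l' z' j b < part_potential p l z j b"
  proof (cases "z b = 0")
    case True
    have "C \<subseteq> {..<n}" by auto
    then have "card C \<le> n" using card_mono[of "{..<n}" "C"] by simp
    then show ?thesis using new_part_potential True card_C by (simp add: part_potential_def)
  next
    case False
    have "x \<in> pieces p l z b" using x by (simp add: pieces_def)
    then have "piece_potential p l j b x \<le> part_potential p l z j b"
      using False by (simp add: part_potential_def member_le_sum)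
    moreover have "piece_potential p l j b x = 2 * card C"
      using big rest by (simp add: piece_potential_def splits_def)
    ultimately show ?thesis using new_part_potential False card_C by simp
  qed
qed

end

section \<open>Merging two adjacent pieces\<close>

locale merging = phase +
  fixes u v :: nat and p' l' :: "nat \<Rightarrow> nat"
  assumes small: "\<And>x. x \<in> pieces p l z (p x) \<Longrightarrow> L j \<le> wt (fib l x) \<Longrightarrow> z (p x) = 0"
    and u: "u < n" "z (p u) \<noteq> Suc u" and v: "v < n" "z (p v) \<noteq> Suc v"
    and uv: "adj u v" "l u \<noteq> l v" and star: "z (p u) \<noteq> 0" and heavy: "heavy p (p u)"
    and p': "\<And>y. y < n \<Longrightarrow> p' y = (if l y = l u then p v else p y)"
    and l': "\<And>y. y < n \<Longrightarrow> l' y = (if l y = l u then l v else l y)"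
begin

abbreviation "D \<equiv> fib l (l u)"
abbreviation "D' \<equiv> fib l (l v)"

text \<open>Mergers wait until every big piece of a star has been dealt with; this limits both the
  loss of the source and the size of the merged piece.\<close>

lemma small_piece: "y < n \<Longrightarrow> z (p y) \<noteq> Suc y \<Longrightarrow> z (p y) \<noteq> 0 \<Longrightarrow> wt (fib l (l y)) < L j"
  using small[of "l y"] piece_label[of y] invV(4)[of y] by force

lemma fib_l'_merged: "fib l' (l v) = D \<union> D'"
  using l' by (auto split: if_splits)

lemma fib_l'_other:
  assumes "x \<noteq> l u" "x \<noteq> l v"
  shows "fib l' x = fib l x"
  using l' assms by (auto split: if_splits)

lemma fib_p': "fib p' b = (fib p b - D) \<union> (if b = p v then D else {})"
  using p' by (auto split: if_splits)

lemma D_subset: "D \<subseteq> fib p (p u)" "D' \<subseteq> fib p (p v)"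
  using piece_subset u v by auto

lemma fib_p'_other: "b \<noteq> p u \<Longrightarrow> b \<noteq> p v \<Longrightarrow> fib p' b = fib p b"
  using fib_p' D_subset(1) by fastforce

lemma D_D': "D \<inter> D' = {}"
  using uv by auto

lemma conn_merged: "conn (D \<union> D')"
  using conn_Un[of D D' u v] invV(5) u v uv by auto

lemma L_u: "L j \<le> L (p u)" "L j \<le> L (p v)"
  using invB(4) invV(1) u v by auto

lemma wt_D: "wt D < L j"
  using small_piece u star by blast

lemma wt_source: "p u \<noteq> p v \<Longrightarrow> 3 * L (p u) < wt (fib p' (p u)) + L j"
proof -
  assume "p u \<noteq> p v"
  then have "fib p' (p u) = fib p (p u) - D" using fib_p' by simp
  then show ?thesis using wt_Diff[of "fib p (p u)" D] D_subset(1) wt_D heavy by (simp add: heavy_def)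
qed

lemma wt_target: "wt (fib p (p v)) \<le> wt (fib p' (p v))"
  using fib_p' by (intro wt_mono) auto

text \<open>Within one heavy part, two pieces lighter than \<open>L j\<close> are removed from more
  than \<open>3 * L (p v)\<close>. Across two parts only \<open>D'\<close> is removed from the old
  target part, but that star may already lack one \<open>L j\<close>. Either way more than
  \<open>3 * L (p v) - 2 * L j\<close> remains.\<close>

lemma splits_merged:
  assumes "z (p v) \<noteq> 0"
  shows "splits p' l' (p v) (l v)"
proof -
  have D': "wt D' < L j" using small_piece v assms by blast
  show ?thesis
  proof (cases "p u = p v")
    case True
    then have "fib p' (p v) - (D \<union> D') = fib p (p v) - (D \<union> D')" using fib_p' by auto
    moreover have "wt (fib p (p v) - (D \<union> D')) + wt (D \<union> D') = wt (fib p (p v))"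
      using D_subset True by (intro wt_Diff) auto
    moreover have "wt (D \<union> D') = wt D + wt D'" using D_D' by (intro wt_Un) auto
    ultimately show ?thesis
      using D' wt_D heavy True L_u by (simp add: splits_def fib_l'_merged heavy_def)
  next
    case False
    then have "D \<inter> fib p (p v) = {}" using D_subset(1) by auto
    then have "fib p' (p v) - (D \<union> D') = fib p (p v) - D'" using fib_p' by auto
    moreover have "wt (fib p (p v) - D') + wt D' = wt (fib p (p v))"
      using D_subset by (intro wt_Diff) auto
    moreover have "3 * L (p v) < wt (fib p (p v)) + L j"
      using star_weight[OF invV(1)] v assms by blast
    ultimately show ?thesis
      using D' L_u by (simp add: splits_def fib_l'_merged)
  qed
qed

text \<open>A piece may grow or leave its part, but never loses vertices, so the pieces that stay
  still touch their centre.\<close>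

lemma star':
  assumes b: "b \<in> B" and s: "z b = Suc s"
  shows "star p' l' b s"
proof -
  have st: "star p l b s" using invS(1)[OF b s] .
  note s' = centre_label[OF this]
  have "u \<noteq> s" "v \<noteq> s" using u v s s'(2) by auto
  then have su: "s \<noteq> l u" "s \<noteq> l v" using s'(5)[of u] s'(5)[of v] u v by auto
  have "\<exists>x\<in>fib l' (l' y). adj s x" if y: "y \<in> fib p' b - {s}" for y
  proof (cases "l y = l u \<or> l y = l v")
    case True
    then have l'y: "l' y = l v" using y l' by auto
    have "y < n" "p' y = b" using y by auto
    then have "p v = b" using True p'[of y] same_label[of y v] v(1) by metis
    then have "v \<in> fib p b - {s}" using v s by auto
    then have "\<exists>x\<in>D'. adj s x" using st by (auto simp: star_def)
    then show ?thesis unfolding l'y fib_l'_merged by blast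
  next
    case False
    then have "y \<in> fib p b - {s}" "l' y = l y" using y p'[of y] l'[of y] by auto
    moreover have "fib l' (l y) = fib l (l y)" using False by (intro fib_l'_other) auto
    ultimately show ?thesis using st by (simp add: star_def)
  qed
  moreover have "fib l' s = {s}" using fib_l'_other[OF su] s' by simp
  moreover have "p' s = b" using p'[of s] s' su by simp
  ultimately show ?thesis using s' by (simp add: star_def)
qed

lemma invar': "invar p' l' z B j"
  unfolding invar_def
proof (intro conjI allI ballI impI)
  show "B \<subseteq> {1..k}" "j \<in> {1..k} - B" using invB by auto
  show "L i \<le> L j" if "i \<in> {1..k} - B" for i using invB that by blast
  show "L j \<le> L a" if "a \<in> B" for a using invB that by blast
next
  fix y assume y: "y < n"
  show "p' y \<in> B" "l' y < n" using p' l' invV(1,2) y u v by auto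
  have lv: "l' (l v) = l v" "p' (l v) = p v"
    using l'[of "l v"] p'[of "l v"] invV(2-4)[OF v(1)] uv by auto
  show "l' (l' y) = l' y"
  proof (cases "l y = l u")
    case False
    then show ?thesis using l'[of y] l'[of "l y"] y invV(2,3)[OF y] by auto
  qed (use lv l'[of y] y in auto)
  show "p' (l' y) = p' y"
  proof (cases "l y = l u")
    case False
    then show ?thesis using l'[of y] p'[of y] p'[of "l y"] y invV(2-4)[OF y] by auto
  qed (use lv l'[of y] p'[of y] y in auto)
  show "conn (fib l' (l' y))"
  proof (cases "l y = l u \<or> l y = l v")
    case True
    then have "l' y = l v" using l' y by auto
    then show ?thesis using fib_l'_merged conn_merged by simp
  next
    case False
    then show ?thesis using fib_l'_other[of "l y"] l'[of y] y invV(5)[OF y] by simp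
  qed
next
  fix b assume b: "b \<in> B"
  consider "b = p v" | "b \<noteq> p v" "b = p u" | "b \<noteq> p v" "b \<noteq> p u" by blast
  then show "L b \<le> wt (fib p' b)"
  proof cases
    case 1
    then show ?thesis using wt_target invW[OF b] by simp
  next
    case 2
    then show ?thesis using wt_source L_u by simp
  next
    case 3
    then show ?thesis using fib_p'_other invW[OF b] by simp
  qed
next
  fix b y y' assume b: "b \<in> B" "z b = 0" and y: "y \<in> fib p' b" "y' \<in> fib p' b"
  have bu: "b \<noteq> p u" using b star by auto
  \<comment> \<open>The source is a star, so a part without centre can only receive
    \<open>D\<close>; then all its vertices share the label \<open>l v\<close>.\<close>
  have *: "l' a = (if b = p v then l v else l a) \<and> (b \<noteq> p v \<longrightarrow> p a = b)" if a: "a \<in> fib p' b" for a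
  proof (cases "l a = l u")
    case True
    then show ?thesis using a p'[of a] l'[of a] by auto
  next
    case False
    then have "p a = b" "l' a = l a" using a p'[of a] l'[of a] by auto
    then show ?thesis using invZ[OF b, of a v] a v by auto
  qed
  show "l' y = l' y'" using *[OF y(1)] *[OF y(2)] invZ[OF b, of y y'] y by (cases "b = p v") auto
next
  fix b s assume b: "b \<in> B" and s: "z b = Suc s"
  show "star p' l' b s" using star'[OF b s] .
  assume nh: "\<not> heavy p' b"
  \<comment> \<open>The case \<open>b = p u = p v\<close> is missing because that part keeps its
    weight and stays heavy.\<close>
  consider "b = p v" "b \<noteq> p u" | "b \<noteq> p v" "b = p u" | "b \<noteq> p v" "b \<noteq> p u"
    using nh wt_target heavy unfolding heavy_def by (metis order.strict_trans2)
  then show "3 * L b < wt (fib p' b) + L j"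
  proof cases
    case 1
    then show ?thesis using wt_target star_weight[OF b] s by simp
  next
    case 2
    then show ?thesis using wt_source by simp
  next
    case 3
    then show ?thesis using fib_p'_other star_weight[OF b] s by simp
  qed
  fix y assume y: "y \<in> fib p' b - {s}"
  show "wt (fib l' (l' y)) < L j \<or> splits p' l' b (l' y)"
  proof (cases "l y = l u \<or> l y = l v")
    case True
    then have l'y: "l' y = l v" using y l' by auto
    have "y < n" "p' y = b" using y by auto
    then have "p v = b" using True p'[of y] same_label[of y v] v(1) by metis
    then show ?thesis using splits_merged s l'y by simp
  next
    case False
    then have "fib l' (l' y) = fib l (l y)" "p y = b" using fib_l'_other[of "l y"] l'[of y] p'[of y] y by auto
    then show ?thesis using small_piece[of y] y s by simp
  qed
qed

lemma pieces': "pieces p' l' z b = pieces p l z b - {l u}"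
proof -
  have "y \<in> pieces p' l' z b \<longleftrightarrow> y \<in> pieces p l z b - {l u}" for y
  proof (cases "y < n")
    case True
    show ?thesis
    proof (cases "l y = l u")
      case True
      then show ?thesis using l'[of y] uv(2) invV(3)[OF u(1)] invV(3)[OF v(1)] \<open>y < n\<close>
        by (auto simp: pieces_def)
    next
      case False
      then show ?thesis using l'[of y] p'[of y] True invV(3)[OF u(1)] by (auto simp: pieces_def)
    qed
  qed (auto simp: pieces_def)
  then show ?thesis by blast
qed

text \<open>The moved piece takes over the label of the piece it joins, so the source loses a piece
  and no part gains one. In a star the enlarged piece splits and thus still counts 1, even if it is
  big now.\<close>

lemma potential_decreases: "potential p' l' z B j < potential p l z B j"
proof (rule potential_less_at[OF invV(1)[OF u(1)]])
  have old: "part_potential p l z j b = card (pieces p l z b)" if b: "b \<in> B" "z b \<noteq> 0" for b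
  proof -
    have "piece_potential p l j b x = 1" if x: "x \<in> pieces p l z b" for x
      using small[of x] x b by (force simp: piece_potential_def pieces_def)
    then show ?thesis using b by (simp add: part_potential_def)
  qed
  have new: "part_potential p' l' z j b = card (pieces p l z b - {l u})" if b: "b \<in> B" "z b \<noteq> 0" for b
  proof -
    have "piece_potential p' l' j b x = 1" if x: "x \<in> pieces p l z b - {l u}" for x
    proof (cases "x = l v")
      case True
      then have "b = p v" using x invV(4)[OF v(1)] by (auto simp: pieces_def)
      then show ?thesis using True splits_merged b by (simp add: piece_potential_def)
    next
      case False
      then have "fib l' x = fib l x" using x by (intro fib_l'_other) auto
      moreover have "wt (fib l x) < L j" using small[of x] x b by (force simp: pieces_def)
      ultimately show ?thesis by (simp add: piece_potential_def)
    qed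
    then show ?thesis using b by (simp add: part_potential_def pieces')
  qed
  show "part_potential p' l' z j a \<le> part_potential p l z j a" if "a \<in> B" "a \<noteq> p u" for a
  proof (cases "z a = 0")
    case True
    then show ?thesis by (simp add: part_potential_def)
  next
    case False
    then show ?thesis using old[OF that(1)] new[OF that(1)] by (simp add: card_Diff1_le)
  qed
  have "l u \<in> pieces p l z (p u)" using piece_label u by blast
  then have "card (pieces p l z (p u) - {l u}) < card (pieces p l z (p u))"
    by (rule card_Diff1_less[OF finite_pieces])
  then show "part_potential p' l' z j (p u) < part_potential p l z j (p u)"
    unfolding old[OF invV(1)[OF u(1)] star] new[OF invV(1)[OF u(1)] star] .
qed

end

section \<open>Termination of the phases and filling up\<close>

context phase
begin

text \<open>If some part were heavy, then the whole graph would consist of a single small piece and of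
  fewer than \<open>k\<close> centres, by \<open>k\<close>-connectivity; this is too light.\<close>

lemma no_heavy_part:
  assumes small: "\<And>x. x \<in> pieces p l z (p x) \<Longrightarrow> L j \<le> wt (fib l x) \<Longrightarrow>
      z (p x) = 0 \<and> \<not> heavy p (p x)"
    and no_pair: "\<And>u v. u < n \<Longrightarrow> v < n \<Longrightarrow> adj u v \<Longrightarrow> z (p u) \<noteq> Suc u \<Longrightarrow> z (p v) \<noteq> Suc v \<Longrightarrow>
      l u \<noteq> l v \<Longrightarrow> z (p u) \<noteq> 0 \<Longrightarrow> heavy p (p u) \<Longrightarrow> False"
    and a: "a \<in> B"
  shows "\<not> heavy p a"
proof
  assume heavy: "heavy p a"
  have ne: "fib p a \<noteq> {}" using conn_nonempty[OF conn_part[OF a]] .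
  \<comment> \<open>A heavy part without centre would itself be a big piece of a heavy part, which
    \<open>small\<close> rules out.\<close>
  have "z a \<noteq> 0"
  proof
    assume z: "z a = 0"
    obtain y where y: "y \<in> fib p a" using ne by blast
    have "fib p a \<subseteq> fib l (l y)" using invZ[OF a z _ y] by (intro subsetI) simp
    then have "wt (fib p a) \<le> wt (fib l (l y))" by (rule wt_mono[OF finite_fiber])
    then have "L j \<le> wt (fib l (l y))" using heavy invB(4)[OF a] by (simp add: heavy_def)
    moreover have "l y \<in> pieces p l z (p (l y))"
      using piece_label[of y] y z invV(4)[of y] by simp
    ultimately show False using small[of "l y"] y heavy invV(4)[of y] by simp
  qed
  then obtain s where s: "z a = Suc s" by (cases "z a") auto
  note s' = centre_label[OF invS(1)[OF a s]]
  \<comment> \<open>A single vertex weighs at most \<open>3 * L a\<close>, so a heavy star has a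
    vertex besides its centre.\<close>
  have "fib p a \<noteq> {s}"
  proof
    assume "fib p a = {s}"
    then have "wt (fib p a) = c * w s" by (simp add: wt_def)
    moreover have "c * w s \<le> 3 * L a" using w_le_L[OF s'(1), of a] a invB(1) c(2) by (intro mult_le_mono) auto
    ultimately show False using heavy by (simp add: heavy_def)
  qed
  then obtain u where u: "u < n" "p u = a" "u \<noteq> s" using ne by (metis mem_fiber singletonI subsetI subset_singletonD)
  let ?S = "{b \<in> B. z b \<noteq> 0}" and ?V = "{..<n}" and ?K = "fib l (l u)"
  \<comment> \<open>This is the set of all centres. There is at most one per part, and
    \<open>j\<close> has no part yet, so fewer than \<open>k\<close> vertices are removed.\<close>
  let ?X = "(\<lambda>b. z b - 1) ` ?S"
  have fin: "finite ?S" using finite_B by simp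
  have X: "y \<in> ?X \<longleftrightarrow> z (p y) = Suc y" if "y < n" for y
  proof
    assume "y \<in> ?X"
    then obtain b where "b \<in> B" "z b = Suc y" by force
    then show "z (p y) = Suc y" using centre_label(2)[OF invS(1)] by simp
  next
    assume "z (p y) = Suc y"
    then show "y \<in> ?X" using invV(1)[OF that] by (intro image_eqI[of _ _ "p y"]) auto
  qed
  have XV: "?X \<subseteq> ?V"
  proof
    fix y assume "y \<in> ?X"
    then obtain b where "b \<in> B" "z b = Suc y" by force
    then show "y \<in> ?V" using centre_label(1)[OF invS(1)] by simp
  qed
  have "card ?X \<le> card ?S" using fin by (rule card_image_le)
  also have "\<dots> \<le> card B" using finite_B by (intro card_mono) auto
  also have "\<dots> < card {1..k}" using invB(1-3) by (intro psubset_card_mono) auto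
  finally have "card ?X < k" by simp
  then have "connected_graph (?V - ?X) (induced_edges E (?V - ?X))"
    using inst XV by (auto simp: gl_instance_def k_connected_def)
  then have conn: "conn (?V - ?X)" by (simp add: connected_graph_iff_conn)
  have K: "y < n \<and> p y = a \<and> z (p y) \<noteq> Suc y" if "y \<in> ?K" for y
  proof -
    have y: "y < n" "l y = l u" using that by auto
    then have "p y = a" using same_label[of y u] u by simp
    moreover have "y \<noteq> s" using s'(3) s'(5)[of u] y u by auto
    ultimately show ?thesis using y s by simp
  qed
  \<comment> \<open>An edge from \<open>?K\<close> to another vertex that is no centre would permit
    a merger. So \<open>?K\<close> is closed in the connected graph without the centres and fills
    it.\<close>
  have "?K = ?V - ?X"
  proof (rule connD[OF conn])
    show "?K \<subseteq> ?V - ?X" using K X by fastforce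
    show "?K \<noteq> {}" using u by auto
    fix x y assume xy: "x \<in> ?K" "y \<in> ?V - ?X" "adj x y"
    have "z (p y) \<noteq> Suc y" "y < n" using X[of y] xy(2) by auto
    then have "l x = l y" using no_pair[of x y] K[OF xy(1)] xy(3) s heavy by auto
    then show "y \<in> ?K" using xy \<open>y < n\<close> by simp
  qed
  then have "?V = ?K \<union> ?X" "?K \<inter> ?X = {}" using XV by blast+
  then have "wt ?V = wt ?K + wt ?X" using wt_Un[of ?K ?X] fin by simp
  moreover have "wt ?K < c * L j"
  proof -
    have "l u \<in> pieces p l z (p (l u))" using piece_label[of u] u s invV(4)[of u] by simp
    then have "wt ?K < L j" using small[of "l u"] s u invV(4)[of u] by fastforce
    then show ?thesis using c(1) by (metis mult_1 mult_le_mono1 order.strict_trans2)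
  qed
  moreover have "wt ?X \<le> (\<Sum>b\<in>?S. c * L b)"
  proof -
    have "wt ?X \<le> (\<Sum>b\<in>?S. c * w (z b - 1))"
      unfolding wt_def using fin by (intro sum_image_le[THEN order_trans]) auto
    also have "\<dots> \<le> (\<Sum>b\<in>?S. c * L b)"
      using invB(1) XV by (intro sum_mono mult_le_mono2 w_le_L) auto
    finally show ?thesis .
  qed
  moreover have "(\<Sum>b\<in>?S. c * L b) + c * L j \<le> c * (\<Sum>i=1..k. L i)"
  proof -
    have "(\<Sum>b\<in>?S. c * L b) + c * L j = (\<Sum>b\<in>insert j ?S. c * L b)"
      using invB(3) fin by simp
    also have "\<dots> \<le> (\<Sum>i=1..k. c * L i)" using invB(1,2) by (intro sum_mono2) auto
    finally show ?thesis by (simp only: sum_distrib_left)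
  qed
  \<comment> \<open>Each centre weighs at most \<open>c\<close> times the target of its part and the
    only piece less than \<open>c * L j\<close>; as \<open>j\<close> is not in \<open>B\<close>, the
    total stays below the weight of the graph.\<close>
  ultimately show False using wt_all by linarith
qed

end

context partition_instance
begin

lemma sum_parts:
  assumes "parts_invar p B"
  shows "(\<Sum>b\<in>B. wt (fib p b)) = wt {..<n}"
proof -
  have "finite B" using assms finite_subset[of B "{1..k}"] by (auto simp: parts_invar_def)
  then have "(\<Sum>b\<in>B. \<Sum>v\<in>{v \<in> {..<n}. p v = b}. c * w v) = (\<Sum>v<n. c * w v)"
    using assms by (intro sum.group) (auto simp: parts_invar_def)
  then show ?thesis by (simp add: wt_def fiber_def)
qed

text \<open>Only the upper bound is kept: a part that gives up vertices may fall below its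
  target.\<close>

definition fill_invar :: "(nat \<Rightarrow> nat) \<Rightarrow> nat set \<Rightarrow> bool" where
  "fill_invar p B \<longleftrightarrow> B \<subseteq> {1..k} \<and> (\<forall>v<n. p v \<in> B) \<and>
     (\<forall>b\<in>B. conn (fib p b) \<and> (\<Sum>v\<in>fib p b. w v) \<le> 3 * L b)"

text \<open>With \<open>c = 3\<close> the graph weighs three times the sum of all targets. Light
  parts that serve only some of the targets cannot add up to this.\<close>

lemma lower_bound:
  assumes p: "parts_invar p B" and "c = 3" and nh: "B = {1..k} \<or> (\<forall>b\<in>B. \<not> heavy p b)"
  shows "B = {1..k}" "i \<in> {1..k} \<Longrightarrow> L i \<le> 3 * (\<Sum>v\<in>fib p i. w v)"
proof -
  have B: "B \<subseteq> {1..k}" using p by (simp add: parts_invar_def)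
  show eq: "B = {1..k}"
  proof (rule ccontr)
    assume ne: "B \<noteq> {1..k}"
    have "wt {..<n} = (\<Sum>b\<in>B. wt (fib p b))" using sum_parts[OF p] ..
    also have "\<dots> \<le> (\<Sum>b\<in>B. 3 * L b)" using nh ne by (intro sum_mono) (auto simp: heavy_def not_less)
    also have "\<dots> < (\<Sum>i=1..k. 3 * L i)"
    proof -
      obtain i where "i \<in> {1..k} - B" using B ne by blast
      then show ?thesis using B L_pos[of i] by (intro sum_strict_mono2[of _ _ i]) auto
    qed
    also have "\<dots> = wt {..<n}" using wt_all \<open>c = 3\<close> by (simp add: sum_distrib_left)
    finally show False by simp
  qed
  assume "i \<in> {1..k}"
  then have "L i \<le> wt (fib p i)" using p eq by (simp add: parts_invar_def)
  then show "L i \<le> 3 * (\<Sum>v\<in>fib p i. w v)"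
    unfolding wt_def unfolding \<open>c = 3\<close> by (simp only: sum_distrib_left)
qed

text \<open>Light parts obey the bound by definition. If all targets are served, the parts weigh at
  least their targets and in total exactly the sum of the targets, so each part weighs exactly its
  target.\<close>

lemma upper_bound:
  assumes p: "parts_invar p B" and "c = 1" and nh: "B = {1..k} \<or> (\<forall>b\<in>B. \<not> heavy p b)"
  shows "fill_invar p B"
proof -
  have wt: "wt S = (\<Sum>v\<in>S. w v)" for S unfolding wt_def unfolding \<open>c = 1\<close> by simp
  have "wt (fib p b) \<le> 3 * L b" if b: "b \<in> B" for b
  proof (cases "\<forall>b\<in>B. \<not> heavy p b")
    case True
    then show ?thesis using b by (simp add: heavy_def not_less)
  next
    case False
    then have eq: "B = {1..k}" using nh by blast
    have "(\<Sum>b\<in>B. wt (fib p b)) = (\<Sum>b\<in>B. L b)" using sum_parts[OF p] wt_all \<open>c = 1\<close> eq by simp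
    moreover have "L a \<le> wt (fib p a)" if "a \<in> B" for a using p that by (simp add: parts_invar_def)
    ultimately have "wt (fib p b) = L b"
      using b eq sum_mono_inv[of L B "\<lambda>b. wt (fib p b)" b] by simp
    then show ?thesis by simp
  qed
  then show ?thesis using p by (auto simp: fill_invar_def parts_invar_def wt)
qed

text \<open>The assumption on the targets makes every vertex at most as heavy as any target, so
  \<open>{v}\<close> can serve \<open>j\<close>; the other parts only lose weight.\<close>

lemma fill_step:
  assumes inv: "fill_invar p B" and j: "j \<in> {1..k} - B" and v: "v < n" "conn (fib p (p v) - {v})"
    and p': "\<And>u. u < n \<Longrightarrow> p' u = (if u = v then j else p u)"
  shows "fill_invar p' (insert j B)"
proof -
  have P: "B \<subseteq> {1..k}" "\<And>u. u < n \<Longrightarrow> p u \<in> B" "\<And>b. b \<in> B \<Longrightarrow> conn (fib p b)"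
    "\<And>b. b \<in> B \<Longrightarrow> (\<Sum>v\<in>fib p b. w v) \<le> 3 * L b"
    using inv unfolding fill_invar_def by blast+
  have j': "u \<in> fib p' j \<longleftrightarrow> u = v" for u
    using p'[of u] P(2)[of u] v(1) j by (cases "u < n") auto
  then have fj: "fib p' j = {v}" by blast
  have fb: "fib p' b = fib p b - {v}" if "b \<in> B" for b
  proof -
    have "u \<in> fib p' b \<longleftrightarrow> u \<in> fib p b - {v}" for u
      using p'[of u] that j by (cases "u < n") auto
    then show ?thesis by blast
  qed
  have "w v \<le> 3 * L j" using w_le_L[of v j] v(1) j by simp
  moreover have "conn (fib p' b) \<and> (\<Sum>v\<in>fib p' b. w v) \<le> 3 * L b" if b: "b \<in> B" for b
  proof
    show "conn (fib p' b)"
    proof (cases "b = p v")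
      case True
      then show ?thesis using fb[OF b] v by simp
    next
      case False
      then have "fib p b - {v} = fib p b" by auto
      then show ?thesis using fb[OF b] P(3)[OF b] by simp
    qed
    have "(\<Sum>v\<in>fib p' b. w v) \<le> (\<Sum>v\<in>fib p b. w v)" unfolding fb[OF b] by (rule sum_mono2) auto
    then show "(\<Sum>v\<in>fib p' b. w v) \<le> 3 * L b" using P(4)[OF b] by simp
  qed
  moreover have "p' u \<in> insert j B" if "u < n" for u using p'[OF that] P(2)[OF that] by simp
  ultimately show ?thesis using P(1) j fj by (auto simp: fill_invar_def)
qed

text \<open>As \<open>k < n\<close>, two vertices share a part, and a connected set with two
  vertices has a non-cut vertex.\<close>

lemma fill_exists:
  assumes inv: "fill_invar p B" and j: "j \<in> {1..k} - B"
  shows "\<exists>v<n. conn (fib p (p v) - {v})"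
proof -
  have P: "B \<subseteq> {1..k}" "\<And>u. u < n \<Longrightarrow> p u \<in> B" "\<And>b. b \<in> B \<Longrightarrow> conn (fib p b)"
    using inv unfolding fill_invar_def by blast+
  have "card (p ` {..<n}) \<le> card {1..k}" using P(1,2) by (intro card_mono) auto
  then have "\<not> inj_on p {..<n}" using k by (auto dest: card_image)
  then obtain u u' where u: "u < n" "u' < n" "u \<noteq> u'" "p u = p u'" by (auto simp: inj_on_def)
  have "card {u, u'} \<le> card (fib p (p u))" using u by (intro card_mono) auto
  then have "2 \<le> card (fib p (p u))" using u by simp
  then obtain v where "v \<in> fib p (p u)" "conn (fib p (p u) - {v})"
    using ex_noncut_vertex[of "fib p (p u)"] P(2,3) u by auto
  then show ?thesis by auto
qed

lemma connected_partition:
  assumes "\<And>v. v < n \<Longrightarrow> p v \<in> {1..k}" "\<And>i. i \<in> {1..k} \<Longrightarrow> conn (fib p i)"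
  shows "connected_partition {..<n} E k (fib p)"
proof -
  have ne: "fib p i \<noteq> {}" if "i \<in> {1..k}" for i using conn_nonempty[OF assms(2)[OF that]] .
  have inj: "inj_on (fib p) {1..k}"
  proof (rule inj_onI)
    fix i i' assume "i \<in> {1..k}" "i' \<in> {1..k}" "fib p i = fib p i'"
    then show "i = i'" using ne[of i] by (metis ex_in_conv mem_fiber)
  qed
  have "partition_on {..<n} (fib p ` {1..k})"
  proof (rule partition_onI)
    show "\<Union> (fib p ` {1..k}) = {..<n}" using assms(1) by auto
    show "disjnt A A'" if "A \<in> fib p ` {1..k}" "A' \<in> fib p ` {1..k}" "A \<noteq> A'" for A A'
      using that by (auto simp: disjnt_def)
    show "{} \<notin> fib p ` {1..k}" using ne by fastforce
  qed
  then show ?thesis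
    using inj assms(2) by (simp add: connected_partition_def connected_graph_iff_conn)
qed

end

section \<open>The program\<close>

definition guarded_store :: "vname \<Rightarrow> bexp \<Rightarrow> vname \<Rightarrow> aexp \<Rightarrow> fcom" where
  "guarded_store x b a e = FFor x ''n'' (FIf b (FStore a (Reg x) e) FSkip)"

text \<open>The result is shifted by one so that 0 means failure; of several hits the last one is
  reported.\<close>

definition search :: "vname \<Rightarrow> vname \<Rightarrow> bexp \<Rightarrow> fcom" where
  "search f x b = FSeq (FAssign f (Const 0))
     (FFor x ''n'' (FIf b (FAssign f (Add (Reg x) (Const 1))) FSkip))"

abbreviation always :: bexp where
  "always \<equiv> Equal (Const 0) (Const 0)"

abbreviation Leq :: "aexp \<Rightarrow> aexp \<Rightarrow> bexp" where
  "Leq e f \<equiv> Neg (Less f e)"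

abbreviation Disj :: "bexp \<Rightarrow> bexp \<Rightarrow> bexp" where
  "Disj b d \<equiv> Neg (Conj (Neg b) (Neg d))"

text \<open>Without multiplication, the offsets \<open>u * n\<close> of an adjacency matrix stored
  in one array have to be tabulated in \<open>row\<close>.\<close>

abbreviation Edge :: "aexp \<Rightarrow> aexp \<Rightarrow> bexp" where
  "Edge e f \<equiv> Equal (Arr ''adj'' (Add (Arr ''row'' e) f)) (Const 1)"

lemma guarded_store_simps [simp]:
  "wregs (guarded_store x b a e) = {x}" "warrs (guarded_store x b a e) = {a}"
  "well_formed Y (guarded_store x b a e) \<longleftrightarrow> x \<notin> Y \<and> ''n'' \<in> Y"
  "depth (guarded_store x b a e) = 1"
  by (simp_all add: guarded_store_def)

lemma search_simps [simp]:
  "wregs (search f x b) = {f, x}" "warrs (search f x b) = {}"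
  "well_formed Y (search f x b) \<longleftrightarrow> f \<notin> Y \<and> x \<notin> Y \<and> ''n'' \<in> Y \<and> x \<noteq> f"
  "depth (search f x b) = 1"
  by (auto simp: search_def)

text \<open>The guard and the value may read the array that is being written: in round
  \<open>i\<close> its entries from \<open>i\<close> on are still the old ones. \<open>Q\<close> and
  \<open>val\<close> express what is read in terms of the old state.\<close>

lemma guarded_store:
  assumes "x \<noteq> ''n''"
    and step: "\<And>i s'. i < reg s ''n'' \<Longrightarrow> reg s' = (reg s)(x := i) \<Longrightarrow>
      (\<And>a'. a' \<noteq> a \<Longrightarrow> arr s' a' = arr s a') \<Longrightarrow> (\<And>v. i \<le> v \<Longrightarrow> arr s' a v = arr s a v) \<Longrightarrow>
      bval b s' = Q i \<and> (Q i \<longrightarrow> aval e s' = val i)"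
  shows "arr (sem (guarded_store x b a e) s) a = (\<lambda>v. if v < reg s ''n'' \<and> Q v then val v else arr s a v)"
  unfolding guarded_store_def
proof (rule for_invariant[where P = "\<lambda>i s'. arr s' a = (\<lambda>v. if v < i \<and> Q v then val v else arr s a v)"])
  fix i s'
  assume i: "i < reg s ''n''" and fr: "frame (FFor x ''n'' (FIf b (FStore a (Reg x) e) FSkip)) s s'"
    and x: "reg s' x = i" and P: "arr s' a = (\<lambda>v. if v < i \<and> Q v then val v else arr s a v)"
  have "reg s' = (reg s)(x := i)" using fr x by (auto simp: frame_def)
  then have *: "bval b s' = Q i \<and> (Q i \<longrightarrow> aval e s' = val i)"
    using fr P by (intro step i) (auto simp: frame_def)
  show "arr (set_reg x (Suc i) (sem (FIf b (FStore a (Reg x) e) FSkip) s')) a =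
      (\<lambda>v. if v < Suc i \<and> Q v then val v else arr s a v)"
    using * x P by (auto simp: fun_eq_iff less_Suc_eq)
qed (use assms(1) in auto)

lemma search:
  assumes "x \<noteq> ''n''" "f \<noteq> ''n''" "x \<noteq> f"
    and step: "\<And>i s'. i < reg s ''n'' \<Longrightarrow> arr s' = arr s \<Longrightarrow>
      (\<And>y. y \<noteq> f \<Longrightarrow> y \<noteq> x \<Longrightarrow> reg s' y = reg s y) \<Longrightarrow> reg s' x = i \<Longrightarrow> bval b s' = Q i"
  obtains "reg (sem (search f x b) s) f = 0" "\<And>v. v < reg s ''n'' \<Longrightarrow> \<not> Q v"
  | v where "reg (sem (search f x b) s) f = Suc v" "v < reg s ''n''" "Q v"
proof -
  let ?c = "FIf b (FAssign f (Add (Reg x) (Const 1))) FSkip" and ?s = "set_reg f 0 s"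
  let ?P = "\<lambda>i s'. reg s' f = 0 \<and> (\<forall>v<i. \<not> Q v) \<or> (\<exists>v<i. reg s' f = Suc v \<and> Q v)"
  have "?P (reg ?s ''n'') (sem (FFor x ''n'' ?c) ?s)"
  proof (rule for_invariant[where P = ?P])
    fix i s'
    assume i: "i < reg ?s ''n''" and fr: "frame (FFor x ''n'' ?c) ?s s'" and x: "reg s' x = i" and P: "?P i s'"
    have "arr s' = arr s" using fr by (auto simp: frame_def)
    then have *: "bval b s' = Q i" using fr x i assms(2) by (intro step) (auto simp: frame_def)
    show "?P (Suc i) (set_reg x (Suc i) (sem ?c s'))"
      using * x P assms(3) by (auto simp: less_Suc_eq)
  qed (use assms in auto)
  then show ?thesis using that assms(2) by (auto simp: search_def)
qed

text \<open>Index 0 is no genuine target and has the value 0, below all genuine ones; it serves as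
  the initial candidate, and as the answer when nothing is left. Scanning the indices below
  \<open>n\<close> reaches all of \<open>{1..k}\<close> because \<open>k < n\<close>.\<close>

definition pick :: fcom where
  "pick = FSeq (FAssign ''j'' (Const 0)) (FFor ''v'' ''n''
     (FIf (Conj (Equal (Arr ''built'' (Reg ''v'')) (Const 0))
                (Less (Arr ''target'' (Reg ''j'')) (Arr ''target'' (Reg ''v''))))
        (FAssign ''j'' (Reg ''v'')) FSkip))"

definition reset :: fcom where
  "reset = FSeq (FFor ''v'' ''n'' (FStore ''rep'' (Arr ''part'' (Reg ''v'')) (Reg ''v'')))
     (FSeq (guarded_store ''v'' always ''lab'' (Arr ''rep'' (Arr ''part'' (Reg ''v''))))
           (guarded_store ''v'' always ''cen'' (Const 0)))"

definition next_phase :: fcom where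
  "next_phase = FSeq (FStore ''built'' (Reg ''j'') (Const 1)) (FSeq pick reset)"

definition weigh :: fcom where
  "weigh = FSeq (guarded_store ''v'' always ''tw'' (Const 0))
     (FSeq (guarded_store ''v'' always ''pw'' (Const 0))
     (FFor ''v'' ''n'' (FSeq
        (FStore ''tw'' (Arr ''part'' (Reg ''v''))
           (Add (Arr ''tw'' (Arr ''part'' (Reg ''v''))) (Arr ''wgt'' (Reg ''v''))))
        (FStore ''pw'' (Arr ''lab'' (Reg ''v''))
           (Add (Arr ''pw'' (Arr ''lab'' (Reg ''v''))) (Arr ''wgt'' (Reg ''v'')))))))"

text \<open>Relabels the vertices marked by \<open>in\<close> with their components, adding one vertex \<open>q\<close> at a
  time: \<open>q\<close> becomes the label of its own component, which absorbs the components it touches.\<close>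

definition relabel :: fcom where
  "relabel = FFor ''q'' ''n'' (FIf (Equal (Arr ''in'' (Reg ''q'')) (Const 1))
     (FSeq (guarded_store ''v'' always ''hit'' (Const 0))
     (FSeq (FFor ''v'' ''n'' (FIf (Conj (Less (Reg ''v'') (Reg ''q''))
          (Conj (Equal (Arr ''in'' (Reg ''v'')) (Const 1)) (Edge (Reg ''q'') (Reg ''v''))))
          (FStore ''hit'' (Arr ''lab'' (Reg ''v'')) (Const 1)) FSkip))
     (FSeq (FStore ''lab'' (Reg ''q'') (Reg ''q''))
     (guarded_store ''v'' (Conj (Less (Reg ''v'') (Reg ''q'')) (Conj (Equal (Arr ''in'' (Reg ''v'')) (Const 1))
        (Equal (Arr ''hit'' (Arr ''lab'' (Reg ''v''))) (Const 1)))) ''lab'' (Reg ''q'')))))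
     FSkip)"

lemma program_parts_simps [simp]:
  "wregs pick = {''j'', ''v''}" "warrs pick = {}"
  "wregs reset = {''v''}" "warrs reset = {''rep'', ''lab'', ''cen''}"
  "wregs next_phase = {''j'', ''v''}" "warrs next_phase = {''built'', ''rep'', ''lab'', ''cen''}"
  "wregs weigh = {''v''}" "warrs weigh = {''tw'', ''pw''}"
  "wregs relabel = {''q'', ''v''}" "warrs relabel = {''hit'', ''lab''}"
  "depth pick = 1" "depth reset = 1" "depth next_phase = 1" "depth weigh = 1" "depth relabel = 2"
  "''n'' \<in> Y \<Longrightarrow> well_formed Y pick \<longleftrightarrow> ''j'' \<notin> Y \<and> ''v'' \<notin> Y"
  "''n'' \<in> Y \<Longrightarrow> well_formed Y reset \<longleftrightarrow> ''v'' \<notin> Y"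
  "''n'' \<in> Y \<Longrightarrow> well_formed Y next_phase \<longleftrightarrow> ''j'' \<notin> Y \<and> ''v'' \<notin> Y"
  "''n'' \<in> Y \<Longrightarrow> well_formed Y weigh \<longleftrightarrow> ''v'' \<notin> Y"
  "''n'' \<in> Y \<Longrightarrow> well_formed Y relabel \<longleftrightarrow> ''q'' \<notin> Y \<and> ''v'' \<notin> Y"
  by (auto simp: pick_def reset_def next_phase_def weigh_def relabel_def)

section \<open>Choosing targets, weighing, and computing components\<close>

context partition_instance
begin

definition built :: "state \<Rightarrow> nat set" where
  "built s = {i. arr s ''built'' i \<noteq> 0}"

text \<open>These data stay fixed once they are set up. The factor \<open>c\<close> is contained in
  \<open>wgt\<close>, so the loop bodies are the same for both versions.\<close>

definition env :: "state \<Rightarrow> bool" where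
  "env s \<longleftrightarrow> reg s ''n'' = n \<and> (\<forall>v<n. arr s ''wgt'' v = c * w v) \<and>
     arr s ''target'' = (\<lambda>i. if i \<in> {1..k} then L i else 0) \<and>
     (\<forall>u<n. \<forall>v<n. arr s ''adj'' (arr s ''row'' u + v) = 1 \<longleftrightarrow> adj u v)"

abbreviation env_arrays :: "vname set" where
  "env_arrays \<equiv> {''wgt'', ''target'', ''adj'', ''row''}"

lemma env_cong:
  assumes "env s" "reg s' ''n'' = reg s ''n''" "\<And>a. a \<in> env_arrays \<Longrightarrow> arr s' a = arr s a"
  shows "env s'"
  using assms by (simp add: env_def)

lemma env_frame:
  assumes "env s" "frame d s s'" "''n'' \<notin> wregs d" "warrs d \<inter> env_arrays = {}"
  shows "env s'"
proof (rule env_cong[OF assms(1)])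
  show "reg s' ''n'' = reg s ''n''" using assms(2,3) by (simp add: frame_def)
  fix a assume "a \<in> env_arrays"
  then have "a \<notin> warrs d" using assms(4) by blast
  then show "arr s' a = arr s a" using assms(2) by (simp add: frame_def)
qed

lemma env_sem:
  assumes "env s" "''n'' \<notin> wregs d" "warrs d \<inter> env_arrays = {}"
  shows "env (sem d s)"
  by (rule env_frame[OF assms(1) _ assms(2,3)]) (simp add: frame_def)

lemma env_set [simp]:
  "x \<noteq> ''n'' \<Longrightarrow> env (set_reg x i s) = env s"
  "a \<notin> env_arrays \<Longrightarrow> env (set_arr a i v s) = env s"
  by (auto simp: env_def)

lemma pick:
  assumes "env s"
  obtains "reg (sem pick s) ''j'' = 0" "{1..k} \<subseteq> built s"
  | "reg (sem pick s) ''j'' \<in> {1..k} - built s"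
    "\<And>i. i \<in> {1..k} - built s \<Longrightarrow> L i \<le> L (reg (sem pick s) ''j'')"
proof -
  let ?c = "FIf (Conj (Equal (Arr ''built'' (Reg ''v'')) (Const 0))
                (Less (Arr ''target'' (Reg ''j'')) (Arr ''target'' (Reg ''v''))))
        (FAssign ''j'' (Reg ''v'')) FSkip" and ?s = "set_reg ''j'' 0 s"
  let ?t = "\<lambda>i. if i \<in> {1..k} then L i else 0"
  let ?P = "\<lambda>i s'. (reg s' ''j'' = 0 \<or> reg s' ''j'' \<in> {1..k} - built s) \<and>
    (\<forall>v<i. v \<notin> built s \<longrightarrow> ?t v \<le> ?t (reg s' ''j''))"
  have t: "arr s ''target'' = ?t" and n: "reg s ''n'' = n" using assms by (auto simp: env_def)
  have "?P (reg ?s ''n'') (sem (FFor ''v'' ''n'' ?c) ?s)"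
  proof (rule for_invariant[where P = ?P])
    fix i s'
    assume i: "i < reg ?s ''n''" and fr: "frame (FFor ''v'' ''n'' ?c) ?s s'" and x: "reg s' ''v'' = i" and P: "?P i s'"
    have a: "arr s' = arr s" using fr by (auto simp: frame_def)
    let ?d = "Conj (Equal (Arr ''built'' (Reg ''v'')) (Const 0))
                (Less (Arr ''target'' (Reg ''j'')) (Arr ''target'' (Reg ''v'')))"
    have b: "bval ?d s' \<longleftrightarrow>
      i \<notin> built s \<and> ?t (reg s' ''j'') < ?t i" using a x t by (simp add: built_def)
    show "?P (Suc i) (set_reg ''v'' (Suc i) (sem ?c s'))"
    proof (cases "i \<notin> built s \<and> ?t (reg s' ''j'') < ?t i")
      case True
      then have "i \<in> {1..k} - built s" by (auto split: if_splits)
      moreover have "?t v \<le> ?t i" if "v < Suc i" "v \<notin> built s" for v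
        using P True that by (cases "v = i") (force simp: less_Suc_eq)+
      moreover have "bval ?d s'" using b True by blast
      then have "sem ?c s' = set_reg ''j'' i s'" using x by (simp only: sem.simps if_True aval.simps)
      then have "reg (set_reg ''v'' (Suc i) (sem ?c s')) ''j'' = i" by simp
      ultimately show ?thesis by presburger
    next
      case False
      then have "\<not> bval ?d s'" using b by blast
      then have "sem ?c s' = s'" by (simp only: sem.simps if_False)
      then have "reg (set_reg ''v'' (Suc i) (sem ?c s')) ''j'' = reg s' ''j''" by simp
      moreover have "?t v \<le> ?t (reg s' ''j'')" if "v < Suc i" "v \<notin> built s" for v
        using P False that by (cases "v = i") (auto simp: less_Suc_eq not_less)
      ultimately show ?thesis using P by presburger
    qed
  qed auto
  moreover have n': "reg ?s ''n'' = n" and e: "sem pick s = sem (FFor ''v'' ''n'' ?c) ?s"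
    using n by (simp_all add: pick_def)
  ultimately have P: "?P n (sem pick s)" unfolding n' e by blast
  have max: "?t i \<le> ?t (reg (sem pick s) ''j'')" if "i \<in> {1..k} - built s" for i
    using P that k by (metis (no_types, lifting) DiffD1 DiffD2 atLeastAtMost_iff le_less_trans)
  show ?thesis
  proof (cases "reg (sem pick s) ''j'' = 0")
    case True
    have "i \<in> built s" if "i \<in> {1..k}" for i
    proof (rule ccontr)
      assume "i \<notin> built s"
      then have "L i \<le> 0" using max[of i] True that by simp
      then show False using L_pos[OF that] by simp
    qed
    then show ?thesis using that(1) True by blast
  next
    case False
    then have j: "reg (sem pick s) ''j'' \<in> {1..k} - built s" using P by (elim conjE disjE) simp_all
    have "L i \<le> L (reg (sem pick s) ''j'')" if "i \<in> {1..k} - built s" for i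
      using max[OF that] j that by simp
    then show ?thesis using that(2) j by blast
  qed
qed

lemma reset:
  assumes n: "reg s ''n'' = n" and p: "\<And>v. v < n \<Longrightarrow> arr s ''part'' v < n"
  defines "s' \<equiv> sem reset s"
  shows "v < n \<Longrightarrow> arr s' ''lab'' v < n \<and> arr s ''part'' (arr s' ''lab'' v) = arr s ''part'' v"
    "u < n \<Longrightarrow> v < n \<Longrightarrow> arr s ''part'' u = arr s ''part'' v \<Longrightarrow> arr s' ''lab'' u = arr s' ''lab'' v"
    "b < n \<Longrightarrow> arr s' ''cen'' b = 0"
proof -
  let ?r = "FFor ''v'' ''n'' (FStore ''rep'' (Arr ''part'' (Reg ''v'')) (Reg ''v''))"
  let ?p = "arr s ''part''"
  let ?P = "\<lambda>i s'. \<forall>v<i. arr s' ''rep'' (?p v) < n \<and> ?p (arr s' ''rep'' (?p v)) = ?p v"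
  have P: "?P (reg s ''n'') (sem ?r s)"
  proof (rule for_invariant[where P = ?P])
    fix i s'
    assume i: "i < reg s ''n''" and fr: "frame ?r s s'" and x: "reg s' ''v'' = i" and P: "?P i s'"
    have a: "arr s' ''part'' = ?p" using fr by (auto simp: frame_def)
    show "?P (Suc i) (set_reg ''v'' (Suc i) (sem (FStore ''rep'' (Arr ''part'' (Reg ''v'')) (Reg ''v'')) s'))"
      using P a x i n by (auto simp: less_Suc_eq)
  qed auto
  let ?s = "sem ?r s"
  let ?l = "guarded_store ''v'' always ''lab'' (Arr ''rep'' (Arr ''part'' (Reg ''v'')))"
  have "arr (sem ?l ?s) ''lab'' = (\<lambda>v. if v < reg ?s ''n'' \<and> True then arr ?s ''rep'' (?p v) else arr ?s ''lab'' v)"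
    by (rule guarded_store) (auto simp del: sem.simps)
  then have lab: "arr s' ''lab'' v = arr ?s ''rep'' (?p v)" if "v < n" for v
    using that n unfolding s'_def reset_def by (simp del: sem.simps(6))
  show "v < n \<Longrightarrow> arr s' ''lab'' v < n \<and> ?p (arr s' ''lab'' v) = ?p v" using P lab n by simp
  show "u < n \<Longrightarrow> v < n \<Longrightarrow> ?p u = ?p v \<Longrightarrow> arr s' ''lab'' u = arr s' ''lab'' v" using lab by simp
  let ?z = "guarded_store ''v'' always ''cen'' (Const 0)"
  have "arr (sem ?z (sem ?l ?s)) ''cen'' =
    (\<lambda>v. if v < reg (sem ?l ?s) ''n'' \<and> True then 0 else arr (sem ?l ?s) ''cen'' v)"
    by (rule guarded_store) auto
  then show "b < n \<Longrightarrow> arr s' ''cen'' b = 0"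
    using n unfolding s'_def reset_def by (simp del: sem.simps(6))
qed

lemma weigh:
  assumes env: "env s"
  defines "s' \<equiv> sem weigh s"
  shows "b < n \<Longrightarrow> arr s' ''tw'' b = wt (fib (arr s ''part'') b)"
    "x < n \<Longrightarrow> arr s' ''pw'' x = wt (fib (arr s ''lab'') x)"
proof -
  let ?z = "guarded_store ''v'' always ''tw'' (Const 0)" and ?y = "guarded_store ''v'' always ''pw'' (Const 0)"
  let ?b = "FSeq
        (FStore ''tw'' (Arr ''part'' (Reg ''v''))
           (Add (Arr ''tw'' (Arr ''part'' (Reg ''v''))) (Arr ''wgt'' (Reg ''v''))))
        (FStore ''pw'' (Arr ''lab'' (Reg ''v''))
           (Add (Arr ''pw'' (Arr ''lab'' (Reg ''v''))) (Arr ''wgt'' (Reg ''v''))))"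
  let ?s = "sem ?y (sem ?z s)" and ?p = "arr s ''part''" and ?l = "arr s ''lab''"
  have n: "reg s ''n'' = n" and W: "\<And>v. v < n \<Longrightarrow> arr s ''wgt'' v = c * w v" using env by (auto simp: env_def)
  have z: "arr (sem ?z s) ''tw'' = (\<lambda>v. if v < reg s ''n'' \<and> True then 0 else arr s ''tw'' v)"
    by (rule guarded_store) auto
  have y: "arr ?s ''pw'' = (\<lambda>v. if v < reg (sem ?z s) ''n'' \<and> True then 0 else arr (sem ?z s) ''pw'' v)"
    by (rule guarded_store) auto
  have fiber_Suc: "fiber (Suc i) f b = (if f i = b then insert i (fiber i f b) else fiber i f b)" for i f b
    by (auto simp: less_Suc_eq)
  \<comment> \<open>Putting the counter in place of \<open>n\<close> in \<open>fiber\<close>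
    expresses the partial sums.\<close>
  let ?P = "\<lambda>i s'. \<forall>b<n. arr s' ''tw'' b = wt (fiber i ?p b) \<and> arr s' ''pw'' b = wt (fiber i ?l b)"
  have "?P (reg ?s ''n'') (sem (FFor ''v'' ''n'' ?b) ?s)"
  proof (rule for_invariant[where P = ?P])
    have "fiber 0 f b = {}" for f b by auto
    then show "?P 0 (set_reg ''v'' 0 ?s)" using z y n by simp
    fix i s'
    assume i: "i < reg ?s ''n''" and fr: "frame (FFor ''v'' ''n'' ?b) ?s s'" and x: "reg s' ''v'' = i" and P: "?P i s'"
    have a: "arr s' ''part'' = ?p" "arr s' ''lab'' = ?l" "arr s' ''wgt'' i = c * w i"
      using fr W[of i] i n by (auto simp: frame_def)
    show "?P (Suc i) (set_reg ''v'' (Suc i) (sem ?b s'))"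
      using P a x by (auto simp: fiber_Suc wt_def)
  qed auto
  then have "?P n s'" using n by (simp add: s'_def weigh_def del: sem.simps(6))
  then show "b < n \<Longrightarrow> arr s' ''tw'' b = wt (fib ?p b)" "x < n \<Longrightarrow> arr s' ''pw'' x = wt (fib ?l x)"
    by auto
qed

end

text \<open>The class of \<open>q\<close> is a star around \<open>q\<close> whose pieces are the old
  components containing a neighbour of \<open>q\<close>. A component that is not hit has no edge to
  \<open>q\<close> and stays as it is.\<close>

lemma (in graph) components_insert:
  assumes f: "components D f" and q: "q \<notin> D" "f' q = q"
    and f': "\<And>y. y \<in> D \<Longrightarrow> f' y = (if \<exists>z\<in>D. adj q z \<and> f z = f y then q else f y)"
  shows "components (insert q D) f'"
proof -
  let ?hit = "\<lambda>y. \<exists>z\<in>D. adj q z \<and> f z = f y"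
  have F: "f u \<in> D" "f (f u) = f u" "conn {y \<in> D. f y = f u}" if "u \<in> D" for u
    using f that unfolding components_def by blast+
  have Fa: "f y = f u" if "u \<in> D" "y \<in> D" "adj u y" for u y
    using f that unfolding components_def by blast
  have hit_f: "?hit (f u) \<longleftrightarrow> ?hit u" if "u \<in> D" for u using F(2)[OF that] by simp
  have mem: "f' u \<in> insert q D \<and> f' (f' u) = f' u" if "u \<in> insert q D" for u
  proof (cases "u = q \<or> ?hit u")
    case True
    then have "f' u = q" using that f'[of u] q by auto
    then show ?thesis using q(2) by simp
  next
    case False
    then have u: "u \<in> D" "\<not> ?hit u" using that by auto
    then have "f' u = f u" using f'[OF u(1)] by (simp only: if_False)
    moreover have "f' (f u) = f (f u)" using f'[OF F(1)[OF u(1)]] hit_f[OF u(1)] u(2) by (simp only: if_False)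
    ultimately show ?thesis using F(1,2)[OF u(1)] by simp
  qed
  have merged: "conn {y \<in> insert q D. f' y = q}"
  proof (rule conn_star[of q])
    show "q \<in> {y \<in> insert q D. f' y = q}" using q by simp
    fix u assume u: "u \<in> {y \<in> insert q D. f' y = q}" "u \<noteq> q"
    then have uD: "u \<in> D" "f' u = q" by auto
    have "?hit u"
    proof (rule ccontr)
      assume "\<not> ?hit u"
      then have "f' u = f u" using f'[OF uD(1)] by (simp only: if_False)
      then show False using uD F(1)[OF uD(1)] q(1) by simp
    qed
    then obtain z where z: "z \<in> D" "adj q z" "f z = f u" by blast
    show "\<exists>K\<subseteq>{y \<in> insert q D. f' y = q}. u \<in> K \<and> conn K \<and> (\<exists>x\<in>K. adj q x)"
    proof (intro exI[of _ "{y \<in> D. f y = f u}"] conjI)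
      show "{y \<in> D. f y = f u} \<subseteq> {y \<in> insert q D. f' y = q}"
      proof
        fix y assume "y \<in> {y \<in> D. f y = f u}"
        then have y: "y \<in> D" "?hit y" using z by auto
        then have "f' y = q" using f'[OF y(1)] by (simp only: if_True)
        then show "y \<in> {y \<in> insert q D. f' y = q}" using y by simp
      qed
      show "\<exists>x\<in>{y \<in> D. f y = f u}. adj q x" using z by blast
    qed (use uD F(3) in auto)
  qed
  have unmerged: "{y \<in> insert q D. f' y = f' u} = {y \<in> D. f y = f u}" if u: "u \<in> D" "\<not> ?hit u" for u
  proof -
    have fu: "f' u = f u" using f'[OF u(1)] u(2) by (simp only: if_False)
    \<comment> \<open>Old labels are members of \<open>D\<close>, so \<open>q\<close> is a fresh
      label.\<close>
    have "f u \<noteq> q" using F(1)[OF u(1)] q(1) by auto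
    have "y \<in> insert q D \<and> f' y = f u \<longleftrightarrow> y \<in> D \<and> f y = f u" for y
    proof (cases "y \<in> D")
      case True
      show ?thesis
      proof (cases "?hit y")
        case True
        then have "f' y = q" using f'[OF \<open>y \<in> D\<close>] by (simp only: if_True)
        moreover have "f y \<noteq> f u" using True u(2) by auto
        ultimately show ?thesis using \<open>f u \<noteq> q\<close> by auto
      next
        case False
        then have "f' y = f y" using f'[OF \<open>y \<in> D\<close>] by (simp only: if_False)
        then show ?thesis using \<open>y \<in> D\<close> by simp
      qed
    next
      case False
      then show ?thesis using q(2) \<open>f u \<noteq> q\<close> by auto
    qed
    then show ?thesis unfolding fu by blast
  qed
  have conn: "conn {y \<in> insert q D. f' y = f' u}" if "u \<in> insert q D" for u
  proof (cases "u = q \<or> ?hit u")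
    case True
    then have "f' u = q" using that f'[of u] q by auto
    then show ?thesis using merged by simp
  next
    case False
    then have u: "u \<in> D" "\<not> ?hit u" using that by auto
    show ?thesis using unmerged[OF u] F(3)[OF u(1)] by simp
  qed
  have adjacent: "f' y = f' u" if uy: "u \<in> insert q D" "y \<in> insert q D" "adj u y" for u y
  proof -
    have hitq: "f' a = q" if a: "a \<in> D" "adj q a" for a
    proof -
      have "?hit a" using a by blast
      then show ?thesis using f'[OF a(1)] by (simp only: if_True)
    qed
    show ?thesis
    proof (cases "u = q \<or> y = q")
      case True
      then show ?thesis using uy q hitq[of y] hitq[of u] adj_sym[of u y] by auto
    next
      case False
      then have u: "u \<in> D" and y: "y \<in> D" using uy by auto
      show ?thesis by (simp only: f'[OF u] f'[OF y] Fa[OF u y uy(3)])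
    qed
  qed
  show ?thesis unfolding components_def
  proof (intro ballI conjI impI)
    fix u assume u: "u \<in> insert q D"
    show "f' u \<in> insert q D" "f' (f' u) = f' u" using mem[OF u] by auto
    show "conn {y \<in> insert q D. f' y = f' u}" using conn[OF u] .
    show "f' y = f' u" if "y \<in> insert q D" "adj u y" for y using adjacent[OF u that] .
  qed
qed

text \<open>The class of \<open>g\<close> is closed in \<open>D\<close>. Comparing all labels with
  one of them thus decides connectedness, which is how non-cut vertices are recognised.\<close>

lemma (in graph) conn_iff_components:
  assumes f: "components D f" and g: "g \<in> D"
  shows "conn D \<longleftrightarrow> (\<forall>u\<in>D. f u = f g)"
proof
  assume c: "conn D"
  have "{y \<in> D. f y = f g} = D"
    using f g by (intro connD[OF c]) (auto simp: components_def)
  then show "\<forall>u\<in>D. f u = f g" by blast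
next
  assume "\<forall>u\<in>D. f u = f g"
  then have "{y \<in> D. f y = f g} = D" by blast
  moreover have "conn {y \<in> D. f y = f g}" using f g unfolding components_def by blast
  ultimately show "conn D" by simp
qed

context partition_instance
begin

lemma relabel:
  assumes env: "env s"
  defines "D \<equiv> {v. v < n \<and> arr s ''in'' v = 1}"
  shows "components D (arr (sem relabel s) ''lab'')"
    "v \<notin> D \<Longrightarrow> arr (sem relabel s) ''lab'' v = arr s ''lab'' v"
proof -
  let ?in = "arr s ''in''" and ?l = "arr s ''lab''"
  let ?z = "guarded_store ''v'' always ''hit'' (Const 0)"
  let ?e = "Conj (Less (Reg ''v'') (Reg ''q''))
          (Conj (Equal (Arr ''in'' (Reg ''v'')) (Const 1)) (Edge (Reg ''q'') (Reg ''v'')))"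
  let ?hb = "FIf ?e (FStore ''hit'' (Arr ''lab'' (Reg ''v'')) (Const 1)) FSkip"
  let ?h = "FFor ''v'' ''n'' ?hb"
  let ?q = "FStore ''lab'' (Reg ''q'') (Reg ''q'')"
  let ?d = "Conj (Less (Reg ''v'') (Reg ''q'')) (Conj (Equal (Arr ''in'' (Reg ''v'')) (Const 1))
        (Equal (Arr ''hit'' (Arr ''lab'' (Reg ''v''))) (Const 1)))"
  let ?m = "guarded_store ''v'' ?d ''lab'' (Reg ''q'')"
  let ?c = "FIf (Equal (Arr ''in'' (Reg ''q'')) (Const 1)) (FSeq ?z (FSeq ?h (FSeq ?q ?m))) FSkip"
  let ?D = "\<lambda>i. {v. v < i \<and> ?in v = 1}"
  \<comment> \<open>Marked vertices from \<open>i\<close> on still carry old labels that say nothing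
    about components, so the claim is restricted to \<open>?D i\<close>.\<close>
  let ?P = "\<lambda>i s'. components (?D i) (arr s' ''lab'') \<and> (\<forall>v. v \<notin> ?D i \<longrightarrow> arr s' ''lab'' v = ?l v)"
  have n: "reg s ''n'' = n" using env by (simp add: env_def)
  have "?P (reg s ''n'') (sem (FFor ''q'' ''n'' ?c) s)"
  proof (rule for_invariant[where P = ?P])
    show "?P 0 (set_reg ''q'' 0 s)" by (simp add: components_def)
    fix i s'
    assume "i < reg s ''n''" and fr: "frame (FFor ''q'' ''n'' ?c) s s'" and x: "reg s' ''q'' = i" and P: "?P i s'"
    have i: "i < n" using \<open>i < _\<close> n by simp
    have a: "arr s' ''in'' = ?in" and nn: "reg s' ''n'' = n" using fr n by (auto simp: frame_def)
    have e': "env s'" by (rule env_frame[OF env fr]) simp_all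
    show "?P (Suc i) (set_reg ''q'' (Suc i) (sem ?c s'))"
    proof (cases "?in i = 1")
      case False
      then have "?D (Suc i) = ?D i" by (auto simp: less_Suc_eq)
      moreover have "sem ?c s' = s'" using False a x by simp
      ultimately show ?thesis using P by simp
    next
      case True
      let ?f = "arr s' ''lab''"
      have Di: "?D (Suc i) = insert i (?D i)" "i \<notin> ?D i" using True by (auto simp: less_Suc_eq)
      have F: "?f u \<in> ?D i" if "u \<in> ?D i" for u using P that unfolding components_def by blast
      define s1 where "s1 = sem ?z s'"
      define s2 where "s2 = sem ?h s1"
      define s3 where "s3 = set_arr ''lab'' i i s2"
      define s4 where "s4 = sem ?m s3"
      have s4: "sem ?c s' = s4" using True a x by (simp add: s1_def s2_def s3_def s4_def del: sem.simps(6))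
      have "arr s1 ''hit'' = (\<lambda>v. if v < reg s' ''n'' \<and> True then 0 else arr s' ''hit'' v)"
        unfolding s1_def by (rule guarded_store) auto
      then have h0: "arr s1 ''hit'' v = 0" if "v < n" for v using that nn by simp
      have s1: "arr s1 ''in'' = ?in" "arr s1 ''lab'' = ?f" "reg s1 ''n'' = n" "reg s1 ''q'' = i"
        unfolding s1_def using a nn x by simp_all
      have e1: "env s1" unfolding s1_def by (rule env_sem[OF e']) simp_all
      let ?H = "\<lambda>r s'. \<forall>y<n. arr s' ''hit'' y = 1 \<longleftrightarrow> (\<exists>v<r. v \<in> ?D i \<and> adj i v \<and> ?f v = y)"
      have "?H (reg s1 ''n'') s2" unfolding s2_def
      proof (rule for_invariant[where P = ?H])
        show "?H 0 (set_reg ''v'' 0 s1)" using h0 by simp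
        fix r t
        assume r: "r < reg s1 ''n''" and frt: "frame ?h s1 t" and v: "reg t ''v'' = r" and H: "?H r t"
        have t: "arr t ''in'' = ?in" "arr t ''lab'' = ?f" "reg t ''q'' = i"
          using frt s1 by (auto simp: frame_def)
        have "env t" by (rule env_frame[OF e1 frt]) simp_all
        then have "arr t ''adj'' (arr t ''row'' i + r) = 1 \<longleftrightarrow> adj i r" using i r s1 by (simp add: env_def)
        then have b: "bval ?e t \<longleftrightarrow>
          r \<in> ?D i \<and> adj i r" using t v by simp
        show "?H (Suc r) (set_reg ''v'' (Suc r) (sem ?hb t))"
        proof (cases "r \<in> ?D i \<and> adj i r")
          case True
          then have "bval ?e t" using b by blast
          then have "sem ?hb t = set_arr ''hit'' (?f r) 1 t"
            using t(2) v by (simp only: sem.simps if_True aval.simps)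
          then show ?thesis using H True by (auto simp: less_Suc_eq)
        next
          case False
          then have "\<not> bval ?e t" using b by blast
          then have "sem ?hb t = t" by (simp only: sem.simps if_False)
          then show ?thesis using H False by (auto simp: less_Suc_eq)
        qed
      qed auto
      then have "?H n s2" unfolding s1(3) .
      moreover have "v < n" if "v \<in> ?D i" for v using that i by simp
      ultimately have hit: "arr s2 ''hit'' y = 1 \<longleftrightarrow> (\<exists>v\<in>?D i. adj i v \<and> ?f v = y)" if "y < n" for y
        using that by blast
      have s3: "arr s3 ''in'' = ?in" "arr s3 ''lab'' = ?f(i := i)" "reg s3 ''n'' = n" "reg s3 ''q'' = i"
          "arr s3 ''hit'' = arr s2 ''hit''"
        unfolding s3_def s2_def using s1 by (simp_all del: sem.simps(6))
      have "arr s4 ''lab'' = (\<lambda>v. if v < reg s3 ''n'' \<and> (v \<in> ?D i \<and> arr s2 ''hit'' (?f v) = 1) then i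
          else arr s3 ''lab'' v)"
        unfolding s4_def
      proof (rule guarded_store)
        fix r and t :: state
        assume "r < reg s3 ''n''" and t: "reg t = (reg s3)(''v'' := r)"
          "\<And>a'. a' \<noteq> ''lab'' \<Longrightarrow> arr t a' = arr s3 a'" "\<And>v. r \<le> v \<Longrightarrow> arr t ''lab'' v = arr s3 ''lab'' v"
        show "bval ?d t = (r \<in> ?D i \<and> arr s2 ''hit'' (?f r) = 1) \<and>
            (r \<in> ?D i \<and> arr s2 ''hit'' (?f r) = 1 \<longrightarrow> aval (Reg ''q'') t = i)"
          using t s3 by auto
      qed simp
      then have l4: "arr s4 ''lab'' v = (if v < n \<and> v \<in> ?D i \<and> arr s2 ''hit'' (?f v) = 1 then i
          else (?f(i := i)) v)" for v using s3 by simp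
      have "components (insert i (?D i)) (arr s4 ''lab'')"
      proof (rule components_insert[where f = ?f])
        show "components (?D i) ?f" using P by blast
        show "arr s4 ''lab'' i = i" using l4[of i] by simp
        fix y assume y: "y \<in> ?D i"
        then have "?f y < n" using F[OF y] i by auto
        then show "arr s4 ''lab'' y = (if \<exists>z\<in>?D i. adj i z \<and> ?f z = ?f y then i else ?f y)"
          using l4[of y] hit[of "?f y"] y i by auto
      qed (rule Di(2))
      moreover have "arr s4 ''lab'' v = ?l v" if "v \<notin> insert i (?D i)" for v
        using l4[of v] P that by auto
      ultimately show ?thesis unfolding s4 Di(1) by simp
    qed
  qed auto
  then have "?P n (sem relabel s)" unfolding n relabel_def .
  then show "components D (arr (sem relabel s) ''lab'')"
    "v \<notin> D \<Longrightarrow> arr (sem relabel s) ''lab'' v = arr s ''lab'' v"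
    unfolding D_def by blast+
qed

end

text \<open>Without an old centre, \<open>y\<close> remains \<open>x\<close>, and the truncated
  subtraction yields 0 as a label for the rest of the part; this is harmless, since that rest is
  then empty.\<close>

definition recentre :: fcom where
  "recentre = FSeq (FAssign ''y'' (Reg ''x''))
     (FSeq (FIf (Equal (Arr ''cen'' (Reg ''b'')) (Const 0)) FSkip
        (FSeq (search ''g'' ''v'' (Conj (Equal (Arr ''lab'' (Reg ''v'')) (Reg ''x''))
            (Edge (Sub (Arr ''cen'' (Reg ''b'')) (Const 1)) (Reg ''v''))))
          (FAssign ''y'' (Sub (Reg ''g'') (Const 1)))))
     (FSeq (guarded_store ''v'' always ''in'' (Const 0))
     (FSeq (guarded_store ''v'' (Conj (Equal (Arr ''lab'' (Reg ''v'')) (Reg ''x''))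
          (Neg (Equal (Reg ''v'') (Reg ''y'')))) ''in'' (Const 1))
     (FSeq (guarded_store ''v'' (Conj (Equal (Arr ''part'' (Reg ''v'')) (Reg ''b''))
          (Neg (Equal (Arr ''lab'' (Reg ''v'')) (Reg ''x'')))) ''lab'' (Sub (Arr ''cen'' (Reg ''b'')) (Const 1)))
     (FSeq (FStore ''lab'' (Reg ''y'') (Reg ''y''))
     (FSeq relabel
     (FStore ''cen'' (Reg ''b'') (Add (Reg ''y'') (Const 1)))))))))"

text \<open>The labels are saved in \<open>lx\<close> and \<open>ly\<close> because the last store
  overwrites entries of \<open>lab\<close>; \<open>part\<close> is changed before, as its guard
  needs the old labels.\<close>

definition merge :: fcom where
  "merge = FSeq (FAssign ''g'' (Const 0))
     (FSeq (FFor ''u'' ''n'' (FSeq (search ''f'' ''v''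
         (Conj (Edge (Reg ''u'') (Reg ''v''))
         (Conj (Neg (Equal (Arr ''cen'' (Arr ''part'' (Reg ''u''))) (Add (Reg ''u'') (Const 1))))
         (Conj (Neg (Equal (Arr ''cen'' (Arr ''part'' (Reg ''v''))) (Add (Reg ''v'') (Const 1))))
         (Conj (Neg (Equal (Arr ''lab'' (Reg ''u'')) (Arr ''lab'' (Reg ''v''))))
         (Conj (Neg (Equal (Arr ''cen'' (Arr ''part'' (Reg ''u''))) (Const 0)))
           (Less (Add (Arr ''target'' (Arr ''part'' (Reg ''u''))) (Add (Arr ''target'' (Arr ''part'' (Reg ''u'')))
               (Arr ''target'' (Arr ''part'' (Reg ''u'')))))
             (Arr ''tw'' (Arr ''part'' (Reg ''u''))))))))))
       (FIf (Equal (Reg ''f'') (Const 0)) FSkip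
         (FSeq (FAssign ''x'' (Reg ''u'')) (FSeq (FAssign ''y'' (Sub (Reg ''f'') (Const 1))) (FAssign ''g'' (Const 1)))))))
     (FIf (Equal (Reg ''g'') (Const 0)) (FAssign ''stop'' (Const 1))
       (FSeq (FAssign ''lx'' (Arr ''lab'' (Reg ''x'')))
       (FSeq (FAssign ''ly'' (Arr ''lab'' (Reg ''y'')))
       (FSeq (FAssign ''b'' (Arr ''part'' (Reg ''y'')))
       (FSeq (guarded_store ''v'' (Equal (Arr ''lab'' (Reg ''v'')) (Reg ''lx'')) ''part'' (Reg ''b''))
       (guarded_store ''v'' (Equal (Arr ''lab'' (Reg ''v'')) (Reg ''lx'')) ''lab'' (Reg ''ly''))))))))"

lemma recentre_merge_simps [simp]:
  "wregs recentre = {''y'', ''g'', ''v'', ''q''}" "warrs recentre = {''in'', ''lab'', ''hit'', ''cen''}"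
  "wregs merge = {''g'', ''u'', ''f'', ''v'', ''x'', ''y'', ''stop'', ''lx'', ''ly'', ''b''}"
  "warrs merge = {''part'', ''lab''}"
  "depth recentre = 2" "depth merge = 2"
  "well_formed {''n''} recentre" "well_formed {''n''} merge"
  by (auto simp: recentre_def merge_def)

context phase
begin

lemma recentre:
  assumes env: "env s" and s: "p = arr s ''part''" "l = arr s ''lab''" "z = arr s ''cen''"
    and x: "reg s ''x'' = x" "reg s ''b'' = p x" "x < n" "l x = x" "z (p x) \<noteq> Suc x"
    and heavy: "heavy p (p x)" and big: "L j \<le> wt (fib l x)"
    and rest: "wt (fib p (p x) - fib l x) < L (p x)" "wt (fib p (p x) - fib l x) < L j"
  obtains v where "recentring n E w k L c p l z B j x v (arr (sem recentre s) ''lab'')"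
    "arr (sem recentre s) ''cen'' = z(p x := Suc v)"
proof -
  have n: "reg s ''n'' = n" using env by (simp add: env_def)
  let ?d = "Conj (Equal (Arr ''lab'' (Reg ''v'')) (Reg ''x''))
            (Edge (Sub (Arr ''cen'' (Reg ''b'')) (Const 1)) (Reg ''v''))"
  let ?c = "FIf (Equal (Arr ''cen'' (Reg ''b'')) (Const 0)) FSkip
        (FSeq (search ''g'' ''v'' ?d) (FAssign ''y'' (Sub (Reg ''g'') (Const 1))))"
  let ?z = "guarded_store ''v'' always ''in'' (Const 0)"
  let ?i = "guarded_store ''v'' (Conj (Equal (Arr ''lab'' (Reg ''v'')) (Reg ''x''))
          (Neg (Equal (Reg ''v'') (Reg ''y'')))) ''in'' (Const 1)"
  let ?l = "guarded_store ''v'' (Conj (Equal (Arr ''part'' (Reg ''v'')) (Reg ''b''))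
          (Neg (Equal (Arr ''lab'' (Reg ''v'')) (Reg ''x'')))) ''lab'' (Sub (Arr ''cen'' (Reg ''b'')) (Const 1))"
  define s1 where "s1 = sem ?c (set_reg ''y'' x s)"
  define s2 where "s2 = sem ?i (sem ?z s1)"
  define s3 where "s3 = set_arr ''lab'' (reg s1 ''y'') (reg s1 ''y'') (sem ?l s2)"
  define s4 where "s4 = sem relabel s3"
  define v where "v = reg s1 ''y''"
  have s1: "arr s1 = arr s" "reg s1 ''n'' = n" "reg s1 ''x'' = x" "reg s1 ''b'' = p x"
    unfolding s1_def using n x by auto
  have "sem recentre s = sem (FStore ''cen'' (Reg ''b'') (Add (Reg ''y'') (Const 1)))
      (sem relabel (sem (FStore ''lab'' (Reg ''y'') (Reg ''y'')) (sem ?l (sem ?i (sem ?z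
        (sem ?c (sem (FAssign ''y'' (Reg ''x'')) s)))))))"
    by (simp only: recentre_def sem.simps(4))
  moreover have "sem ?c (sem (FAssign ''y'' (Reg ''x'')) s) = s1"
    unfolding s1_def by (simp only: sem.simps(2) aval.simps x)
  moreover have "sem (FStore ''lab'' (Reg ''y'') (Reg ''y'')) (sem ?l s2) = s3"
    unfolding s3_def s2_def by simp
  moreover have "sem (FStore ''cen'' (Reg ''b'') (Add (Reg ''y'') (Const 1))) s4 = set_arr ''cen'' (p x) (Suc v) s4"
    using s1 unfolding s4_def s3_def s2_def v_def by simp
  ultimately have final: "sem recentre s = set_arr ''cen'' (p x) (Suc v) s4"
    unfolding s4_def s2_def by (simp only:)
  have v: "v \<in> fib l x" "\<And>s. z (p x) = Suc s \<Longrightarrow> adj s v"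
  proof -
    have "v \<in> fib l x \<and> (\<forall>s. z (p x) = Suc s \<longrightarrow> adj s v)"
    proof (cases "z (p x)")
      case 0
      then have "arr s ''cen'' (reg s ''b'') = 0" using s(3) x(2) by simp
      then have "v = x" unfolding v_def s1_def by simp
      then show ?thesis using x 0 by simp
    next
      case (Suc a)
      have star: "star p l (p x) a" using invS(1)[OF invV(1)[OF x(3)] Suc] .
      have "a < n" using centre_label(1)[OF star] .
      have "x \<in> fib p (p x) - {a}" using x(3,5) Suc by auto
      \<comment> \<open>Every piece of a star has a neighbour of the centre, so the search must
        succeed.\<close>
      then have "\<exists>y\<in>fib l (l x). adj a y" using star unfolding star_def by blast
      then obtain y where y: "y \<in> fib l x" "adj a y" unfolding x(4) by blast
      let ?t = "set_reg ''y'' x s"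
      have reg: "reg s1 ''y'' = reg (sem (search ''g'' ''v'' ?d) ?t) ''g'' - 1"
      proof -
        have "arr s ''cen'' (reg s ''b'') \<noteq> 0" using s(3) x(2) Suc by simp
        then show ?thesis unfolding s1_def by simp
      qed
      show ?thesis
      proof (rule search[of "''v''" "''g''" ?t ?d "\<lambda>v. l v = x \<and> adj a v"])
        fix i and s' :: state assume i: "i < reg ?t ''n''" and s': "arr s' = arr ?t"
          "\<And>y. y \<noteq> ''g'' \<Longrightarrow> y \<noteq> ''v'' \<Longrightarrow> reg s' y = reg ?t y" "reg s' ''v'' = i"
        have "arr s ''adj'' (arr s ''row'' a + i) = 1 \<longleftrightarrow> adj a i"
          using env i n \<open>a < n\<close> by (simp add: env_def)
        moreover have "arr s ''cen'' (reg s ''b'') = Suc a" using s(3) x(2) Suc by simp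
        ultimately show "bval ?d s' = (l i = x \<and> adj a i)" using s' s(2) x(1) by simp
      next
        assume "\<And>v. v < reg ?t ''n'' \<Longrightarrow> \<not> (l v = x \<and> adj a v)"
        then show ?thesis using y n by auto
      next
        fix y assume "reg (sem (search ''g'' ''v'' ?d) ?t) ''g'' = Suc y" "y < reg ?t ''n''" "l y = x \<and> adj a y"
        then show ?thesis using reg n Suc by (simp add: v_def)
      qed auto
    qed
    then show "v \<in> fib l x" "\<And>s. z (p x) = Suc s \<Longrightarrow> adj s v" by blast+
  qed
  have "arr (sem ?z s1) ''in'' = (\<lambda>v. if v < reg s1 ''n'' \<and> True then 0 else arr s1 ''in'' v)"
    by (rule guarded_store) auto
  moreover have "arr s2 ''in'' = (\<lambda>u. if u < reg (sem ?z s1) ''n'' \<and> (l u = x \<and> u \<noteq> v) then 1 else arr (sem ?z s1) ''in'' u)"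
    unfolding s2_def by (rule guarded_store) (auto simp: s1 s v_def)
  ultimately have in2: "arr s2 ''in'' u = (if l u = x \<and> u \<noteq> v then 1 else 0)" if "u < n" for u
    using that s1 by simp
  have s2: "reg s2 ''n'' = n" "reg s2 ''b'' = p x" "reg s2 ''x'' = x" "arr s2 ''part'' = p" "arr s2 ''lab'' = l" "arr s2 ''cen'' = z"
    unfolding s2_def using s1 s by auto
  have "arr (sem ?l s2) ''lab'' = (\<lambda>u. if u < reg s2 ''n'' \<and> (p u = p x \<and> l u \<noteq> x) then z (p x) - 1 else arr s2 ''lab'' u)"
    by (rule guarded_store) (auto simp: s2)
  then have l3: "arr s3 ''lab'' u = (if u = v then v else if p u = p x \<and> l u \<noteq> x then z (p x) - 1 else l u)" if "u < n" for u
    using that s2 unfolding s3_def v_def by simp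
  have "env (set_reg ''y'' x s)" using env by simp
  then have "env s1" unfolding s1_def by (rule env_sem) simp_all
  then have "env (sem ?z s1)" by (rule env_sem) simp_all
  then have "env s2" unfolding s2_def by (rule env_sem) simp_all
  then have "env (sem ?l s2)" by (rule env_sem) simp_all
  then have "env s3" unfolding s3_def by simp
  note rel = relabel[OF this]
  have "{u. u < n \<and> arr s3 ''in'' u = 1} = fib l x - {v}"
    using in2 unfolding s3_def by (auto split: if_splits)
  note rel = rel[unfolded this]
  have l': "arr (sem recentre s) ''lab'' = arr s4 ''lab''" using final by simp
  have "recentring n E w k L c p l z B j x v (arr (sem recentre s) ''lab'')"
  proof (unfold_locales)
    show "components (fib l x - {v}) (arr (sem recentre s) ''lab'')" unfolding l' s4_def by (rule rel(1))
    have out: "arr (sem recentre s) ''lab'' u = arr s3 ''lab'' u" if "u \<notin> fib l x - {v}" for u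
      unfolding l' s4_def by (rule rel(2)[OF that])
    show "arr (sem recentre s) ''lab'' v = v" using out[of v] l3[of v] v by auto
    fix u assume u: "u < n"
    show "arr (sem recentre s) ''lab'' u = l u" if "p u \<noteq> p x"
    proof -
      have "u \<notin> fib l x" using piece_subset[OF x(3)] x(4) that by auto
      moreover have "v \<in> fib p (p x)" using piece_subset[OF x(3)] x(4) v(1) by auto
      ultimately show ?thesis using out[of u] l3[OF u] that by auto
    qed
    show "arr (sem recentre s) ''lab'' u = a" if "z (p x) = Suc a" "p u = p x" "l u \<noteq> x" for a
      using out[of u] l3[OF u] that v by auto
  qed (use x heavy big rest v in auto)
  moreover have "arr (sem recentre s) ''cen'' = z(p x := Suc v)"
  proof -
    have "arr s4 ''cen'' = z" using s2 unfolding s4_def s3_def by simp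
    then show ?thesis using final by simp
  qed
  ultimately show ?thesis using that by blast
qed

end

lemma (in partition_instance) heavy_iff: "heavy p b \<longleftrightarrow> L b + (L b + L b) < wt (fib p b)"
  by (simp add: heavy_def numeral_3_eq_3)

context phase
begin

lemma merge:
  assumes env: "env s" and s: "p = arr s ''part''" "l = arr s ''lab''" "z = arr s ''cen''"
    and tw: "\<And>b. b < n \<Longrightarrow> arr s ''tw'' b = wt (fib p b)"
    and small: "\<And>x. x \<in> pieces p l z (p x) \<Longrightarrow> L j \<le> wt (fib l x) \<Longrightarrow> z (p x) = 0 \<and> \<not> heavy p (p x)"
  obtains "reg (sem merge s) ''stop'' = 1" "arr (sem merge s) = arr s" "\<And>b. b \<in> B \<Longrightarrow> \<not> heavy p b"
  | u v where "reg (sem merge s) ''stop'' = reg s ''stop''"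
    "merging n E w k L c p l z B j u v (arr (sem merge s) ''part'') (arr (sem merge s) ''lab'')"
proof -
  have n: "reg s ''n'' = n" using env by (simp add: env_def)
  define Q where "Q u v \<longleftrightarrow> adj u v \<and> z (p u) \<noteq> Suc u \<and> z (p v) \<noteq> Suc v \<and> l u \<noteq> l v \<and>
    z (p u) \<noteq> 0 \<and> heavy p (p u)" for u v
  let ?t = "Arr ''target'' (Arr ''part'' (Reg ''u''))"
  let ?d = "Conj (Edge (Reg ''u'') (Reg ''v''))
         (Conj (Neg (Equal (Arr ''cen'' (Arr ''part'' (Reg ''u''))) (Add (Reg ''u'') (Const 1))))
         (Conj (Neg (Equal (Arr ''cen'' (Arr ''part'' (Reg ''v''))) (Add (Reg ''v'') (Const 1))))
         (Conj (Neg (Equal (Arr ''lab'' (Reg ''u'')) (Arr ''lab'' (Reg ''v''))))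
         (Conj (Neg (Equal (Arr ''cen'' (Arr ''part'' (Reg ''u''))) (Const 0)))
           (Less (Add ?t (Add ?t ?t)) (Arr ''tw'' (Arr ''part'' (Reg ''u''))))))))"
  let ?e = "FIf (Equal (Reg ''f'') (Const 0)) FSkip
         (FSeq (FAssign ''x'' (Reg ''u'')) (FSeq (FAssign ''y'' (Sub (Reg ''f'') (Const 1))) (FAssign ''g'' (Const 1))))"
  let ?c = "FSeq (search ''f'' ''v'' ?d) ?e" and ?s = "set_reg ''g'' 0 s"
  let ?P = "\<lambda>i s'. reg s' ''g'' = 0 \<and> (\<forall>u<i. \<forall>v<n. \<not> Q u v) \<or>
    reg s' ''g'' = 1 \<and> reg s' ''x'' < n \<and> reg s' ''y'' < n \<and> Q (reg s' ''x'') (reg s' ''y'')"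
  define s1 where "s1 = sem (FFor ''u'' ''n'' ?c) ?s"
  have "?P (reg ?s ''n'') s1" unfolding s1_def
  proof (rule for_invariant[where P = ?P])
    fix i s'
    assume "i < reg ?s ''n''" and fr: "frame (FFor ''u'' ''n'' ?c) ?s s'" and u: "reg s' ''u'' = i" and P: "?P i s'"
    have i: "i < n" using \<open>i < _\<close> n by simp
    have a: "arr s' = arr s" and n': "reg s' ''n'' = n" using fr n by (auto simp: frame_def)
    let ?s' = "sem (search ''f'' ''v'' ?d) s'"
    have keep: "reg ?s' ''g'' = reg s' ''g''" "reg ?s' ''x'' = reg s' ''x''" "reg ?s' ''y'' = reg s' ''y''"
      "reg ?s' ''u'' = i" using u by simp_all
    show "?P (Suc i) (set_reg ''u'' (Suc i) (sem ?c s'))"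
    proof (rule search[of "''v''" "''f''" s' ?d "Q i"])
      fix r and t :: state assume r: "r < reg s' ''n''" and t: "arr t = arr s'"
        "\<And>y. y \<noteq> ''f'' \<Longrightarrow> y \<noteq> ''v'' \<Longrightarrow> reg t y = reg s' y" "reg t ''v'' = r"
      have "p i \<in> {1..k}" using invV(1)[OF i] invB(1) by blast
      then have L: "arr s ''target'' (p i) = L (p i)" "arr s ''tw'' (p i) = wt (fib p (p i))"
        using env tw k by (auto simp: env_def)
      have "arr s ''adj'' (arr s ''row'' i + r) = 1 \<longleftrightarrow> adj i r"
        using env i r n' by (simp add: env_def)
      then show "bval ?d t = Q i r" using L t a u s unfolding Q_def heavy_iff by simp
    next
      assume f: "reg ?s' ''f'' = 0" and none: "\<And>v. v < reg s' ''n'' \<Longrightarrow> \<not> Q i v"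
      have e: "sem ?c s' = ?s'" using f by simp
      have none: "\<not> Q i v" if "v < n" for v using none n' that by blast
      show ?thesis
      proof (cases "reg s' ''g'' = 0")
        case True
        then have "\<forall>u<Suc i. \<forall>v<n. \<not> Q u v" using P none by (auto simp: less_Suc_eq)
        then show ?thesis using True unfolding e by (simp add: keep)
      next
        case False
        then show ?thesis using P unfolding e by (simp add: keep)
      qed
    next
      fix v assume f: "reg ?s' ''f'' = Suc v" and v: "v < reg s' ''n''" "Q i v"
      have "sem ?c s' = set_reg ''g'' 1 (set_reg ''y'' v (set_reg ''x'' i ?s'))" using f keep by simp
      then show ?thesis using v i n' by simp
    qed auto
  qed auto
  then have P: "?P n s1" using n by simp
  have s1: "arr s1 = arr s" "reg s1 ''stop'' = reg s ''stop''" "reg s1 ''n'' = n"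
    unfolding s1_def using n by (auto simp del: sem.simps(6))
  let ?m = "guarded_store ''v'' (Equal (Arr ''lab'' (Reg ''v'')) (Reg ''lx'')) ''part'' (Reg ''b'')"
  let ?r = "guarded_store ''v'' (Equal (Arr ''lab'' (Reg ''v'')) (Reg ''lx'')) ''lab'' (Reg ''ly'')"
  let ?D = "FSeq (FAssign ''lx'' (Arr ''lab'' (Reg ''x''))) (FSeq (FAssign ''ly'' (Arr ''lab'' (Reg ''y'')))
    (FSeq (FAssign ''b'' (Arr ''part'' (Reg ''y''))) (FSeq ?m ?r)))"
  have merge: "sem merge s = sem (FIf (Equal (Reg ''g'') (Const 0)) (FAssign ''stop'' (Const 1)) ?D) s1"
    unfolding s1_def merge_def by (simp only: sem.simps(2,4) aval.simps)
  show ?thesis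
  proof (cases "reg s1 ''g'' = 0")
    case True
    then have "sem merge s = set_reg ''stop'' 1 s1" unfolding merge by simp
    moreover have "\<not> Q u v" if "u < n" "v < n" for u v using P True that by simp
    then have "\<not> heavy p b" if "b \<in> B" for b
      using no_heavy_part[OF small _ that] unfolding Q_def by blast
    ultimately show ?thesis using that(1) s1 by simp
  next
    case False
    define x where "x = reg s1 ''x''"
    define y where "y = reg s1 ''y''"
    have Q: "x < n" "y < n" "Q x y" using P False unfolding x_def y_def by auto
    define s2 where "s2 = set_reg ''b'' (p y) (set_reg ''ly'' (l y) (set_reg ''lx'' (l x) s1))"
    have e: "sem merge s = sem ?r (sem ?m s2)"
      unfolding merge s2_def using False s s1 by (simp add: x_def y_def)
    have s2: "arr s2 = arr s" "reg s2 ''n'' = n" "reg s2 ''b'' = p y" "reg s2 ''ly'' = l y" "reg s2 ''lx'' = l x"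
      "reg s2 ''stop'' = reg s ''stop''"
      unfolding s2_def using s1 by simp_all
    have m: "arr (sem ?m s2) ''part'' = (\<lambda>v. if v < reg s2 ''n'' \<and> l v = l x then p y else arr s2 ''part'' v)"
      by (rule guarded_store) (auto simp: s2 s)
    have r: "arr (sem ?r (sem ?m s2)) ''lab'' =
        (\<lambda>v. if v < reg (sem ?m s2) ''n'' \<and> l v = l x then l y else arr (sem ?m s2) ''lab'' v)"
      by (rule guarded_store) (auto simp: s2 s)
    have "merging n E w k L c p l z B j x y (arr (sem merge s) ''part'') (arr (sem merge s) ''lab'')"
    proof unfold_locales
      fix v assume v: "v < n"
      show "arr (sem merge s) ''part'' v = (if l v = l x then p y else p v)"
        unfolding e using m v by (simp add: s2 s)
      show "arr (sem merge s) ''lab'' v = (if l v = l x then l y else l v)"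
        unfolding e using r v by (simp add: s2 s)
    qed (use Q small in \<open>auto simp: Q_def\<close>)
    moreover have "reg (sem merge s) ''stop'' = reg s ''stop''" unfolding e using s2 by simp
    ultimately show ?thesis using that(2) by blast
  qed
qed

end

text \<open>Big pieces of stars and of heavy parts are treated first: they are split off, or
  exchanged with their rest, or receive the centre. Only if there are none may pieces be merged. A
  light part without centre needs no action.\<close>

definition main_body :: fcom where
  "main_body = FSeq weigh
     (FSeq (search ''f'' ''v'' (Conj (Equal (Arr ''lab'' (Reg ''v'')) (Reg ''v''))
        (Conj (Neg (Equal (Arr ''cen'' (Arr ''part'' (Reg ''v''))) (Add (Reg ''v'') (Const 1))))
        (Conj (Leq (Arr ''target'' (Reg ''j'')) (Arr ''pw'' (Reg ''v'')))
        (Disj (Neg (Equal (Arr ''cen'' (Arr ''part'' (Reg ''v''))) (Const 0)))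
          (Less (Add (Arr ''target'' (Arr ''part'' (Reg ''v''))) (Add (Arr ''target'' (Arr ''part'' (Reg ''v'')))
               (Arr ''target'' (Arr ''part'' (Reg ''v'')))))
             (Arr ''tw'' (Arr ''part'' (Reg ''v'')))))))))
     (FIf (Equal (Reg ''f'') (Const 0)) merge
     (FSeq (FAssign ''x'' (Sub (Reg ''f'') (Const 1)))
     (FSeq (FAssign ''b'' (Arr ''part'' (Reg ''x'')))
     (FIf (Leq (Arr ''target'' (Reg ''b'')) (Sub (Arr ''tw'' (Reg ''b'')) (Arr ''pw'' (Reg ''x''))))
       (FSeq (guarded_store ''v'' (Equal (Arr ''lab'' (Reg ''v'')) (Reg ''x'')) ''part'' (Reg ''j'')) next_phase)
     (FIf (Leq (Arr ''target'' (Reg ''j'')) (Sub (Arr ''tw'' (Reg ''b'')) (Arr ''pw'' (Reg ''x''))))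
       (FSeq (guarded_store ''v'' (Conj (Equal (Arr ''part'' (Reg ''v'')) (Reg ''b''))
           (Neg (Equal (Arr ''lab'' (Reg ''v'')) (Reg ''x'')))) ''part'' (Reg ''j'')) next_phase)
     recentre))))))"

lemma main_body_simps: "well_formed {''n''} main_body" "depth main_body = 2"
  by (auto simp: main_body_def)

section \<open>One round of the main loop\<close>

context partition_instance
begin

text \<open>There are two ways to leave the loop: \<open>j = 0\<close> means that every target is
  served, and \<open>stop\<close> that no part is heavy any more.\<close>

definition main_inv :: "state \<Rightarrow> bool" where
  "main_inv s \<longleftrightarrow> env s \<and>
     (reg s ''j'' = 0 \<and> built s = {1..k} \<and> parts_invar (arr s ''part'') (built s) \<or>
      reg s ''j'' \<noteq> 0 \<and> invar (arr s ''part'') (arr s ''lab'') (arr s ''cen'') (built s) (reg s ''j'') \<and>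
      (reg s ''stop'' \<noteq> 0 \<longrightarrow> (\<forall>b\<in>built s. \<not> heavy (arr s ''part'') b)))"

text \<open>A phase takes at most \<open>k (2 n + 1)\<close> rounds.\<close>

definition work_left :: "state \<Rightarrow> nat" where
  "work_left s = (if reg s ''j'' = 0 \<or> reg s ''stop'' \<noteq> 0 then 0
     else (k - card (built s)) * (k * (2 * n + 1) + 1) +
       potential (arr s ''part'') (arr s ''lab'') (arr s ''cen'') (built s) (reg s ''j'') + 1)"

text \<open>The newly served target releases one block \<open>k * (2 * n + 1) + 1\<close>. It pays
  for the fresh potential, at most \<open>2 * n + 1\<close> for each of at most \<open>k\<close>
  parts, and for the summand 1 of \<open>work_left\<close>.\<close>

lemma next_phase:
  assumes env: "env s" and j: "reg s ''j'' \<in> {1..k} - built s"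
    and parts: "parts_invar (arr s ''part'') (insert (reg s ''j'') (built s))"
    and stop: "reg s ''stop'' = 0"
  defines "s' \<equiv> sem next_phase s"
  shows "main_inv s'" "built s' = insert (reg s ''j'') (built s)"
    "work_left s' \<le> (k - card (built s)) * (k * (2 * n + 1) + 1)"
proof -
  let ?B = "insert (reg s ''j'') (built s)" and ?p = "arr s ''part''"
  define s1 where "s1 = set_arr ''built'' (reg s ''j'') 1 s"
  have e1: "env s1" unfolding s1_def using env by simp
  have b1: "built s1 = ?B" by (auto simp: built_def s1_def)
  define s2 where "s2 = sem pick s1"
  have s2: "env s2" "built s2 = ?B" "arr s2 ''part'' = ?p" "reg s2 ''stop'' = 0"
    unfolding s2_def using e1 stop b1 by (auto simp: built_def s1_def intro: env_sem)
  have s': "s' = sem reset s2" by (simp add: s'_def next_phase_def s2_def s1_def)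
  have B: "?B \<subseteq> {1..k}" using parts unfolding parts_invar_def by blast
  then have fin: "finite ?B" by (rule finite_subset) simp
  have n: "reg s2 ''n'' = n" using s2 by (simp add: env_def)
  have p: "arr s2 ''part'' v < n" if "v < n" for v
  proof -
    have "?p v \<in> ?B" using parts that unfolding parts_invar_def by blast
    then have "?p v \<in> {1..k}" using B by blast
    then have "?p v < n" using k(2) by simp
    then show ?thesis unfolding s2(3) .
  qed
  note reset = reset[OF n p, folded s']
  have s'_simps: "built s' = ?B" "arr s' ''part'' = ?p" "reg s' ''stop'' = 0" "reg s' ''j'' = reg s2 ''j''"
    unfolding s' using s2 by (simp_all add: built_def)
  show "built s' = ?B" by fact
  have e': "env s'" unfolding s' by (rule env_sem[OF s2(1)]) simp_all
  have cen: "arr s' ''cen'' b = 0" if "b \<in> ?B" for b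
    using reset(3)[of b] that B k by auto
  have "card ?B \<le> k" using card_mono[OF _ B] by simp
  moreover have cB: "card ?B = Suc (card (built s))" using j fin by simp
  ultimately have kB: "k - card (built s) = Suc (k - card ?B)" by simp
  have m: "work_left s' \<le> (k - card (built s)) * (k * (2 * n + 1) + 1)"
  proof (cases "reg s' ''j'' = 0")
    case False
    have "potential ?p (arr s' ''lab'') (arr s' ''cen'') ?B (reg s' ''j'') = card ?B * (2 * n + 1)"
      by (rule potential_new_phase) (rule cen)
    also have "\<dots> \<le> k * (2 * n + 1)" using \<open>card ?B \<le> k\<close> by (rule mult_le_mono1)
    finally show ?thesis using False unfolding work_left_def s'_simps kB by simp
  qed (simp add: work_left_def)
  then show "work_left s' \<le> (k - card (built s)) * (k * (2 * n + 1) + 1)" .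
  show "main_inv s'"
  proof (rule pick[OF e1])
    assume "reg (sem pick s1) ''j'' = 0" "{1..k} \<subseteq> built s1"
    then show ?thesis using e' parts B b1 s'_simps unfolding main_inv_def s2_def by auto
  next
    assume j': "reg (sem pick s1) ''j'' \<in> {1..k} - built s1"
      "\<And>i. i \<in> {1..k} - built s1 \<Longrightarrow> L i \<le> L (reg (sem pick s1) ''j'')"
    have "invar ?p (arr s' ''lab'') (arr s' ''cen'') ?B (reg s' ''j'')"
    proof (rule new_phase[OF parts])
      show "reg s' ''j'' \<in> {1..k} - ?B" using j'(1) b1 s'_simps unfolding s2_def by simp
      show "L i \<le> L (reg s' ''j'')" if "i \<in> {1..k} - ?B" for i
        using j'(2)[of i] that b1 s'_simps unfolding s2_def by simp
      show "arr s' ''lab'' v < n \<and> ?p (arr s' ''lab'' v) = ?p v" if "v < n" for v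
        using reset(1)[OF _ that] s2(3) by simp
      show "arr s' ''lab'' u = arr s' ''lab'' v" if "u < n" "v < n" "?p u = ?p v" for u v
        using reset(2)[OF _ that(1,2)] that(3) s2(3) by simp
    qed (rule cen)
    moreover have "reg s' ''j'' \<noteq> 0" using j'(1) s'_simps unfolding s2_def by auto
    ultimately show ?thesis using e' s'_simps unfolding main_inv_def by simp
  qed
qed

lemma main_body:
  assumes inv: "main_inv s" and j: "reg s ''j'' \<noteq> 0" and stop: "reg s ''stop'' = 0"
  defines "s' \<equiv> sem main_body s"
  shows "main_inv s' \<and> work_left s' < work_left s"
proof -
  define p where "p = arr s ''part''"
  define l where "l = arr s ''lab''"
  define z where "z = arr s ''cen''"
  define B where "B = built s"
  define jj where "jj = reg s ''j''"
  have env: "env s" using inv by (simp add: main_inv_def)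
  interpret phase n E w k L c p l z B jj
    using inv j by unfold_locales (simp add: main_inv_def p_def l_def z_def B_def jj_def)
  have n: "reg s ''n'' = n" using env by (simp add: env_def)
  have jj: "jj \<noteq> 0" using j by (simp add: jj_def)
  define s1 where "s1 = sem weigh s"
  have e1: "env s1" unfolding s1_def by (rule env_sem[OF env]) simp_all
  have s1: "arr s1 ''part'' = p" "arr s1 ''lab'' = l" "arr s1 ''cen'' = z" "built s1 = B" "reg s1 ''j'' = jj"
    "reg s1 ''stop'' = 0" "reg s1 ''n'' = n"
    unfolding s1_def p_def l_def z_def B_def jj_def using stop n by (simp_all add: built_def)
  have tw: "arr s1 ''tw'' b = wt (fib p b)" if "b < n" for b
    using weigh(1)[OF env that] by (simp add: s1_def p_def)
  have pw: "arr s1 ''pw'' x = wt (fib l x)" if "x < n" for x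
    using weigh(2)[OF env that] by (simp add: s1_def l_def)
  have target: "arr s1 ''target'' i = L i" if "i \<in> {1..k}" for i using e1 that by (simp add: env_def)
  have pk: "p v \<in> {1..k}" "p v < n" if "v < n" for v using invV(1)[OF that] invB(1) k by auto
  have work_left: "work_left s = (k - card B) * (k * (2 * n + 1) + 1) + potential p l z B jj + 1"
    using j stop by (simp add: work_left_def p_def l_def z_def B_def jj_def)
  let ?t = "Arr ''target'' (Arr ''part'' (Reg ''v''))"
  let ?d = "Conj (Equal (Arr ''lab'' (Reg ''v'')) (Reg ''v''))
        (Conj (Neg (Equal (Arr ''cen'' (Arr ''part'' (Reg ''v''))) (Add (Reg ''v'') (Const 1))))
        (Conj (Leq (Arr ''target'' (Reg ''j'')) (Arr ''pw'' (Reg ''v'')))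
        (Disj (Neg (Equal (Arr ''cen'' (Arr ''part'' (Reg ''v''))) (Const 0)))
          (Less (Add ?t (Add ?t ?t)) (Arr ''tw'' (Arr ''part'' (Reg ''v'')))))))"
  define s2 where "s2 = sem (search ''f'' ''v'' ?d) s1"
  have e2: "env s2" unfolding s2_def by (rule env_sem[OF e1]) simp_all
  have arr2: "arr s2 = arr s1" unfolding s2_def by auto
  have reg2: "reg s2 ''j'' = jj" "reg s2 ''stop'' = 0" "reg s2 ''n'' = n" unfolding s2_def using s1 by simp_all
  have built2: "built s2 = B" using s1(4) by (simp add: built_def arr2)
  let ?A = "Sub (Arr ''tw'' (Reg ''b'')) (Arr ''pw'' (Reg ''x''))"
  let ?s1 = "guarded_store ''v'' (Equal (Arr ''lab'' (Reg ''v'')) (Reg ''x'')) ''part'' (Reg ''j'')"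
  let ?s2 = "guarded_store ''v'' (Conj (Equal (Arr ''part'' (Reg ''v'')) (Reg ''b''))
           (Neg (Equal (Arr ''lab'' (Reg ''v'')) (Reg ''x'')))) ''part'' (Reg ''j'')"
  let ?i = "FIf (Leq (Arr ''target'' (Reg ''j'')) ?A) (FSeq ?s2 next_phase) recentre"
  let ?h = "FIf (Leq (Arr ''target'' (Reg ''b'')) ?A) (FSeq ?s1 next_phase) ?i"
  let ?g = "FSeq (FAssign ''x'' (Sub (Reg ''f'') (Const 1))) (FSeq (FAssign ''b'' (Arr ''part'' (Reg ''x''))) ?h)"
  have s': "s' = sem (FIf (Equal (Reg ''f'') (Const 0)) merge ?g) s2"
    unfolding s'_def s2_def s1_def main_body_def by (simp only: sem.simps(4))
  have Q: "bval ?d t \<longleftrightarrow> v \<in> pieces p l z (p v) \<and> L jj \<le> wt (fib l v) \<and> (z (p v) \<noteq> 0 \<or> heavy p (p v))"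
    if "v < n" "arr t = arr s1" "reg t ''v'' = v" "reg t ''j'' = jj" for v and t :: state
    using that s1 tw[OF pk(2)] pw[OF that(1)] target[OF pk(1)] target[OF invB(2)]
    by (auto simp: pieces_def heavy_iff)
  show ?thesis
  proof (rule search[of "''v''" "''f''" s1 ?d "\<lambda>v. v \<in> pieces p l z (p v) \<and> L jj \<le> wt (fib l v) \<and> (z (p v) \<noteq> 0 \<or> heavy p (p v))"])
    fix i and t :: state
    assume "i < reg s1 ''n''" "arr t = arr s1" "\<And>y. y \<noteq> ''f'' \<Longrightarrow> y \<noteq> ''v'' \<Longrightarrow> reg t y = reg s1 y" "reg t ''v'' = i"
    then show "bval ?d t = (i \<in> pieces p l z (p i) \<and> L jj \<le> wt (fib l i) \<and> (z (p i) \<noteq> 0 \<or> heavy p (p i)))"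
      using s1 by (intro Q) simp_all
  next
    assume f: "reg (sem (search ''f'' ''v'' ?d) s1) ''f'' = 0"
      and none: "\<And>v. v < reg s1 ''n'' \<Longrightarrow>
        \<not> (v \<in> pieces p l z (p v) \<and> L jj \<le> wt (fib l v) \<and> (z (p v) \<noteq> 0 \<or> heavy p (p v)))"
    have s'm: "s' = sem merge s2" using f unfolding s' s2_def by simp
    have e': "env s'" unfolding s'm by (rule env_sem[OF e2]) simp_all
    have b': "built s' = B" "reg s' ''j'' = jj" "arr s' ''cen'' = z"
      unfolding s'm using reg2 built2 arr2 s1 by (simp_all add: built_def)
    show ?thesis
    proof (rule merge[OF e2, folded s'm])
      show "p = arr s2 ''part''" "l = arr s2 ''lab''" "z = arr s2 ''cen''" using arr2 s1 by simp_all
      show "arr s2 ''tw'' b = wt (fib p b)" if "b < n" for b using tw[OF that] arr2 by simp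
      show "z (p x) = 0 \<and> \<not> heavy p (p x)" if "x \<in> pieces p l z (p x)" "L jj \<le> wt (fib l x)" for x
        using none[of x] that s1(7) by (auto simp: pieces_def)
    next
      assume st: "reg s' ''stop'' = 1" and a: "arr s' = arr s2" and nh: "\<And>b. b \<in> B \<Longrightarrow> \<not> heavy p b"
      have "main_inv s'" unfolding main_inv_def b'
        using e' nh inv a arr2 s1 b'(3) j phase.inv[OF phase_axioms] by (auto simp: jj_def[symmetric])
      \<comment> \<open>The summand 1 in \<open>work_left\<close> makes this a strict decrease even
        if the potential was already 0.\<close>
      moreover have "work_left s' = 0" using st by (simp add: work_left_def)
      ultimately show ?thesis using work_left by simp
    next
      fix u v assume st: "reg s' ''stop'' = reg s2 ''stop''"
        and m: "merging n E w k L c p l z B jj u v (arr s' ''part'') (arr s' ''lab'')"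
      have "main_inv s'" unfolding main_inv_def b' using e' j st reg2 merging.invar'[OF m] by (simp add: jj_def)
      moreover have "work_left s' = (k - card B) * (k * (2 * n + 1) + 1) +
          potential (arr s' ''part'') (arr s' ''lab'') z B jj + 1"
        using jj st reg2 by (simp add: work_left_def b')
      then have "work_left s' < work_left s" using merging.potential_decreases[OF m] work_left by simp
      ultimately show ?thesis by blast
    qed
  next
    fix x assume f: "reg (sem (search ''f'' ''v'' ?d) s1) ''f'' = Suc x" and xn: "x < reg s1 ''n''"
      and x: "x \<in> pieces p l z (p x) \<and> L jj \<le> wt (fib l x) \<and> (z (p x) \<noteq> 0 \<or> heavy p (p x))"
    have x': "x < n" "l x = x" "z (p x) \<noteq> Suc x" using x by (auto simp: pieces_def)
    define s3 where "s3 = set_reg ''b'' (p x) (set_reg ''x'' x s2)"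
    have e3: "env s3" unfolding s3_def using e2 by simp
    have "s' = sem ?g s2" using f unfolding s' s2_def by simp
    also have "sem ?g s2 = sem ?h s3"
    proof -
      have "reg s2 ''f'' = Suc x" using f unfolding s2_def .
      then have "sem (FAssign ''b'' (Arr ''part'' (Reg ''x''))) (sem (FAssign ''x'' (Sub (Reg ''f'') (Const 1))) s2) = s3"
        unfolding s3_def using arr2 s1 by simp
      then show ?thesis by (simp only: sem.simps(4))
    qed
    finally have s'3: "s' = sem ?h s3" .
    have s3: "arr s3 = arr s1" "reg s3 ''x'' = x" "reg s3 ''b'' = p x" "reg s3 ''j'' = jj" "reg s3 ''stop'' = 0"
      "reg s3 ''n'' = n" unfolding s3_def using arr2 reg2 by simp_all
    have b3: "built s3 = B" using built2 by (simp add: s3_def built_def)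
    have "fib l x \<subseteq> fib p (p x)" using piece_subset[OF x'(1)] x'(2) by simp
    \<comment> \<open>The piece is contained in its part, so the truncated subtraction is
      exact.\<close>
    then have A: "aval ?A s3 = wt (fib p (p x) - fib l x)"
      using wt_Diff[of "fib p (p x)" "fib l x"] tw[OF pk(2)] pw x' s3 by simp
    have c1: "bval (Leq (Arr ''target'' (Reg ''b'')) ?A) s3 \<longleftrightarrow> L (p x) \<le> wt (fib p (p x) - fib l x)"
      using A s3 target[OF pk(1)[OF x'(1)]] by (simp only: bval.simps aval.simps) (simp add: not_less)
    have c2: "bval (Leq (Arr ''target'' (Reg ''j'')) ?A) s3 \<longleftrightarrow> L jj \<le> wt (fib p (p x) - fib l x)"
      using A s3 target[OF invB(2)] by (simp only: bval.simps aval.simps) (simp add: not_less)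
    have split: "main_inv s' \<and> work_left s' < work_left s"
      if s't: "s' = sem next_phase t" and t: "env t" "reg t ''j'' = jj" "reg t ''stop'' = 0" "built t = B"
        and parts: "parts_invar (arr t ''part'') (insert jj B)" for t
    proof -
      have "reg t ''j'' \<in> {1..k} - built t" using t invB(2,3) by simp
      note np = next_phase[OF t(1) this _ t(3), unfolded t(2,4), OF parts, folded s't]
      show ?thesis using np(1,3) work_left by simp
    qed
    show ?thesis
    proof (cases "L (p x) \<le> wt (fib p (p x) - fib l x)")
      case True
      let ?t = "sem ?s1 s3"
      have "arr ?t ''part'' = (\<lambda>v. if v < reg s3 ''n'' \<and> l v = x then jj else arr s3 ''part'' v)"
        by (rule guarded_store) (auto simp: s3 s1)
      then have "parts_invar (arr ?t ''part'') (insert jj B)"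
        using x True s3 s1 by (intro split_piece[of x]) auto
      moreover have "s' = sem next_phase ?t" unfolding s'3 using c1 True by (simp only: sem.simps if_True)
      moreover have "env ?t" by (rule env_sem[OF e3]) simp_all
      ultimately show ?thesis using s3 b3 by (intro split[of ?t]) (simp_all add: built_def)
    next
      case False
      have s'4: "s' = sem ?i s3" unfolding s'3 using c1 False by (simp only: sem.simps if_False)
      show ?thesis
      proof (cases "L jj \<le> wt (fib p (p x) - fib l x)")
        case True
        let ?t = "sem ?s2 s3"
        have "arr ?t ''part'' = (\<lambda>v. if v < reg s3 ''n'' \<and> (p v = p x \<and> l v \<noteq> x) then jj else arr s3 ''part'' v)"
          by (rule guarded_store) (auto simp: s3 s1)
        then have "parts_invar (arr ?t ''part'') (insert jj B)"
          using x True False s3 s1 by (intro split_rest[of x "p x"]) auto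
        moreover have "s' = sem next_phase ?t" unfolding s'4 using c2 True by (simp only: sem.simps if_True)
        moreover have "env ?t" by (rule env_sem[OF e3]) simp_all
        ultimately show ?thesis using s3 b3 by (intro split[of ?t]) (simp_all add: built_def)
      next
        case False': False
        have s'5: "s' = sem recentre s3" unfolding s'4 using c2 False' by (simp only: sem.simps if_False)
        \<comment> \<open>The search found a star or a heavy part, and in a light star a big piece
          splits.\<close>
        have heavy: "heavy p (p x)"
        proof (rule ccontr)
          assume nh: "\<not> heavy p (p x)"
          then obtain a where a: "z (p x) = Suc a" using x by (cases "z (p x)") auto
          then have "splits p l (p x) x"
            using invS(3)[OF invV(1)[OF x'(1)] a nh, of x] x x' by auto
          then show False using False by (simp add: splits_def)
        qed
        show ?thesis
        proof (rule recentre[of s3 x])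
          fix v assume r: "recentring n E w k L c p l z B jj x v (arr (sem recentre s3) ''lab'')"
            and cen: "arr (sem recentre s3) ''cen'' = z(p x := Suc v)"
          have e': "env s'" unfolding s'5 by (rule env_sem[OF e3]) simp_all
          have b': "built s' = B" "reg s' ''j'' = jj" "arr s' ''part'' = p" "reg s' ''stop'' = 0"
            unfolding s'5 using s3 b3 s1 by (simp_all add: built_def)
          have "main_inv s'" unfolding main_inv_def b'
            using e' j recentring.invar'[OF r] cen by (simp add: jj_def s'5)
          moreover have "work_left s' = (k - card B) * (k * (2 * n + 1) + 1) +
              potential p (arr s' ''lab'') (z(p x := Suc v)) B jj + 1"
            using jj cen[folded s'5] by (simp add: work_left_def b')
          then have "work_left s' < work_left s"
            using recentring.potential_decreases[OF r, folded s'5] work_left by simp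
          ultimately show ?thesis by blast
        qed (use e3 s3 s1 x' x heavy False False' in simp_all)
      qed
    qed
  qed simp_all
qed

end

text \<open>Each \<open>x\<close> is tested by computing the components of its part without
  \<open>x\<close>: \<open>g\<close> finds some vertex there and \<open>y\<close> one with a
  different label, so \<open>x\<close> is suitable iff \<open>g\<close> succeeds and
  \<open>y\<close> fails. The labels are mere scratch space now.\<close>

definition fill :: fcom where
  "fill = FSeq (FAssign ''f'' (Const 0))
     (FSeq (FFor ''x'' ''n''
       (FSeq (guarded_store ''v'' always ''in'' (Const 0))
       (FSeq (guarded_store ''v'' (Conj (Equal (Arr ''part'' (Reg ''v'')) (Arr ''part'' (Reg ''x'')))
           (Neg (Equal (Reg ''v'') (Reg ''x'')))) ''in'' (Const 1))
       (FSeq relabel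
       (FSeq (search ''g'' ''v'' (Equal (Arr ''in'' (Reg ''v'')) (Const 1)))
       (FSeq (search ''y'' ''v'' (Conj (Equal (Arr ''in'' (Reg ''v'')) (Const 1))
           (Neg (Equal (Arr ''lab'' (Reg ''v'')) (Arr ''lab'' (Sub (Reg ''g'') (Const 1)))))))
       (FIf (Conj (Neg (Equal (Reg ''g'') (Const 0))) (Equal (Reg ''y'') (Const 0)))
         (FAssign ''f'' (Add (Reg ''x'') (Const 1))) FSkip)))))))
     (FSeq (FStore ''part'' (Sub (Reg ''f'') (Const 1)) (Reg ''j''))
     (FSeq (FStore ''built'' (Reg ''j'') (Const 1)) pick)))"

text \<open>All vertices are given to the largest target, after which \<open>next_phase\<close> can
  proceed as after a split. The offsets in \<open>row\<close> arise by repeated addition, with the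
  register \<open>x\<close> starting at 0.\<close>

definition init :: "aexp \<Rightarrow> fcom" where
  "init e = FSeq (FFor ''v'' ''n'' (FSeq (FStore ''row'' (Reg ''v'') (Reg ''x''))
       (FAssign ''x'' (Add (Reg ''x'') (Reg ''n'')))))
     (FSeq (FFor ''u'' ''m'' (FSeq
         (FStore ''adj'' (Add (Arr ''row'' (Arr ''source'' (Reg ''u''))) (Arr ''sink'' (Reg ''u''))) (Const 1))
         (FStore ''adj'' (Add (Arr ''row'' (Arr ''sink'' (Reg ''u''))) (Arr ''source'' (Reg ''u''))) (Const 1))))
     (FSeq (guarded_store ''v'' always ''wgt'' e)
     (FSeq pick
     (FSeq (guarded_store ''v'' always ''part'' (Reg ''j''))
     next_phase))))"

lemma fill_init_simps:
  "well_formed {''n''} fill" "depth fill = 3"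
  "well_formed {''n'', ''m''} (init e)" "depth (init e) = 1"
  by (auto simp: fill_def init_def)

definition main_guard :: bexp where
  "main_guard = Conj (Neg (Equal (Reg ''j'') (Const 0))) (Equal (Reg ''stop'') (Const 0))"

definition fill_guard :: bexp where
  "fill_guard = Neg (Equal (Reg ''j'') (Const 0))"

definition program :: "aexp \<Rightarrow> com" where
  "program e = Seq (compile (init e))
     (Seq (While main_guard (compile main_body)) (While fill_guard (compile fill)))"

text \<open>The coefficients come from the estimates in \<open>total_time\<close>.\<close>

definition time_factor :: "aexp \<Rightarrow> nat" where
  "time_factor e = 3 * factor (init e) + 40 * (factor main_body + bcost main_guard + 1) +
     32 * (factor fill + bcost fill_guard + 1)"

section \<open>Minimum degree, filling up, and initialisation\<close>

context partition_instance
begin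

text \<open>If \<open>v\<close> had fewer than \<open>k\<close> neighbours, removing them would
  leave a connected graph in which \<open>v\<close> is isolated, hence \<open>v\<close> alone; but
  \<open>k < n\<close> leaves at least two vertices.\<close>

lemma degree:
  assumes v: "v < n"
  shows "k \<le> card {e \<in> E. v \<in> e}"
proof (rule ccontr)
  assume small: "\<not> k \<le> card {e \<in> E. v \<in> e}"
  have E: "e \<subseteq> {..<n} \<and> card e = 2" if "e \<in> E" for e using simple that by (simp add: simple_graph_def)
  have fE: "finite E" by (rule finite_subset[of _ "Pow {..<n}"]) (use E in auto)
  let ?N = "{u. u < n \<and> adj v u}" and ?V = "{..<n}"
  have vN: "v \<notin> ?N" using E[of "{v}"] by (auto simp: adj_def)
  have "inj_on (\<lambda>u. {v, u}) ?N" by (auto simp: inj_on_def doubleton_eq_iff)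
  then have "card ?N = card ((\<lambda>u. {v, u}) ` ?N)" by (simp add: card_image)
  also have "\<dots> \<le> card {e \<in> E. v \<in> e}" using fE by (intro card_mono) (auto simp: adj_def)
  finally have cN: "card ?N < k" using small by simp
  moreover have NV: "?N \<subseteq> ?V" by auto
  ultimately have "connected_graph (?V - ?N) (induced_edges E (?V - ?N))"
    using inst by (simp add: gl_instance_def k_connected_def)
  then have conn: "conn (?V - ?N)" by (simp add: connected_graph_iff_conn)
  have "{v} = ?V - ?N" using v vN by (intro connD[OF conn]) auto
  then have "card (?V - ?N) = 1" by (metis card_1_singleton_iff One_nat_def)
  moreover have "card (?V - ?N) = n - card ?N" using NV by (subst card_Diff_subset) auto
  ultimately show False using cN k by simp
qed

text \<open>Counting the incidences of vertices and edges in two ways, with every degree at least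
  \<open>k\<close>.\<close>

lemma edge_count: "k * n \<le> 2 * card E"
proof -
  have E: "e \<subseteq> {..<n} \<and> card e = 2" if "e \<in> E" for e using simple that by (simp add: simple_graph_def)
  have fE: "finite E" by (rule finite_subset[of _ "Pow {..<n}"]) (use E in auto)
  have "{v \<in> {..<n}. v \<in> e} = e" if "e \<in> E" for e using E[OF that] by auto
  then have "(\<Sum>v<n. card {e \<in> E. v \<in> e}) = (\<Sum>e\<in>E. 2)"
    using E fE by (intro sum_multicount_gen) auto
  moreover have "(\<Sum>v<n. k) \<le> (\<Sum>v<n. card {e \<in> E. v \<in> e})" by (intro sum_mono degree) simp
  ultimately show ?thesis by (simp add: mult.commute)
qed

definition fill_inv :: "state \<Rightarrow> bool" where
  "fill_inv s \<longleftrightarrow> env s \<and> fill_invar (arr s ''part'') (built s) \<and>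
     (if reg s ''j'' = 0 then built s = {1..k} else reg s ''j'' \<in> {1..k} - built s)"

lemma fill:
  assumes inv: "fill_inv s" and j: "reg s ''j'' \<noteq> 0"
  defines "s' \<equiv> sem fill s"
  shows "fill_inv s' \<and> k - card (built s') < k - card (built s)"
proof -
  let ?p = "arr s ''part''" and ?j = "reg s ''j''" and ?B = "built s"
  have env: "env s" and fi: "fill_invar ?p ?B" and jB: "?j \<in> {1..k} - ?B"
    using inv j by (auto simp: fill_inv_def)
  have n: "reg s ''n'' = n" using env by (simp add: env_def)
  define R where "R v \<longleftrightarrow> conn (fib ?p (?p v) - {v})" for v
  let ?z = "guarded_store ''v'' always ''in'' (Const 0)"
  let ?i = "guarded_store ''v'' (Conj (Equal (Arr ''part'' (Reg ''v'')) (Arr ''part'' (Reg ''x'')))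
           (Neg (Equal (Reg ''v'') (Reg ''x'')))) ''in'' (Const 1)"
  let ?d = "Equal (Arr ''in'' (Reg ''v'')) (Const 1)"
  let ?d' = "Conj ?d (Neg (Equal (Arr ''lab'' (Reg ''v'')) (Arr ''lab'' (Sub (Reg ''g'') (Const 1)))))"
  let ?e = "Conj (Neg (Equal (Reg ''g'') (Const 0))) (Equal (Reg ''y'') (Const 0))"
  let ?c = "FSeq ?z (FSeq ?i (FSeq relabel (FSeq (search ''g'' ''v'' ?d) (FSeq (search ''y'' ''v'' ?d')
    (FIf ?e (FAssign ''f'' (Add (Reg ''x'') (Const 1))) FSkip)))))"
  let ?s = "set_reg ''f'' 0 s"
  let ?P = "\<lambda>i s'. reg s' ''f'' = 0 \<and> (\<forall>v<i. \<not> R v) \<or> (\<exists>v<n. reg s' ''f'' = Suc v \<and> R v)"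
  define s1 where "s1 = sem (FFor ''x'' ''n'' ?c) ?s"
  have "?P (reg ?s ''n'') s1" unfolding s1_def
  proof (rule for_invariant[where P = ?P])
    fix i s'
    assume "i < reg ?s ''n''" and fr: "frame (FFor ''x'' ''n'' ?c) ?s s'" and x: "reg s' ''x'' = i" and P: "?P i s'"
    have i: "i < n" using \<open>i < _\<close> n by simp
    have a: "arr s' ''part'' = ?p" and n': "reg s' ''n'' = n" using fr n by (auto simp: frame_def)
    define t1 where "t1 = sem ?i (sem ?z s')"
    have "env ?s" using env by simp
    then have "env s'" by (rule env_frame[OF _ fr]) simp_all
    then have "env (sem ?z s')" by (rule env_sem) simp_all
    then have e1: "env t1" unfolding t1_def by (rule env_sem) simp_all
    have z: "arr (sem ?z s') ''in'' = (\<lambda>v. if v < reg s' ''n'' \<and> True then 0 else arr s' ''in'' v)"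
      by (rule guarded_store) auto
    have in1: "arr t1 ''in'' = (\<lambda>v. if v < reg (sem ?z s') ''n'' \<and> (?p v = ?p i \<and> v \<noteq> i) then 1
        else arr (sem ?z s') ''in'' v)"
      unfolding t1_def by (rule guarded_store) (auto simp: a x)
    define D where "D = fib ?p (?p i) - {i}"
    have in_D: "arr t1 ''in'' v = 1 \<longleftrightarrow> v \<in> D" if "v < n" for v
      using that n' by (simp add: in1 z D_def)
    then have D_eq: "{v. v < n \<and> arr t1 ''in'' v = 1} = D" by (auto simp: D_def)
    define t2 where "t2 = sem relabel t1"
    have comps: "components D (arr t2 ''lab'')" unfolding t2_def using relabel(1)[OF e1] unfolding D_eq .
    have t2: "arr t2 ''in'' = arr t1 ''in''" "reg t2 ''n'' = n" "reg t2 ''x'' = i" "reg t2 ''f'' = reg s' ''f''"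
      unfolding t2_def t1_def using n' x by simp_all
    define t3 where "t3 = sem (search ''g'' ''v'' ?d) t2"
    have t3: "arr t3 = arr t2" "reg t3 ''n'' = n" "reg t3 ''x'' = i" "reg t3 ''f'' = reg s' ''f''"
      unfolding t3_def using t2 by auto
    define t4 where "t4 = sem (search ''y'' ''v'' ?d') t3"
    have t4: "arr t4 = arr t2" "reg t4 ''n'' = n" "reg t4 ''x'' = i" "reg t4 ''g'' = reg t3 ''g''" "reg t4 ''f'' = reg s' ''f''"
      unfolding t4_def using t3 by auto
    have b: "bval ?e t4 \<longleftrightarrow> R i"
    proof (rule search[of "''v''" "''g''" t2 ?d "\<lambda>v. v \<in> D"])
      fix v and t :: state
      assume "v < reg t2 ''n''" "arr t = arr t2" "reg t ''v'' = v"
      then show "bval ?d t = (v \<in> D)" using in_D t2 by simp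
    next
      assume g: "reg (sem (search ''g'' ''v'' ?d) t2) ''g'' = 0" and none: "\<And>v. v < reg t2 ''n'' \<Longrightarrow> v \<notin> D"
      have "D = {}" using none t2(2) by (auto simp: D_def)
      then have "\<not> R i" using conn_nonempty by (auto simp: R_def D_def)
      moreover have "reg t4 ''g'' = 0" using g t4 t3_def by simp
      ultimately show ?thesis by simp
    next
      fix r assume g: "reg (sem (search ''g'' ''v'' ?d) t2) ''g'' = Suc r" and r: "r < reg t2 ''n''" "r \<in> D"
      have g3: "reg t3 ''g'' = Suc r" using g t3_def by simp
      have R: "R i \<longleftrightarrow> (\<forall>u\<in>D. arr t2 ''lab'' u = arr t2 ''lab'' r)"
        unfolding R_def D_def[symmetric] by (rule conn_iff_components[OF comps r(2)])
      show ?thesis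
      proof (rule search[of "''v''" "''y''" t3 ?d' "\<lambda>v. v \<in> D \<and> arr t2 ''lab'' v \<noteq> arr t2 ''lab'' r"])
        fix v and t :: state
        assume "v < reg t3 ''n''" "arr t = arr t3" "reg t ''v'' = v"
          "\<And>y. y \<noteq> ''y'' \<Longrightarrow> y \<noteq> ''v'' \<Longrightarrow> reg t y = reg t3 y"
        then show "bval ?d' t = (v \<in> D \<and> arr t2 ''lab'' v \<noteq> arr t2 ''lab'' r)"
          using in_D t2 t3 g3 by simp
      next
        assume y: "reg (sem (search ''y'' ''v'' ?d') t3) ''y'' = 0"
          and none: "\<And>v. v < reg t3 ''n'' \<Longrightarrow> \<not> (v \<in> D \<and> arr t2 ''lab'' v \<noteq> arr t2 ''lab'' r)"
        have "u < n" if "u \<in> D" for u using that by (simp add: D_def)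
        then have "R i" unfolding R using none t3(2) by blast
        moreover have "reg t4 ''y'' = 0" using y t4_def by simp
        ultimately show ?thesis using g3 t4 by simp
      next
        fix u assume y: "reg (sem (search ''y'' ''v'' ?d') t3) ''y'' = Suc u"
          and u: "u \<in> D \<and> arr t2 ''lab'' u \<noteq> arr t2 ''lab'' r"
        have "\<not> R i" unfolding R using u by blast
        moreover have "reg t4 ''y'' = Suc u" using y t4_def by simp
        ultimately show ?thesis by simp
      qed simp_all
    qed simp_all
    have c: "sem ?c s' = sem (FIf ?e (FAssign ''f'' (Add (Reg ''x'') (Const 1))) FSkip) t4"
      unfolding t4_def t3_def t2_def t1_def by (simp only: sem.simps(4))
    show "?P (Suc i) (set_reg ''x'' (Suc i) (sem ?c s'))"
    proof (cases "R i")
      case True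
      then have "bval ?e t4" using b by blast
      then have "sem ?c s' = set_reg ''f'' (Suc i) t4" unfolding c using t4(3) by simp
      then show ?thesis using True i by simp
    next
      case False
      then have "\<not> bval ?e t4" using b by blast
      then have "sem ?c s' = t4" unfolding c by (simp only: sem.simps if_False)
      then show ?thesis using False P t4(5) by (auto simp: less_Suc_eq)
    qed
  qed simp_all
  then have "?P n s1" using n by simp
  moreover obtain v0 where "v0 < n" "R v0" using fill_exists[OF fi jB] unfolding R_def by blast
  ultimately obtain v where v: "v < n" "reg s1 ''f'' = Suc v" "R v" by blast
  have s1: "arr s1 ''part'' = ?p" "reg s1 ''j'' = ?j" "built s1 = ?B"
    unfolding s1_def by (simp_all add: built_def del: sem.simps(6))
  have "env ?s" using env by simp
  then have e1: "env s1" unfolding s1_def by (rule env_sem) simp_all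
  define s2 where "s2 = set_arr ''built'' ?j 1 (set_arr ''part'' v ?j s1)"
  have e2: "env s2" unfolding s2_def using e1 by simp
  have s2: "arr s2 ''part'' = ?p(v := ?j)" "built s2 = insert ?j ?B"
    unfolding s2_def using s1 by (auto simp: built_def)
  have "s' = sem pick (sem (FStore ''built'' (Reg ''j'') (Const 1)) (sem (FStore ''part'' (Sub (Reg ''f'') (Const 1)) (Reg ''j'')) s1))"
    unfolding s'_def s1_def fill_def by (simp only: sem.simps(2,4) aval.simps)
  then have s': "s' = sem pick s2" unfolding s2_def using v s1 by simp
  have b': "built s' = insert ?j ?B" "arr s' ''part'' = ?p(v := ?j)" unfolding s' using s2 by (simp_all add: built_def)
  have e': "env s'" unfolding s' by (rule env_sem[OF e2]) simp_all
  have fi': "fill_invar (arr s' ''part'') (built s')" unfolding b'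
    using v(3) by (intro fill_step[OF fi jB v(1)]) (simp_all add: R_def)
  have sub: "insert ?j ?B \<subseteq> {1..k}" using fi' b' by (simp add: fill_invar_def)
  have "fill_inv s'"
  proof (rule pick[OF e2, folded s'])
    assume "reg s' ''j'' = 0" "{1..k} \<subseteq> built s2"
    then show ?thesis using e' fi' sub s2 b' by (auto simp: fill_inv_def)
  next
    assume "reg s' ''j'' \<in> {1..k} - built s2"
    then show ?thesis using e' fi' s2 b' by (auto simp: fill_inv_def)
  qed
  moreover have "card ?B < card (insert ?j ?B)" "card (insert ?j ?B) \<le> k"
    using sub jB finite_subset[OF sub] card_mono[OF _ sub] by simp_all
  ultimately show ?thesis using b' by simp
qed

lemma init:
  assumes es: "edge_list es E" and e: "\<And>s. aval e s = c * arr s ''weight'' (reg s ''v'')"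
  defines "s' \<equiv> sem (init e) (input_state n es w k L)"
  shows "main_inv s'" "work_left s' \<le> k * (k * (2 * n + 1) + 1)"
proof -
  define s where "s = input_state n es w k L"
  have s: "reg s ''n'' = n" "reg s ''m'' = length es" "reg s ''x'' = 0" "reg s ''stop'' = 0"
    "arr s ''weight'' = (\<lambda>v. if v < n then w v else 0)" "arr s ''target'' = (\<lambda>i. if i \<in> {1..k} then L i else 0)"
    "\<And>j. j < length es \<Longrightarrow> arr s ''source'' j = fst (es ! j)" "\<And>j. j < length es \<Longrightarrow> arr s ''sink'' j = snd (es ! j)"
    "arr s ''adj'' = (\<lambda>_. 0)" "arr s ''built'' = (\<lambda>_. 0)"
    by (simp_all add: s_def input_state_def)
  have E: "E = (\<lambda>e. {fst e, snd e}) ` set es"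
    using es by (simp add: edge_list_def case_prod_beta')
  have edges: "{fst (es ! i), snd (es ! i)} \<in> E" if "i < length es" for i
    unfolding E using that by (intro image_eqI[of _ _ "es ! i"]) simp_all
  have edges': "\<exists>i<length es. {fst (es ! i), snd (es ! i)} = d" if d: "d \<in> E" for d
  proof -
    obtain e where e: "e \<in> set es" "{fst e, snd e} = d" using d unfolding E by blast
    obtain i where "i < length es" "es ! i = e" using e(1) by (auto simp: in_set_conv_nth)
    then show ?thesis using e(2) by blast
  qed
  have lt: "fst (es ! i) < n \<and> snd (es ! i) < n" if "i < length es" for i
  proof -
    have "{fst (es ! i), snd (es ! i)} \<subseteq> {..<n}"
      using edges[OF that] simple unfolding simple_graph_def by blast
    then show ?thesis by simp
  qed
  let ?rb = "FSeq (FStore ''row'' (Reg ''v'') (Reg ''x'')) (FAssign ''x'' (Add (Reg ''x'') (Reg ''n'')))"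
  let ?a1 = "FStore ''adj'' (Add (Arr ''row'' (Arr ''source'' (Reg ''u''))) (Arr ''sink'' (Reg ''u''))) (Const 1)"
  let ?a2 = "FStore ''adj'' (Add (Arr ''row'' (Arr ''sink'' (Reg ''u''))) (Arr ''source'' (Reg ''u''))) (Const 1)"
  define s1 where "s1 = sem (FFor ''v'' ''n'' ?rb) s"
  let ?P = "\<lambda>i s'. reg s' ''x'' = i * n \<and> (\<forall>v<i. arr s' ''row'' v = v * n)"
  have "?P (reg s ''n'') s1" unfolding s1_def
  proof (rule for_invariant[where P = ?P])
    fix i s'
    assume fr: "frame (FFor ''v'' ''n'' ?rb) s s'" and x: "reg s' ''v'' = i" and P: "?P i s'"
    have "reg s' ''n'' = n" using fr s by (auto simp: frame_def)
    then show "?P (Suc i) (set_reg ''v'' (Suc i) (sem ?rb s'))" using P x by (simp add: less_Suc_eq)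
  qed (use s in simp_all)
  then have row: "arr s1 ''row'' v = v * n" if "v < n" for v using that s by simp
  have s1: "reg s1 y = reg s y" if "y \<notin> {''v'', ''x''}" for y
    unfolding s1_def using that by (simp del: sem.simps(6))
  have s1': "arr s1 a = arr s a" if "a \<noteq> ''row''" for a
    unfolding s1_def using that by (simp del: sem.simps(6))
  define s2 where "s2 = sem (FFor ''u'' ''m'' (FSeq ?a1 ?a2)) s1"
  let ?I = "\<lambda>i x. x = fst (es ! i) * n + snd (es ! i) \<or> x = snd (es ! i) * n + fst (es ! i)"
  let ?Q = "\<lambda>r s'. \<forall>x. arr s' ''adj'' x = (if \<exists>i<r. ?I i x then 1 else 0)"
  have "?Q (reg s1 ''m'') s2" unfolding s2_def
  proof (rule for_invariant[where P = ?Q])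
    show "?Q 0 (set_reg ''u'' 0 s1)" using s1' s by simp
    fix i s'
    assume "i < reg s1 ''m''" and fr: "frame (FFor ''u'' ''m'' (FSeq ?a1 ?a2)) s1 s'" and x: "reg s' ''u'' = i" and Q: "?Q i s'"
    have i: "i < length es" using \<open>i < _\<close> s1 s by simp
    have a: "arr s' ''source'' = arr s ''source''" "arr s' ''sink'' = arr s ''sink''" "arr s' ''row'' = arr s1 ''row''"
      using fr s1' by (simp_all add: frame_def)
    show "?Q (Suc i) (set_reg ''u'' (Suc i) (sem (FSeq ?a1 ?a2) s'))"
      using Q x a s(7,8)[OF i] lt[OF i] row by (auto simp: less_Suc_eq)
  qed simp_all
  then have adj2: "arr s2 ''adj'' x = (if \<exists>i<length es. ?I i x then 1 else 0)" for x using s1 s by simp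
  have s2: "reg s2 y = reg s y" if "y \<notin> {''v'', ''x'', ''u''}" for y
    unfolding s2_def using that s1 by (simp del: sem.simps(6))
  have s2': "arr s2 a = arr s a" if "a \<notin> {''row'', ''adj''}" for a
    unfolding s2_def using that s1' by (simp del: sem.simps(6))
  have row2: "arr s2 ''row'' v = v * n" if "v < n" for v
    unfolding s2_def using row that by (simp del: sem.simps(6))
  \<comment> \<open>Row-major positions are unique as the second coordinates are below
    \<open>n\<close>, so each matrix entry belongs to one ordered pair.\<close>
  have index: "u * n + v = a * n + b \<longleftrightarrow> u = a \<and> v = b" if "v < n" "b < n" for u v a b
  proof
    assume eq: "u * n + v = a * n + b"
    have "u = (u * n + v) div n" "v = (u * n + v) mod n" using that by simp_all
    then show "u = a \<and> v = b" unfolding eq using that by simp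
  qed simp
  have adj: "arr s2 ''adj'' (arr s2 ''row'' u + v) = 1 \<longleftrightarrow> adj u v" if "u < n" "v < n" for u v
  proof -
    have "?I i (u * n + v) \<longleftrightarrow> {fst (es ! i), snd (es ! i)} = {u, v}" if "i < length es" for i
      using index[OF \<open>v < n\<close>] lt[OF that] by (auto simp: doubleton_eq_iff)
    then have "(\<exists>i<length es. ?I i (u * n + v)) \<longleftrightarrow> (\<exists>i<length es. {fst (es ! i), snd (es ! i)} = {u, v})"
      by blast
    also have "\<dots> \<longleftrightarrow> adj u v" using edges edges' unfolding adj_def by metis
    finally show ?thesis using adj2 row2 that by simp
  qed
  let ?w = "guarded_store ''v'' always ''wgt'' e"
  define s3 where "s3 = sem ?w s2"
  have "arr s3 ''wgt'' = (\<lambda>v. if v < reg s2 ''n'' \<and> True then c * arr s2 ''weight'' v else arr s2 ''wgt'' v)"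
    unfolding s3_def by (rule guarded_store) (auto simp: e)
  then have wgt: "arr s3 ''wgt'' v = c * w v" if "v < n" for v using that s2 s2' s by simp
  have e3: "env s3" unfolding env_def
    using wgt adj s2 s2' s unfolding s3_def by simp
  have b3: "built s3 = {}" unfolding s3_def built_def using s2' s by simp
  define s4 where "s4 = sem pick s3"
  define j where "j = reg s4 ''j''"
  have j: "j \<in> {1..k}" "\<And>i. i \<in> {1..k} \<Longrightarrow> L i \<le> L j"
  proof -
    have "j \<in> {1..k} \<and> (\<forall>i\<in>{1..k}. L i \<le> L j)"
    proof (rule pick[OF e3, folded s4_def, folded j_def])
      assume "{1..k} \<subseteq> built s3"
      then show ?thesis using b3 k by simp
    qed (simp_all add: b3)
    then show "j \<in> {1..k}" "\<And>i. i \<in> {1..k} \<Longrightarrow> L i \<le> L j" by blast+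
  qed
  let ?p = "guarded_store ''v'' always ''part'' (Reg ''j'')"
  define s5 where "s5 = sem ?p s4"
  have e4: "env s4" unfolding s4_def by (rule env_sem[OF e3]) simp_all
  have e5: "env s5" unfolding s5_def by (rule env_sem[OF e4]) simp_all
  have s5: "built s5 = {}" "reg s5 ''j'' = j" "reg s5 ''stop'' = 0"
    using b3 s2 s unfolding s5_def s4_def j_def s3_def by (simp_all add: built_def)
  have "arr s5 ''part'' = (\<lambda>v. if v < reg s4 ''n'' \<and> True then j else arr s4 ''part'' v)"
    unfolding s5_def by (rule guarded_store) (auto simp: j_def)
  then have part: "arr s5 ''part'' v = j" if "v < n" for v using that e4 by (simp add: env_def)
  have fibj: "fib (arr s5 ''part'') j = {..<n}" using part by auto
  \<comment> \<open>Connectedness of the graph itself is the case of removing no vertex, which is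
    allowed as \<open>0 < k\<close>.\<close>
  have "connected_graph ({..<n} - {}) (induced_edges E ({..<n} - {}))"
    using inst k unfolding gl_instance_def k_connected_def by (metis card.empty empty_subsetI less_eq_Suc_le One_nat_def)
  then have "conn {..<n}" by (simp add: connected_graph_iff_conn)
  moreover have "L j \<le> wt {..<n}"
  proof -
    have "L j \<le> (\<Sum>i=1..k. L i)" using j(1) by (intro member_le_sum) auto
    also have "\<dots> \<le> wt {..<n}" using c by (simp add: wt_all)
    finally show ?thesis .
  qed
  ultimately have parts: "parts_invar (arr s5 ''part'') (insert j {})"
    using j part fibj by (simp add: parts_invar_def)
  have "s' = sem next_phase s5"
    unfolding s'_def s5_def s4_def s3_def s2_def s1_def s_def init_def by (simp only: sem.simps(4))
  moreover have "reg s5 ''j'' \<in> {1..k} - built s5" using s5 j by simp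
  moreover have "parts_invar (arr s5 ''part'') (insert (reg s5 ''j'') (built s5))" using parts s5 by simp
  ultimately show "main_inv s'" "work_left s' \<le> k * (k * (2 * n + 1) + 1)"
    using next_phase(1)[OF e5] next_phase(3)[OF e5] s5 by simp_all
qed

end

section \<open>Correctness and running time\<close>

context partition_instance
begin

text \<open>Initialisation also loops over the edges and is charged with \<open>n + card E\<close>;
  the loops inside the rounds are bounded by \<open>n\<close> only, and their nesting depth 2 gives
  the square.\<close>

lemma main_phase:
  assumes es: "edge_list es E" and e: "\<And>s. aval e s = c * arr s ''weight'' (reg s ''v'')"
  obtains t s where
    "exec (Seq (compile (init e)) (While main_guard (compile main_body))) (input_state n es w k L) t s"
    "t \<le> factor (init e) * (n + card E + 1) +
      (k * (k * (2 * n + 1) + 1) + 1) * ((factor main_body + bcost main_guard + 1) * (n + 1)\<^sup>2)"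
    "main_inv s" "\<not> bval main_guard s"
proof -
  let ?s = "input_state n es w k L"
  let ?s1 = "sem (init e) ?s"
  have len: "length es = card E" using es distinct_card unfolding edge_list_def by fastforce
  have N: "reg ?s y \<le> n + card E" if "y \<in> {''n'', ''m''}" for y
    using that len by (auto simp: input_state_def)
  from exec_compile[OF fill_init_simps(3) N] obtain t1 where t1: "exec (compile (init e)) ?s t1 ?s1"
    "t1 \<le> factor (init e) * (n + card E + 1)" by (auto simp: fill_init_simps)
  note init = init[OF es e]
  have N': "reg ?s1 y \<le> n" if "y \<in> {''n''}" for y using init(1) that by (auto simp: main_inv_def env_def)
  have step: "main_inv (sem main_body s) \<and> work_left (sem main_body s) < work_left s"
    if "main_inv s" "bval main_guard s" for s
    using main_body[OF that(1)] that(2) by (simp add: main_guard_def)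
  from exec_while[where Q = main_inv and \<mu> = work_left, OF main_body_simps(1) N' init(1) step]
  obtain t2 s where s: "exec (While main_guard (compile main_body)) ?s1 t2 s" "main_inv s" "\<not> bval main_guard s"
    and t2: "t2 \<le> (work_left ?s1 + 1) * ((factor main_body + bcost main_guard + 1) * (n + 1) ^ depth main_body)"
    by blast
  have "t2 \<le> (k * (k * (2 * n + 1) + 1) + 1) * ((factor main_body + bcost main_guard + 1) * (n + 1)\<^sup>2)"
    using t2 init(2) unfolding main_body_simps(2)
    by (meson add_le_mono1 mult_le_mono1 order_trans)
  then show ?thesis using that[OF exec.Seq[OF t1(1) s(1)] _ s(2,3)] t1(2) by simp
qed

lemma exit_main:
  assumes "main_inv s" "\<not> bval main_guard s"
  shows "parts_invar (arr s ''part'') (built s)"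
    "built s = {1..k} \<or> (\<forall>b\<in>built s. \<not> heavy (arr s ''part'') b)"
    "if reg s ''j'' = 0 then built s = {1..k} else reg s ''j'' \<in> {1..k} - built s"
proof -
  consider "reg s ''j'' = 0" "built s = {1..k}" "parts_invar (arr s ''part'') (built s)"
    | "reg s ''j'' \<noteq> 0" "\<forall>b\<in>built s. \<not> heavy (arr s ''part'') b"
      "invar (arr s ''part'') (arr s ''lab'') (arr s ''cen'') (built s) (reg s ''j'')"
    using assms by (auto simp: main_inv_def main_guard_def)
  then have "parts_invar (arr s ''part'') (built s) \<and>
    (built s = {1..k} \<or> (\<forall>b\<in>built s. \<not> heavy (arr s ''part'') b)) \<and>
    (if reg s ''j'' = 0 then built s = {1..k} else reg s ''j'' \<in> {1..k} - built s)"
  proof cases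
    case 2
    interpret phase n E w k L c "arr s ''part''" "arr s ''lab''" "arr s ''cen''" "built s" "reg s ''j''"
      using 2 by unfold_locales
    show ?thesis using 2 parts_invar invB(2,3) by simp
  qed simp
  then show "parts_invar (arr s ''part'') (built s)"
    "built s = {1..k} \<or> (\<forall>b\<in>built s. \<not> heavy (arr s ''part'') b)"
    "if reg s ''j'' = 0 then built s = {1..k} else reg s ''j'' \<in> {1..k} - built s" by blast+
qed

text \<open>The main loop takes at most \<open>5 * (k * k * n)\<close> rounds of order
  \<open>n\<^sup>2\<close>, and the spare factor \<open>k * n\<close> is at most
  \<open>2 * card E\<close>; with \<open>n + 1 \<le> 2 * n\<close> this gives 40 = 5 * 4 * 2. In the
  same way filling gives 32 = 2 * 8 * 2, using \<open>n \<le> 2 * card E\<close>.\<close>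

lemma total_time:
  assumes "t1 \<le> a * (n + card E + 1) + (k * (k * (2 * n + 1) + 1) + 1) * (b * (n + 1)\<^sup>2)"
    and "t2 \<le> (k + 1) * (d * (n + 1) ^ 3)"
  shows "t1 + t2 \<le> (3 * a + 40 * b + 32 * d) * (k * n\<^sup>2 * card E)"
proof -
  let ?m = "card E" and ?K = "k * n\<^sup>2 * card E"
  have k1: "1 \<le> k" and n2: "2 \<le> n" using k by simp_all
  have km: "k * n \<le> 2 * ?m" by (rule edge_count)
  have "1 * n \<le> k * n" using k1 by (rule mult_le_mono1)
  then have nm: "n \<le> 2 * ?m" using km by linarith
  then have m1: "1 \<le> ?m" using n2 by linarith
  have "n * 1 \<le> n * (n * (k * ?m))" using n2 k1 m1 by (intro mult_le_mono2) simp
  moreover have "n * (n * (k * ?m)) = ?K" by (simp add: power2_eq_square ac_simps)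
  moreover have "1 * ?m \<le> (k * n\<^sup>2) * ?m" using n2 k1 by (intro mult_le_mono1) simp
  ultimately have "n + ?m + 1 \<le> 3 * ?K" using m1 by linarith
  then have A: "a * (n + ?m + 1) \<le> a * (3 * ?K)" by (rule mult_le_mono2)
  have sq: "(n + 1)\<^sup>2 \<le> (2 * n)\<^sup>2" "(n + 1) ^ 3 \<le> (2 * n) ^ 3" using n2 by (intro power_mono; simp)+
  have "k * (k * (2 * n + 1) + 1) + 1 \<le> 5 * (k * k * n)"
  proof -
    have "k * k * 1 \<le> k * k * n" using n2 by (intro mult_le_mono2) simp
    moreover have "k * 1 \<le> k * k" using k1 by (rule mult_le_mono2)
    moreover have "k * (k * (2 * n + 1) + 1) + 1 = 2 * (k * k * n) + k * k + k + 1" by (simp add: algebra_simps)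
    ultimately show ?thesis using k1 by linarith
  qed
  then have "(k * (k * (2 * n + 1) + 1) + 1) * (b * (n + 1)\<^sup>2) \<le> 5 * (k * k * n) * (b * (2 * n)\<^sup>2)"
    using sq(1) by (intro mult_le_mono) auto
  also have "\<dots> = (20 * b * k * n\<^sup>2) * (k * n)" by (simp add: power2_eq_square algebra_simps)
  also have "\<dots> \<le> (20 * b * k * n\<^sup>2) * (2 * ?m)" using km by (rule mult_le_mono2)
  finally have B: "(k * (k * (2 * n + 1) + 1) + 1) * (b * (n + 1)\<^sup>2) \<le> 40 * b * ?K" by (simp add: ac_simps)
  have "(k + 1) * (d * (n + 1) ^ 3) \<le> (2 * k) * (d * (2 * n) ^ 3)"
    using sq(2) k1 by (intro mult_le_mono) auto
  also have "\<dots> = (16 * d * k * n\<^sup>2) * n" by (simp add: power2_eq_square power3_eq_cube algebra_simps)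
  also have "\<dots> \<le> (16 * d * k * n\<^sup>2) * (2 * ?m)" using nm by (rule mult_le_mono2)
  finally have D: "(k + 1) * (d * (n + 1) ^ 3) \<le> 32 * d * ?K" by (simp add: ac_simps)
  have "(3 * a + 40 * b + 32 * d) * ?K = a * (3 * ?K) + 40 * b * ?K + 32 * d * ?K" by (simp add: algebra_simps)
  then show ?thesis using A B D assms by linarith
qed

lemma fill_phase:
  fixes s :: state
  assumes Q: "Q s" "reg s ''n'' = n"
    and step: "\<And>s. Q s \<Longrightarrow> bval fill_guard s \<Longrightarrow> Q (sem fill s) \<and> k - card (built (sem fill s)) < k - card (built s)"
  obtains t s' where "exec (While fill_guard (compile fill)) s t s'" "Q s'" "\<not> bval fill_guard s'"
    "t \<le> (k + 1) * ((factor fill + bcost fill_guard + 1) * (n + 1) ^ 3)"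
proof -
  have N: "reg s y \<le> n" if "y \<in> {''n''}" for y using Q(2) that by simp
  from exec_while[where Q = Q and \<mu> = "\<lambda>s. k - card (built s)", OF fill_init_simps(1) N Q(1) step]
  obtain t s' where s': "exec (While fill_guard (compile fill)) s t s'" "Q s'" "\<not> bval fill_guard s'"
    and t: "t \<le> (k - card (built s) + 1) * ((factor fill + bcost fill_guard + 1) * (n + 1) ^ depth fill)"
    by blast
  have "t \<le> (k + 1) * ((factor fill + bcost fill_guard + 1) * (n + 1) ^ 3)"
    using t unfolding fill_init_simps(2) by (rule order_trans) (intro mult_le_mono1, simp)
  then show ?thesis using that[OF s'] by blast
qed

text \<open>The predicate \<open>Q\<close> stands for whatever a version needs during filling up, so
  both versions share the program scheme and its time bound.\<close>

lemma run:
  assumes es: "edge_list es E" and e: "\<And>s. aval e s = c * arr s ''weight'' (reg s ''v'')"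
    and post: "\<And>s. main_inv s \<Longrightarrow> \<not> bval main_guard s \<Longrightarrow> Q s"
    and step: "\<And>s. Q s \<Longrightarrow> bval fill_guard s \<Longrightarrow> Q (sem fill s) \<and> k - card (built (sem fill s)) < k - card (built s)"
  shows "\<exists>t s. exec (program e) (input_state n es w k L) t s \<and>
    t \<le> time_factor e * (k * n\<^sup>2 * card E) \<and> Q s \<and> reg s ''j'' = 0"
proof -
  obtain t1 s1 where 1: "exec (Seq (compile (init e)) (While main_guard (compile main_body))) (input_state n es w k L) t1 s1"
    "t1 \<le> factor (init e) * (n + card E + 1) +
      (k * (k * (2 * n + 1) + 1) + 1) * ((factor main_body + bcost main_guard + 1) * (n + 1)\<^sup>2)"
    "main_inv s1" "\<not> bval main_guard s1"
    using main_phase[OF es e] by blast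
  have "reg s1 ''n'' = n" using 1(3) by (auto simp: main_inv_def env_def)
  then obtain t2 s2 where 2: "exec (While fill_guard (compile fill)) s1 t2 s2" "Q s2" "\<not> bval fill_guard s2"
    "t2 \<le> (k + 1) * ((factor fill + bcost fill_guard + 1) * (n + 1) ^ 3)"
    using fill_phase[of Q s1, OF post[OF 1(3,4)] _ step] by blast
  from 1(1) obtain u v s where "exec (compile (init e)) (input_state n es w k L) u s"
    "exec (While main_guard (compile main_body)) s v s1" "t1 = u + v"
    by (cases rule: exec.cases) simp_all
  then have "exec (program e) (input_state n es w k L) (t1 + t2) s2"
    unfolding program_def using exec.Seq[OF _ exec.Seq[OF _ 2(1)]] by (simp add: add.assoc)
  moreover have "t1 + t2 \<le> time_factor e * (k * n\<^sup>2 * card E)"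
    unfolding time_factor_def by (rule total_time[OF 1(2) 2(4)])
  moreover have "reg s2 ''j'' = 0" using 2(3) by (simp add: fill_guard_def)
  ultimately show ?thesis using 2(2) by blast
qed

lemma output_part: "output_part n s i = fib (arr s ''part'') i"
  by (auto simp: output_part_def)

end

theorem theorem6:
  "(\<exists>p C. \<forall>n E w k ws es.
      gl_instance {..<n} E w k ws \<longrightarrow> edge_list es E \<longrightarrow>
      (\<exists>t s. exec p (input_state n es w k ws) t s \<and>
             t \<le> C * (k * (card {..<n})\<^sup>2 * card E) \<and>
             connected_partition {..<n} E k (output_part n s) \<and>
             (\<forall>i\<in>{1..k}. real (\<Sum>v\<in>output_part n s i. w v) \<ge> 1/3 * real (ws i))))
   \<and>
   (\<exists>p C. \<forall>n E w k ws es.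
      gl_instance {..<n} E w k ws \<longrightarrow> edge_list es E \<longrightarrow>
      (\<exists>t s. exec p (input_state n es w k ws) t s \<and>
             t \<le> C * (k * (card {..<n})\<^sup>2 * card E) \<and>
             connected_partition {..<n} E k (output_part n s) \<and>
             (\<forall>i\<in>{1..k}. real (\<Sum>v\<in>output_part n s i. w v) \<le> 3 * real (ws i))))"
proof (intro conjI)
  let ?w = "Arr ''weight'' (Reg ''v'')"
  let ?e = "Add ?w (Add ?w ?w)"
  show "\<exists>p C. \<forall>n E w k ws es.
      gl_instance {..<n} E w k ws \<longrightarrow> edge_list es E \<longrightarrow>
      (\<exists>t s. exec p (input_state n es w k ws) t s \<and>
             t \<le> C * (k * (card {..<n})\<^sup>2 * card E) \<and>
             connected_partition {..<n} E k (output_part n s) \<and>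
             (\<forall>i\<in>{1..k}. real (\<Sum>v\<in>output_part n s i. w v) \<ge> 1/3 * real (ws i)))"
  proof (rule exI[of _ "program ?e"], rule exI[of _ "time_factor ?e"], intro allI impI)
    fix n E w k ws es
    assume inst: "gl_instance {..<n} E w k ws" and es: "edge_list es E"
    interpret partition_instance n E w k ws 3 using inst by unfold_locales simp_all
    let ?Q = "\<lambda>s. reg s ''j'' = 0 \<and> built s = {1..k} \<and> parts_invar (arr s ''part'') {1..k}"
    have "?Q s" if "main_inv s" "\<not> bval main_guard s" for s
    proof -
      note x = exit_main[OF that]
      have "built s = {1..k}" by (rule lower_bound(1)[OF x(1) _ x(2)]) simp
      then show ?thesis using x(1,3) by (auto split: if_splits)
    qed
    \<comment> \<open>All targets are served when the main loop ends, so \<open>?Q\<close> contains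
      \<open>j = 0\<close> and the filling loop is never entered.\<close>
    then have "\<exists>t s. exec (program ?e) (input_state n es w k ws) t s \<and>
        t \<le> time_factor ?e * (k * n\<^sup>2 * card E) \<and> ?Q s \<and> reg s ''j'' = 0"
      by (rule run[OF es, rotated]) (simp_all add: fill_guard_def)
    then obtain t s where s: "exec (program ?e) (input_state n es w k ws) t s"
        "t \<le> time_factor ?e * (k * n\<^sup>2 * card E)" and P: "parts_invar (arr s ''part'') {1..k}" by blast
    have "connected_partition {..<n} E k (output_part n s)"
      unfolding output_part[abs_def] using P by (intro connected_partition) (auto simp: parts_invar_def)
    moreover have "real (\<Sum>v\<in>output_part n s i. w v) \<ge> 1/3 * real (ws i)" if "i \<in> {1..k}" for i
    proof -
      have "ws i \<le> 3 * (\<Sum>v\<in>output_part n s i. w v)"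
        unfolding output_part by (rule lower_bound(2)[OF P _ _ that]) simp_all
      then have "real (ws i) \<le> real (3 * (\<Sum>v\<in>output_part n s i. w v))" by (simp only: of_nat_le_iff)
      then show ?thesis by simp
    qed
    ultimately show "\<exists>t s. exec (program ?e) (input_state n es w k ws) t s \<and>
             t \<le> time_factor ?e * (k * (card {..<n})\<^sup>2 * card E) \<and>
             connected_partition {..<n} E k (output_part n s) \<and>
             (\<forall>i\<in>{1..k}. real (\<Sum>v\<in>output_part n s i. w v) \<ge> 1/3 * real (ws i))"
      using s unfolding card_lessThan by blast
  qed
  show "\<exists>p C. \<forall>n E w k ws es.
      gl_instance {..<n} E w k ws \<longrightarrow> edge_list es E \<longrightarrow>
      (\<exists>t s. exec p (input_state n es w k ws) t s \<and>
             t \<le> C * (k * (card {..<n})\<^sup>2 * card E) \<and>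
             connected_partition {..<n} E k (output_part n s) \<and>
             (\<forall>i\<in>{1..k}. real (\<Sum>v\<in>output_part n s i. w v) \<le> 3 * real (ws i)))"
  proof (rule exI[of _ "program ?w"], rule exI[of _ "time_factor ?w"], intro allI impI)
    fix n E w k ws es
    assume inst: "gl_instance {..<n} E w k ws" and es: "edge_list es E"
    interpret partition_instance n E w k ws 1 using inst by unfold_locales simp_all
    note One_nat_def [simp del]
    have "fill_inv s" if "main_inv s" "\<not> bval main_guard s" for s
    proof -
      note x = exit_main[OF that]
      have "fill_invar (arr s ''part'') (built s)" by (rule upper_bound[OF x(1) _ x(2)]) simp
      then show ?thesis using x(3) that(1) by (simp add: fill_inv_def main_inv_def)
    qed
    then have "\<exists>t s. exec (program ?w) (input_state n es w k ws) t s \<and>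
        t \<le> time_factor ?w * (k * n\<^sup>2 * card E) \<and> fill_inv s \<and> reg s ''j'' = 0"
      by (rule run[OF es, rotated]) (use fill in \<open>simp_all add: fill_guard_def\<close>)
    then obtain t s where s: "exec (program ?w) (input_state n es w k ws) t s"
        "t \<le> time_factor ?w * (k * n\<^sup>2 * card E)" and P: "fill_invar (arr s ''part'') {1..k}"
      by (auto simp: fill_inv_def)
    have "connected_partition {..<n} E k (output_part n s)"
      unfolding output_part[abs_def] using P by (intro connected_partition) (auto simp: fill_invar_def)
    moreover have "real (\<Sum>v\<in>output_part n s i. w v) \<le> 3 * real (ws i)" if "i \<in> {1..k}" for i
    proof -
      have "(\<Sum>v\<in>output_part n s i. w v) \<le> 3 * ws i"
        unfolding output_part using P that by (simp add: fill_invar_def)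
      then have "real (\<Sum>v\<in>output_part n s i. w v) \<le> real (3 * ws i)" by (simp only: of_nat_le_iff)
      then show ?thesis by simp
    qed
    ultimately show "\<exists>t s. exec (program ?w) (input_state n es w k ws) t s \<and>
             t \<le> time_factor ?w * (k * (card {..<n})\<^sup>2 * card E) \<and>
             connected_partition {..<n} E k (output_part n s) \<and>
             (\<forall>i\<in>{1..k}. real (\<Sum>v\<in>output_part n s i. w v) \<le> 3 * real (ws i))"
      using s unfolding card_lessThan by blast
  qed
qed

end
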